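(* The candidate surface branched covers of degree $d$ inducing a candidate 2-orbifold cover $S(3,3,3)\dashrightarrow S(3,3,3)$ are the following, with $\widetilde\Sigma=\Sigma=S$ and $k\geq 1$: \begin{enumerate} \item $d=3k+1$, partitions $(3^k,1),(3^k,1),(3^k,1)$; \item $d=3k+3$, partitions $(3^{k+1}),(3^{k+1}),(3^k,1,1,1)$; \end{enumerate} and they are realizable if and only if, respectively: \begin{enumerate} \item $d=x^2+xy+y^2$ with $x,y\in\mathbb{N}$ and $x\not\equiv y\pmod 3$; \item $d=3(x^2+3xy+3y^2)$ with $x,y\in\mathbb{N}$. \end{enumerate}
   Context: $\mathbb{N}$ denotes the non-negative integers and $S$ the 2-sphere. A partition of $d$ is a finite unordered list (multiset) of positive integers with sum $d$; $\ell(\Pi)$ is the number of entries of $\Pi$; $(a^m,b,\ldots)$ means that $a$ is repeated $m$ times. For closed connected orientable surfaces $\widetilde\Sigma,\Sigma$, a branched cover $f:\widetilde\Sigma\to\Sigma$ is a map locally modelled on $(\mathbb{C},0)\to(\mathbb{C},0)$, $z\mapsto z^k$ with $k\geq 1$; $k$ is the local degree at the source point, and a point of $\Sigma$ having a preimage with local degree $>1$ is a branching point. The degree $d$ of $f$ is the degree of the genuine cover obtained by removing the branching points and their preimages; the local degrees at the preimages of a branching point form a partition of $d$. A candidate surface branched cover consists of closed connected orientable surfaces $\widetilde\Sigma,\Sigma$ (up to homeomorphism), integers $d\geq 2$ and $n\geq 1$, and an unordered collection (repetitions allowed) $\Pi_1,\ldots,\Pi_n$ of partitions of $d$, each with at least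 one entry $>1$, satisfying the Riemann-Hurwitz condition $\chi(\widetilde\Sigma)-\sum_i\ell(\Pi_i)=d\,(\chi(\Sigma)-n)$. It is realizable if there is a degree-$d$ branched cover $f:\widetilde\Sigma\to\Sigma$ with $n$ branching points whose associated partitions of local degrees are $\Pi_1,\ldots,\Pi_n$. A 2-orbifold $\Sigma(p_1,\ldots,p_n)$ is a closed connected orientable surface $\Sigma$ with $n$ cone points of orders $p_i\geq 2$. With $\Pi_i=(d_{ij})_j$, set $p_i=\mathrm{lcm}_j\, d_{ij}$ and $p_{ij}=p_i/d_{ij}$. The induced candidate 2-orbifold cover is $\widetilde X\dashrightarrow X$ with $X=\Sigma(p_1,\ldots,p_n)$ and $\widetilde X=\widetilde\Sigma((p_{ij})_{i,j})$, where orders equal to $1$ are dropped. *)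

theory Defs
  imports
    "HOL-Analysis.Analysis"
    "HOL-Homology.Homology"
    "HOL-Number_Theory.Cong"
    "HOL-Library.Multiset"
begin

section \<open>Closed connected orientable surfaces\<close>

definition locally_planar :: "'a topology \<Rightarrow> bool" where
  "locally_planar X \<longleftrightarrow>
     (\<forall>x\<in>topspace X. \<exists>U (D :: complex set).
        openin X U \<and> x \<in> U \<and> open D \<and> subtopology X U homeomorphic_space top_of_set D)"

text \<open>
  Orientations are taken in the usual homological sense: a choice, for every point \<open>x\<close>, of a
  generator of the local homology group $H_2(X, X - x)$ (infinite cyclic on a surface), such that
  near every point the choices all come from one class in $H_2(X, X - U)$.
\<close>

definition orientation :: "'a topology \<Rightarrow> ('a \<Rightarrow> 'a chain set) \<Rightarrow> bool" where
  "orientation X \<mu> \<longleftrightarrow>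
     (\<forall>x\<in>topspace X.
        \<mu> x \<in> carrier (relative_homology_group 2 X (topspace X - {x})) \<and>
        generate (relative_homology_group 2 X (topspace X - {x})) {\<mu> x}
          = carrier (relative_homology_group 2 X (topspace X - {x}))) \<and>
     (\<forall>x\<in>topspace X. \<exists>U \<alpha>.
        openin X U \<and> x \<in> U \<and>
        \<alpha> \<in> carrier (relative_homology_group 2 X (topspace X - U)) \<and>
        (\<forall>y\<in>U. hom_induced 2 X (topspace X - U) X (topspace X - {y}) id \<alpha> = \<mu> y))"

definition closed_orientable_surface :: "'a topology \<Rightarrow> bool" where
  "closed_orientable_surface X \<longleftrightarrow>
     topspace X \<noteq> {} \<and> connected_space X \<and> compact_space X \<and> Hausdorff_space X \<and>
     locally_planar X \<and> (\<exists>\<mu>. orientation X \<mu>)"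

definition int_independent :: "('g, 'm) monoid_scheme \<Rightarrow> 'g set \<Rightarrow> bool" where
  "int_independent G B \<longleftrightarrow>
     finite B \<and> B \<subseteq> carrier G \<and>
     (\<forall>c :: 'g \<Rightarrow> int.
        finprod G (\<lambda>b. b [^]\<^bsub>G\<^esub> c b) B = \<one>\<^bsub>G\<^esub> \<longrightarrow> (\<forall>b\<in>B. c b = 0))"

text \<open>
  The rank of an abelian group; meaningful when it is finite, as it is for the homology groups of a
  compact manifold.
\<close>

definition abelian_rank :: "('g, 'm) monoid_scheme \<Rightarrow> nat" where
  "abelian_rank G = Sup {card B | B. int_independent G B}"

definition betti :: "nat \<Rightarrow> 'a topology \<Rightarrow> nat" where
  "betti p X = abelian_rank (homology_group (int p) X)"

definition euler_char :: "'a topology \<Rightarrow> int" where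
  "euler_char X = (\<Sum>p | betti p X \<noteq> 0. (- 1) ^ p * int (betti p X))"

abbreviation sphere2 :: "(nat \<Rightarrow> real) topology" where
  "sphere2 \<equiv> nsphere 2"

section \<open>Branched covers\<close>

text \<open>
  \<open>f\<close> has local degree \<open>k\<close> at \<open>x\<close> if charts centred at \<open>x\<close> and \<open>f x\<close> turn it into $z \mapsto z^k$.
\<close>

definition has_local_degree ::
    "'a topology \<Rightarrow> 'b topology \<Rightarrow> ('a \<Rightarrow> 'b) \<Rightarrow> 'a \<Rightarrow> nat \<Rightarrow> bool" where
  "has_local_degree X Y f x k \<longleftrightarrow>
     k \<ge> 1 \<and>
     (\<exists>U V (D :: complex set) (E :: complex set) \<phi> \<psi>.
        openin X U \<and> x \<in> U \<and> openin Y V \<and> f ` U \<subseteq> V \<and>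
        open D \<and> homeomorphic_map (subtopology X U) (top_of_set D) \<phi> \<and> \<phi> x = 0 \<and>
        open E \<and> homeomorphic_map (subtopology Y V) (top_of_set E) \<psi> \<and> \<psi> (f x) = 0 \<and>
        (\<forall>u\<in>U. \<psi> (f u) = \<phi> u ^ k))"

definition branched_cover :: "'a topology \<Rightarrow> 'b topology \<Rightarrow> ('a \<Rightarrow> 'b) \<Rightarrow> bool" where
  "branched_cover X Y f \<longleftrightarrow>
     closed_orientable_surface X \<and> closed_orientable_surface Y \<and> continuous_map X Y f \<and>
     (\<forall>x\<in>topspace X. \<exists>k. has_local_degree X Y f x k)"

definition local_degree :: "'a topology \<Rightarrow> 'b topology \<Rightarrow> ('a \<Rightarrow> 'b) \<Rightarrow> 'a \<Rightarrow> nat" where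
  "local_degree X Y f x = (THE k. has_local_degree X Y f x k)"

definition fibre :: "'a topology \<Rightarrow> ('a \<Rightarrow> 'b) \<Rightarrow> 'b \<Rightarrow> 'a set" where
  "fibre X f y = {x \<in> topspace X. f x = y}"

definition branching_points :: "'a topology \<Rightarrow> 'b topology \<Rightarrow> ('a \<Rightarrow> 'b) \<Rightarrow> 'b set" where
  "branching_points X Y f = {y \<in> topspace Y. \<exists>x\<in>fibre X f y. local_degree X Y f x > 1}"

text \<open>
  The degree of the genuine cover left after deleting the branching points and their preimages,
  i.e. the number of points in each of its fibres (with \<open>d \<ge> 1\<close>, as infinite sets have \<open>card\<close> 0).
\<close>

definition has_degree :: "'a topology \<Rightarrow> 'b topology \<Rightarrow> ('a \<Rightarrow> 'b) \<Rightarrow> nat \<Rightarrow> bool" where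
  "has_degree X Y f d \<longleftrightarrow>
     d \<ge> 1 \<and> (\<forall>y\<in>topspace Y - branching_points X Y f. card (fibre X f y) = d)"

definition local_degrees :: "'a topology \<Rightarrow> 'b topology \<Rightarrow> ('a \<Rightarrow> 'b) \<Rightarrow> 'b \<Rightarrow> nat multiset" where
  "local_degrees X Y f y = image_mset (local_degree X Y f) (mset_set (fibre X f y))"

section \<open>Candidate surface branched covers and realizability\<close>

definition partition_of :: "nat \<Rightarrow> nat multiset \<Rightarrow> bool" where
  "partition_of d P \<longleftrightarrow> 0 \<notin># P \<and> sum_mset P = d"

text \<open>
  The unordered collection of partitions is a multiset \<open>Ps\<close>, and the number $n$ of branching points
  is its size. Surfaces are given as spaces; everything below depends on them only up to
  homeomorphism.
\<close>

definition candidate_branched_cover ::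
    "'a topology \<Rightarrow> 'b topology \<Rightarrow> nat \<Rightarrow> nat multiset multiset \<Rightarrow> bool" where
  "candidate_branched_cover X Y d Ps \<longleftrightarrow>
     closed_orientable_surface X \<and> closed_orientable_surface Y \<and> d \<ge> 2 \<and> size Ps \<ge> 1 \<and>
     (\<forall>P\<in>#Ps. partition_of d P \<and> (\<exists>e\<in>#P. e > 1)) \<and>
     euler_char X - (\<Sum>P\<in>#Ps. int (size P)) = int d * (euler_char Y - int (size Ps))"

definition realizable ::
    "'a topology \<Rightarrow> 'b topology \<Rightarrow> nat \<Rightarrow> nat multiset multiset \<Rightarrow> bool" where
  "realizable X Y d Ps \<longleftrightarrow>
     (\<exists>f. branched_cover X Y f \<and> has_degree X Y f d \<and> finite (branching_points X Y f) \<and>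
        image_mset (local_degrees X Y f) (mset_set (branching_points X Y f)) = Ps)"

section \<open>Induced orbifold covers\<close>

text \<open>A 2-orbifold is given by its underlying surface and the multiset of its cone orders.\<close>

type_synonym 'a orbifold2 = "'a topology \<times> nat multiset"

definition same_orbifold :: "'a orbifold2 \<Rightarrow> 'b orbifold2 \<Rightarrow> bool" where
  "same_orbifold A B \<longleftrightarrow> fst A homeomorphic_space fst B \<and> snd A = snd B"

definition cone_order :: "nat multiset \<Rightarrow> nat" where
  "cone_order P = Lcm (set_mset P)"

definition induced_base :: "'b topology \<Rightarrow> nat multiset multiset \<Rightarrow> 'b orbifold2" where
  "induced_base Y Ps = (Y, filter_mset (\<lambda>p. p \<noteq> 1) (image_mset cone_order Ps))"

definition induced_total :: "'a topology \<Rightarrow> nat multiset multiset \<Rightarrow> 'a orbifold2" where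
  "induced_total X Ps =
     (X, filter_mset (\<lambda>p. p \<noteq> 1) (\<Sum>P\<in>#Ps. image_mset (\<lambda>e. cone_order P div e) P))"

definition S333 :: "(nat \<Rightarrow> real) orbifold2" where
  "S333 = (sphere2, {#3, 3, 3#})"

end

theory Submission
  imports Defs
begin

text \<open>
  The orbifold \<open>S(3,3,3)\<close> is the quotient of the plane by the group \<open>\<Gamma>\<close> generated by the translations
  by Eisenstein integers and the rotation \<open>omega\<close> of order 3. The quotient map \<open>P\<close> is written down
  explicitly: three unimodular numbers of product 1 are determined up to cyclic rotation by their sum
  and their Vandermonde product, and the surface swept out by these two values is star-shaped about
  the origin, hence a sphere.

  Multiplication by an Eisenstein integer \<open>l\<close> descends through \<open>P\<close> to a branched cover of degree
  \<open>|l|^2\<close>; its ramification depends only on whether \<open>1 - omega\<close> divides \<open>l\<close>. Conversely, move the cone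
  points of \<open>P\<close> onto the branching points of a given cover \<open>f\<close>. As all local degrees of \<open>f\<close> divide 3,
  \<open>P\<close> lifts through \<open>f\<close> over the whole plane. A lift that sends a cone point to a point of local degree
  1 is invariant under the rotation about it, so its periods form an ideal of the Eisenstein
  integers; the index of this ideal is the degree of \<open>f\<close>, and it is the norm of a generator.
\<close>

section \<open>Eisenstein integers\<close>

text \<open>A branched cover is given by topological charts only, so \<open>f\<close> carries no
  complex structure to transport. This costs nothing: there are exactly three branching points, as
  many as \<open>P\<close> has cone points, and a homeomorphism of the sphere can match them. The
  obstacle is lifting across a cone point, where \<open>P\<close> is not a covering: over a point of
  local degree 3 a lift needs a continuous cube root of \<open>P\<close> in a chart, and one exists
  because \<open>P\<close> itself depends only on the cube of the coordinate. In both families some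
  partition contains an entry 1; it supplies the point of local degree 1 over the cone point 0. The
  field of residues modulo \<open>1 - omega\<close> has three elements, which label the three cone
  points, and \<open>l\<close> acts on them by its residue. They are permuted if the residue is
  nonzero and collapse to one point otherwise; this separates the two families, and the degree
  modulo 3 tells which case holds. In the basis \<open>1, omega\<close> the norm is
  \<open>a^2 - a b + b^2\<close>; the form \<open>x^2 + x y + y^2\<close> with natural arguments
  comes from bases of adjacent units, which meet at 60 degrees.\<close>

definition omega :: complex where "omega = Complex (-1/2) (sqrt 3 / 2)"

definition eis :: "int \<Rightarrow> int \<Rightarrow> complex" where "eis a b = of_int a + of_int b * omega"

definition Eisenstein :: "complex set" where "Eisenstein = {eis a b | a b. True}"

lemma omega_squared: "omega * omega = - 1 - omega"
  by (simp add: omega_def complex_eq_iff)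

lemma omega_cubed: "omega ^ 3 = 1"
proof -
  have "omega ^ 3 = omega * (omega * omega)" by (simp add: power3_eq_cube)
  also have "\<dots> = - omega - omega * omega" by (simp add: omega_squared algebra_simps)
  also have "\<dots> = 1" by (simp add: omega_squared)
  finally show ?thesis .
qed

lemma omega_neq [simp]: "omega \<noteq> 0" "omega \<noteq> 1"
  by (simp_all add: omega_def complex_eq_iff)

lemma norm_omega [simp]: "cmod omega = 1"
  by (simp add: omega_def cmod_def power2_eq_square)

lemma eis_add: "eis a b + eis c d = eis (a + c) (b + d)"
  and eis_diff: "eis a b - eis c d = eis (a - c) (b - d)"
  and eis_minus: "- eis a b = eis (- a) (- b)"
  by (simp_all add: eis_def algebra_simps)

lemma eis_mult: "eis a b * eis c d = eis (a * c - b * d) (a * d + b * c - b * d)"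
proof -
  have "eis a b * eis c d
      = of_int (a * c) + of_int (a * d + b * c) * omega + of_int (b * d) * (omega * omega)"
    by (simp add: eis_def algebra_simps)
  also have "\<dots> = eis (a * c - b * d) (a * d + b * c - b * d)"
    by (simp add: eis_def omega_squared algebra_simps)
  finally show ?thesis .
qed

lemma eis_eq_iff [simp]: "eis a b = eis c d \<longleftrightarrow> a = c \<and> b = d"
  by (auto simp: eis_def omega_def complex_eq_iff)

lemma norm_real_combination:
  "(cmod (of_real x + of_real y * omega))\<^sup>2 = x\<^sup>2 - x * y + y\<^sup>2"
proof -
  have "(y * (sqrt 3 / 2))\<^sup>2 = y\<^sup>2 * 3 / 4" by (simp add: power_mult_distrib power_divide)
  then show ?thesis
    by (simp add: cmod_power2 omega_def) (simp add: power2_eq_square algebra_simps)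
qed

lemma norm_eis: "(cmod (eis a b))\<^sup>2 = of_int (a\<^sup>2 - a * b + b\<^sup>2)"
  using norm_real_combination[of "of_int a" "of_int b"] by (simp add: eis_def)

lemma eis_in [simp]: "eis a b \<in> Eisenstein"
  by (auto simp: Eisenstein_def)

lemma EisensteinE: assumes "x \<in> Eisenstein" obtains a b where "x = eis a b"
  using assms by (auto simp: Eisenstein_def)

lemma Eisenstein_of_int [simp]: "of_int n \<in> Eisenstein"
  using eis_in[of n 0] by (simp add: eis_def)

lemma Eisenstein_0 [simp]: "0 \<in> Eisenstein" and Eisenstein_1 [simp]: "1 \<in> Eisenstein"
  using Eisenstein_of_int[of 0] Eisenstein_of_int[of 1] by simp_all

lemma omega_in [simp]: "omega \<in> Eisenstein"
  using eis_in[of 0 1] by (simp add: eis_def)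

lemma Eisenstein_add [intro]: "x \<in> Eisenstein \<Longrightarrow> y \<in> Eisenstein \<Longrightarrow> x + y \<in> Eisenstein"
  and Eisenstein_diff [intro]: "x \<in> Eisenstein \<Longrightarrow> y \<in> Eisenstein \<Longrightarrow> x - y \<in> Eisenstein"
  and Eisenstein_mult [intro]: "x \<in> Eisenstein \<Longrightarrow> y \<in> Eisenstein \<Longrightarrow> x * y \<in> Eisenstein"
  and Eisenstein_minus [intro]: "x \<in> Eisenstein \<Longrightarrow> - x \<in> Eisenstein"
  by (auto elim!: EisensteinE simp: eis_add eis_diff eis_mult eis_minus)

lemma Eisenstein_power [intro]: "x \<in> Eisenstein \<Longrightarrow> x ^ n \<in> Eisenstein"
  by (induction n) auto

lemma norm_Eisenstein_ge_1:
  assumes "x \<in> Eisenstein" "x \<noteq> 0" shows "cmod x \<ge> 1"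
proof -
  obtain a b where x: "x = eis a b" using assms by (auto elim: EisensteinE)
  have "(cmod x)\<^sup>2 > 0" using assms by simp
  then have "0 < a\<^sup>2 - a * b + b\<^sup>2"
    unfolding x norm_eis of_int_0_less_iff .
  then have "1 \<le> a\<^sup>2 - a * b + b\<^sup>2" by simp
  then have "1\<^sup>2 \<le> (cmod x)\<^sup>2"
    unfolding x norm_eis by (metis of_int_1_le_iff one_power2)
  then show ?thesis by (rule power2_le_imp_le) simp
qed

section \<open>Euclidean division, principal ideals and residue classes\<close>

lemma complex_real_combination: "\<exists>x y. z = of_real x + of_real y * omega"
  by (rule exI[of _ "Re z + Im z / sqrt 3"], rule exI[of _ "2 * Im z / sqrt 3"])
     (simp add: omega_def complex_eq_iff)

text \<open>Rounding both coordinates leaves an error of squared norm at most 3/4. A bound below 1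
  makes division with remainder possible, and it also shows that the unit disc meets every
  translation class.\<close>

lemma Eisenstein_approx: "\<exists>e\<in>Eisenstein. cmod (z - e) < 1"
proof -
  obtain x y where z: "z = of_real x + of_real y * omega"
    using complex_real_combination by blast
  define p q where "p = x - of_int (round x)" and "q = y - of_int (round y)"
  have pq: "\<bar>p\<bar> \<le> 1/2" "\<bar>q\<bar> \<le> 1/2"
    unfolding p_def q_def using of_int_round_abs_le[of x] of_int_round_abs_le[of y]
    by (simp_all add: abs_minus_commute)
  have "z - eis (round x) (round y) = of_real p + of_real q * omega"
    by (simp add: z p_def q_def eis_def algebra_simps)
  then have "(cmod (z - eis (round x) (round y)))\<^sup>2 = p\<^sup>2 - p * q + q\<^sup>2"
    using norm_real_combination by simp
  also have "\<dots> \<le> \<bar>p\<bar>\<^sup>2 + \<bar>p\<bar> * \<bar>q\<bar> + \<bar>q\<bar>\<^sup>2"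
    using abs_ge_minus_self[of "p * q"] by (simp add: abs_mult)
  also have "\<dots> \<le> (1/2)\<^sup>2 + (1/2) * (1/2) + (1/2)\<^sup>2"
    using pq by (intro add_mono power_mono mult_mono) auto
  also have "\<dots> < 1\<^sup>2" by (simp add: power2_eq_square)
  finally have "cmod (z - eis (round x) (round y)) < 1"
    by (rule power2_less_imp_less) simp
  then show ?thesis by (intro bexI[of _ "eis (round x) (round y)"]) auto
qed

text \<open>Closure under subtraction and under \<open>omega\<close> already gives an ideal, because
  1 and \<open>omega\<close> span the ring over the integers. Division with remainder then makes a
  nonzero element of least norm a generator.\<close>

lemma Eisenstein_ideal_principal:
  assumes sub: "T \<subseteq> Eisenstein" and zero: "0 \<in> T"
    and diff: "\<And>s t. s \<in> T \<Longrightarrow> t \<in> T \<Longrightarrow> s - t \<in> T"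
    and om: "\<And>t. t \<in> T \<Longrightarrow> omega * t \<in> T"
  shows "\<exists>l\<in>T. T = {l * e | e. e \<in> Eisenstein}"
proof -
  have minus: "- t \<in> T" if "t \<in> T" for t using diff[OF zero that] by simp
  have add: "s + t \<in> T" if "s \<in> T" "t \<in> T" for s t
    using diff[OF that(1) minus[OF that(2)]] by simp
  have nat: "of_nat n * t \<in> T" if "t \<in> T" for n t
    by (induction n) (auto simp: zero algebra_simps intro: add that)
  have int: "of_int n * t \<in> T" if "t \<in> T" for n t
    by (cases n rule: int_cases2) (use nat[OF that] minus in auto)
  have mult: "t * e \<in> T" if "t \<in> T" "e \<in> Eisenstein" for t e
  proof -
    obtain a b where e: "e = eis a b" using \<open>e \<in> Eisenstein\<close> by (rule EisensteinE)
    have "t * e = of_int a * t + of_int b * (omega * t)" by (simp add: e eis_def algebra_simps)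
    then show ?thesis using that int om add by simp
  qed
  show ?thesis
  proof (cases "T = {0}")
    case True
    then show ?thesis by (auto intro: exI[of _ 0])
  next
    case False
    then obtain t0 where t0: "t0 \<in> T" "t0 \<noteq> 0" using zero by blast
    \<comment> \<open>Cutting the squared norm down to a natural number makes the least-element
      principle available; on \<open>T\<close> nothing is lost, because norms of Eisenstein integers
      are integers.\<close>
    define sq where "sq t = nat \<lfloor>(cmod t)\<^sup>2\<rfloor>" for t
    obtain l where l: "l \<in> T \<and> l \<noteq> 0" and min: "\<And>t. t \<in> T \<and> t \<noteq> 0 \<Longrightarrow> sq l \<le> sq t"
      using ex_has_least_nat[of "\<lambda>t. t \<in> T \<and> t \<noteq> 0" t0 sq] t0 by auto
    have sq: "of_nat (sq t) = (cmod t)\<^sup>2" if "t \<in> T" for t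
    proof -
      have "t \<in> Eisenstein" using that sub by blast
      then obtain a b where t: "t = eis a b" by (rule EisensteinE)
      have nn: "0 \<le> (cmod t)\<^sup>2" by simp
      then have "0 \<le> a\<^sup>2 - a * b + b\<^sup>2"
        unfolding t norm_eis of_int_0_le_iff .
      then show ?thesis unfolding sq_def t norm_eis floor_of_int by simp
    qed
    have "\<exists>e\<in>Eisenstein. t = l * e" if t: "t \<in> T" for t
    proof -
      obtain e where e: "e \<in> Eisenstein" "cmod (t / l - e) < 1" using Eisenstein_approx by blast
      have r: "t - l * e \<in> T" using diff t mult l e by blast
      have "t - l * e = l * (t / l - e)" using l by (simp add: algebra_simps)
      then have "cmod (t - l * e) = cmod l * cmod (t / l - e)" by (metis norm_mult)
      then have less: "cmod (t - l * e) < cmod l" using e l by simp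
      have "t - l * e = 0"
      proof (rule ccontr)
        assume "t - l * e \<noteq> 0"
        then have "sq l \<le> sq (t - l * e)" using min r by blast
        then have "(cmod l)\<^sup>2 \<le> (cmod (t - l * e))\<^sup>2"
          using sq[of l] sq[OF r] l by (metis of_nat_le_iff)
        then show False using less by (meson norm_ge_zero not_le power2_le_imp_le)
      qed
      then show ?thesis using e by auto
    qed
    then have "T = {l * e | e. e \<in> Eisenstein}" using mult l by auto
    then show ?thesis using l by blast
  qed
qed

text \<open>The lattice of multiples of \<open>l\<close> has a triangular basis \<open>n\<close>,
  \<open>c + m * omega\<close>, so an \<open>n\<close> by \<open>m\<close> box represents the
  residue classes. The product \<open>n * m\<close> equals the determinant of the basis
  \<open>l\<close>, \<open>l * omega\<close>, which is the norm.\<close>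

lemma Eisenstein_residues:
  assumes "l \<in> Eisenstein" "l \<noteq> 0"
  shows "\<exists>R. finite R \<and> R \<subseteq> Eisenstein \<and> of_nat (card R) = (cmod l)\<^sup>2 \<and>
    (\<forall>t\<in>Eisenstein. \<exists>!r. r \<in> R \<and> (\<exists>e\<in>Eisenstein. t = r + l * e))"
proof -
  obtain p q where l: "l = eis p q" using assms by (auto elim: EisensteinE)
  define N where "N = p\<^sup>2 - p * q + q\<^sup>2"
  have "0 < (cmod l)\<^sup>2" using assms by simp
  then have N: "N > 0" unfolding l norm_eis of_int_0_less_iff N_def .
  define T where "T = {(a, b). \<exists>e\<in>Eisenstein. eis a b = l * e}"
  have T_iff: "(a, b) \<in> T \<longleftrightarrow> (\<exists>x y. a = p * x - q * y \<and> b = p * y + q * x - q * y)" for a b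
  proof -
    have "(a, b) \<in> T \<longleftrightarrow> (\<exists>x y. eis a b = l * eis x y)"
      unfolding T_def Eisenstein_def by blast
    then show ?thesis by (simp add: l eis_mult)
  qed
  have T_mult: "(k * a, k * b) \<in> T" if ab: "(a, b) \<in> T" for k a b
  proof -
    obtain x y where "a = p * x - q * y" "b = p * y + q * x - q * y" using ab T_iff by blast
    then have "k * a = p * (k * x) - q * (k * y)" "k * b = p * (k * y) + q * (k * x) - q * (k * y)"
      by (simp_all add: right_diff_distrib distrib_left mult.left_commute)
    then show ?thesis using T_iff by blast
  qed
  have T_diff: "(a - c, b - d) \<in> T" if ab: "(a, b) \<in> T" and cd: "(c, d) \<in> T" for a b c d
  proof -
    obtain x y where xy: "a = p * x - q * y" "b = p * y + q * x - q * y" using ab T_iff by blast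
    obtain u v where uv: "c = p * u - q * v" "d = p * v + q * u - q * v" using cd T_iff by blast
    have "a - c = p * (x - u) - q * (y - v)" "b - d = p * (y - v) + q * (x - u) - q * (y - v)"
      by (simp_all add: xy uv algebra_simps)
    then show ?thesis using T_iff by blast
  qed
  \<comment> \<open>Multiplication by \<open>omega\<close> in coordinates, from
    \<open>omega^2 = - 1 - omega\<close>.\<close>
  have T_om: "(- b, a - b) \<in> T" if ab: "(a, b) \<in> T" for a b
  proof -
    obtain x y where xy: "a = p * x - q * y" "b = p * y + q * x - q * y" using ab T_iff by blast
    have "- b = p * (- y) - q * (x - y)" "a - b = p * (x - y) + q * (- y) - q * (x - y)"
      by (simp_all add: xy algebra_simps)
    then show ?thesis using T_iff by blast
  qed
  \<comment> \<open>The cofactor is the conjugate \<open>(p - q) - q * omega\<close> of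
    \<open>l\<close>.\<close>
  have NT: "(N, 0) \<in> T"
    unfolding T_iff by (rule exI[of _ "p - q"], rule exI[of _ "- q"])
      (simp add: N_def power2_eq_square algebra_simps)
  have NT': "(0, N) \<in> T" using T_om[OF NT] by simp
  \<comment> \<open>Hermite normal form: \<open>n\<close> will generate the intersection of the
    lattice with the first axis, \<open>m\<close> its projection to the second axis.\<close>
  define n where "n = (LEAST k. 0 < k \<and> (int k, 0) \<in> T)"
  define m where "m = (LEAST k. 0 < k \<and> (\<exists>c. (c, int k) \<in> T))"
  have "0 < nat N \<and> (int (nat N), 0) \<in> T" using N NT by simp
  then have n: "0 < n \<and> (int n, 0) \<in> T" unfolding n_def by (rule LeastI)
  have "0 < nat N \<and> (\<exists>c. (c, int (nat N)) \<in> T)" using N NT' by auto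
  then have m: "0 < m \<and> (\<exists>c. (c, int m) \<in> T)" unfolding m_def by (rule LeastI)
  then obtain c where c: "(c, int m) \<in> T" by blast
  have n_dvd: "int n dvd a" if "(a, 0) \<in> T" for a
  proof -
    have "(a - a div int n * int n, 0) \<in> T"
      using T_diff[OF that T_mult[of "int n" 0 "a div int n"]] n by simp
    then have "(a mod int n, 0) \<in> T" by (simp add: minus_div_mult_eq_mod)
    then have r: "(int (nat (a mod int n)), 0) \<in> T" using n by simp
    have "nat (a mod int n) < n" using n by (simp add: nat_less_iff)
    then have "\<not> (0 < nat (a mod int n))"
      using r not_less_Least[of "nat (a mod int n)" "\<lambda>k. 0 < k \<and> (int k, 0) \<in> T"]
      unfolding n_def[symmetric] by metis
    moreover have "0 \<le> a mod int n" using n by simp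
    ultimately have "a mod int n = 0" by linarith
    then show ?thesis by (simp add: mod_eq_0_iff_dvd)
  qed
  have m_dvd: "int m dvd b" if "(a, b) \<in> T" for a b
  proof -
    have "(a - b div int m * c, b - b div int m * int m) \<in> T"
      using T_diff[OF that T_mult[OF c, of "b div int m"]] by simp
    then have r: "(a - b div int m * c, int (nat (b mod int m))) \<in> T"
      using m by (simp add: minus_div_mult_eq_mod)
    have "nat (b mod int m) < m" using m by (simp add: nat_less_iff)
    then have "\<not> (0 < nat (b mod int m))"
      using r not_less_Least[of "nat (b mod int m)" "\<lambda>k. 0 < k \<and> (\<exists>c. (c, int k) \<in> T)"]
      unfolding m_def[symmetric] by metis
    moreover have "0 \<le> b mod int m" using m by simp
    ultimately have "b mod int m = 0" by linarith
    then show ?thesis by (simp add: mod_eq_0_iff_dvd)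
  qed
  have T_basis: "\<exists>i j. a = i * int n + j * c \<and> b = j * int m" if ab: "(a, b) \<in> T" for a b
  proof -
    obtain j where j: "b = int m * j" using m_dvd[OF ab] by blast
    have "(a - j * c, 0) \<in> T" using T_diff[OF ab T_mult[OF c, of j]] by (simp add: j mult.commute)
    then obtain i where "a - j * c = int n * i" using n_dvd by blast
    then have "a = i * int n + j * c \<and> b = j * int m" by (simp add: j algebra_simps)
    then show ?thesis by blast
  qed
  \<comment> \<open>\<open>{n, c + m omega}\<close> and \<open>{l, l omega}\<close> are bases of the same lattice, so their determinants
      divide each other.\<close>
  have "int (n * m) dvd N"
  proof -
    have "(p, q) \<in> T" unfolding T_iff by (rule exI[of _ 1], rule exI[of _ 0]) simp
    then obtain i j where ij: "p = i * int n + j * c" "q = j * int m" using T_basis by blast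
    obtain i' j' where ij': "- q = i' * int n + j' * c" "p - q = j' * int m"
      using T_basis T_om[OF \<open>(p, q) \<in> T\<close>] by blast
    have "N = p * (p - q) - q * (- q)" by (simp add: N_def power2_eq_square algebra_simps)
    also have "\<dots> = (i * int n + j * c) * (j' * int m) - (j * int m) * (i' * int n + j' * c)"
      using ij ij' by simp
    also have "\<dots> = int (n * m) * (i * j' - j * i')" by (simp add: algebra_simps)
    finally show ?thesis by simp
  qed
  moreover have "N dvd int (n * m)"
  proof -
    obtain x y where xy: "int n = p * x - q * y" "0 = p * y + q * x - q * y"
      using n T_iff by blast
    obtain u v where uv: "c = p * u - q * v" "int m = p * v + q * u - q * v" using c T_iff by blast
    have "int (n * m) = (p * x - q * y) * (p * v + q * u - q * v) - (p * y + q * x - q * y) * (p * u - q * v)"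
      by (simp add: xy(1)[symmetric] uv(2)[symmetric] xy(2)[symmetric])
    also have "\<dots> = N * (x * v - y * u)" by (simp add: N_def power2_eq_square algebra_simps)
    finally show ?thesis by simp
  qed
  ultimately have nm: "int (n * m) = N" using N by (simp add: zdvd_antisym_nonneg)
  define R where "R = (\<lambda>(i, j). eis (int i) (int j)) ` ({..<n} \<times> {..<m})"
  have "inj_on (\<lambda>(i, j). eis (int i) (int j)) ({..<n} \<times> {..<m})" by (auto simp: inj_on_def)
  then have "card R = n * m" unfolding R_def by (simp add: card_image card_cartesian_product)
  then have card: "of_nat (card R) = (cmod l)\<^sup>2"
    using nm unfolding l norm_eis N_def by (metis of_int_of_nat_eq)
  have uniq: "\<exists>!r. r \<in> R \<and> (\<exists>e\<in>Eisenstein. t = r + l * e)" if t: "t \<in> Eisenstein" for t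
  proof -
    obtain a b where t: "t = eis a b" using t by (rule EisensteinE)
    \<comment> \<open>The second coordinate is reduced first, since subtracting multiples of
      \<open>(c, m)\<close> changes the first coordinate as well.\<close>
    define j where "j = b mod int m"
    define a' where "a' = a - b div int m * c"
    define i where "i = a' mod int n"
    have "(b div int m * c, b div int m * int m) \<in> T" using T_mult[OF c] .
    moreover have "(- (a' div int n) * int n, 0) \<in> T"
      using T_mult[of "int n" 0 "- (a' div int n)"] n by simp
    ultimately have "(b div int m * c - (- (a' div int n) * int n), b div int m * int m - 0) \<in> T"
      by (rule T_diff)
    moreover have "a - i = b div int m * c - (- (a' div int n) * int n)"
      by (simp add: i_def a'_def minus_mod_eq_div_mult[symmetric])
    moreover have "b - j = b div int m * int m - 0"
      by (simp add: j_def minus_mod_eq_div_mult)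
    ultimately have "(a - i, b - j) \<in> T" by simp
    then obtain e where e: "e \<in> Eisenstein" "eis (a - i) (b - j) = l * e" by (auto simp: T_def)
    have "0 \<le> i" "i < int n" "0 \<le> j" "j < int m" using n m by (simp_all add: i_def j_def)
    then have R: "eis i j \<in> R"
      unfolding R_def by (intro image_eqI[of _ _ "(nat i, nat j)"]) auto
    have "t = eis i j + l * e" using e by (simp add: t eis_add flip: e(2))
    moreover have "r = eis i j" if "r \<in> R" "e' \<in> Eisenstein" "t = r + l * e'" for r e'
    proof -
      obtain i' j' where r: "r = eis (int i') (int j')" "i' < n" "j' < m"
        using \<open>r \<in> R\<close> by (auto simp: R_def)
      have "eis i j - r = l * (e' - e)"
        using that(3) \<open>t = eis i j + l * e\<close> by (simp add: algebra_simps)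
      then have *: "(i - int i', j - int j') \<in> T"
        unfolding T_def using that e by (auto simp: r eis_diff)
      have "int m dvd j - int j'" using m_dvd[OF *] .
      then have j': "j = int j'"
        using \<open>0 \<le> j\<close> \<open>j < int m\<close> r by (metis mod_eq_dvd_iff mod_pos_pos_trivial of_nat_0_le_iff of_nat_less_iff)
      then have "int n dvd i - int i'" using n_dvd * by simp
      then have "i = int i'"
        using \<open>0 \<le> i\<close> \<open>i < int n\<close> r by (metis mod_eq_dvd_iff mod_pos_pos_trivial of_nat_0_le_iff of_nat_less_iff)
      then show ?thesis using j' r by simp
    qed
    ultimately show ?thesis using R e by blast
  qed
  have "finite R" "R \<subseteq> Eisenstein" by (auto simp: R_def)
  then show ?thesis
    by (intro exI[of _ R] conjI ballI card uniq)
qed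

section \<open>The norm form over the naturals\<close>

lemma norm_form_nonneg:
  assumes "int d = a\<^sup>2 - a * b + b\<^sup>2"
  shows "\<exists>x y :: nat. d = x\<^sup>2 + x * y + y\<^sup>2"
proof -
  have nat: "\<exists>x y :: nat. d = x\<^sup>2 + x * y + y\<^sup>2"
    if "int d = x\<^sup>2 + x * y + y\<^sup>2" "0 \<le> x" "0 \<le> y" for x y
  proof -
    have "int d = int ((nat x)\<^sup>2 + nat x * nat y + (nat y)\<^sup>2)" using that by simp
    then show ?thesis by (metis of_nat_eq_iff)
  qed
  \<comment> \<open>The six sectors of angle 60 degrees between consecutive units. In each of them
    \<open>a + b * omega\<close> is a non-negative combination \<open>x * u + y * v\<close> of the
    two bounding units, whose norm is \<open>x^2 + x y + y^2\<close>.\<close>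
  consider "a \<ge> 0" "b \<le> 0" | "a \<le> 0" "b \<ge> 0" | "0 \<le> b" "b \<le> a" | "0 \<le> a" "a \<le> b"
    | "b \<le> 0" "a \<le> b" | "a \<le> 0" "b \<le> a" by linarith
  then show ?thesis
  proof cases
    case 1 show ?thesis by (rule nat[of a "- b"]) (use assms 1 in simp_all)
  next
    case 2 show ?thesis by (rule nat[of "- a" b]) (use assms 2 in simp_all)
  next
    case 3 show ?thesis
      by (rule nat[of "a - b" b]) (use assms 3 in \<open>simp_all add: power2_eq_square algebra_simps\<close>)
  next
    case 4 show ?thesis
      by (rule nat[of "b - a" a]) (use assms 4 in \<open>simp_all add: power2_eq_square algebra_simps\<close>)
  next
    case 5 show ?thesis
      by (rule nat[of "b - a" "- b"]) (use assms 5 in \<open>simp_all add: power2_eq_square algebra_simps\<close>)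
  next
    case 6 show ?thesis
      by (rule nat[of "a - b" "- a"]) (use assms 6 in \<open>simp_all add: power2_eq_square algebra_simps\<close>)
  qed
qed

text \<open>Substituting \<open>x = y + 3 e\<close> turns the form into
  \<open>3 (y^2 + 3 y e + 3 e^2)\<close>. The larger argument is expressed through the smaller one
  to stay within the naturals.\<close>

lemma norm_form_div_3:
  fixes d :: nat
  assumes "d = x\<^sup>2 + x * y + y\<^sup>2" "[x = y] (mod 3)"
  shows "\<exists>x y :: nat. d = 3 * (x\<^sup>2 + 3 * x * y + 3 * y\<^sup>2)"
proof -
  have *: "\<exists>x y :: nat. d = 3 * (x\<^sup>2 + 3 * x * y + 3 * y\<^sup>2)"
    if "d = x\<^sup>2 + x * y + y\<^sup>2" "[x = y] (mod 3)" "y \<le> x" for x y :: nat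
  proof -
    have "3 dvd x - y" using that by (simp add: cong_altdef_nat)
    then obtain e where "x - y = 3 * e" by blast
    then have "x = y + 3 * e" using that by simp
    then have "d = 3 * (y\<^sup>2 + 3 * y * e + 3 * e\<^sup>2)"
      using that by (simp add: power2_eq_square algebra_simps)
    then show ?thesis by blast
  qed
  show ?thesis
  proof (cases "y \<le> x")
    case True then show ?thesis using * assms by blast
  next
    case False
    then have "x \<le> y" by simp
    moreover have "d = y\<^sup>2 + y * x + x\<^sup>2" using assms by (simp add: algebra_simps)
    ultimately show ?thesis using * assms cong_sym by blast
  qed
qed

text \<open>Modulo 3 the form is \<open>(x - y)^2\<close>.\<close>

lemma norm_form_mod_3:
  fixes x y :: nat
  shows "[x\<^sup>2 + x * y + y\<^sup>2 = 0] (mod 3) \<longleftrightarrow> [x = y] (mod 3)"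
    and "\<not> [x = y] (mod 3) \<Longrightarrow> [x\<^sup>2 + x * y + y\<^sup>2 = 1] (mod 3)"
proof -
  have m: "x mod 3 = 0 \<or> x mod 3 = 1 \<or> x mod 3 = 2" "y mod 3 = 0 \<or> y mod 3 = 1 \<or> y mod 3 = 2"
    by presburger+
  have e: "(x\<^sup>2 + x * y + y\<^sup>2) mod 3
      = ((x mod 3)\<^sup>2 + (x mod 3) * (y mod 3) + (y mod 3)\<^sup>2) mod 3"
    unfolding power2_eq_square cong_def[symmetric]
    by (intro cong_add cong_mult) (simp_all add: cong_def)
  show "[x\<^sup>2 + x * y + y\<^sup>2 = 0] (mod 3) \<longleftrightarrow> [x = y] (mod 3)"
    unfolding cong_def e using m by auto
  show "\<not> [x = y] (mod 3) \<Longrightarrow> [x\<^sup>2 + x * y + y\<^sup>2 = 1] (mod 3)"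
    unfolding cong_def e using m by auto
qed

section \<open>The unit sphere in three-space\<close>

text \<open>This model of the sphere is chosen because the quotient map of the plane is written down
  with values in \<open>complex \<times> real\<close>.\<close>

abbreviation unit_sphere :: "(complex \<times> real) set" where "unit_sphere \<equiv> sphere 0 1"

abbreviation S2 :: "(complex \<times> real) topology" where "S2 \<equiv> top_of_set unit_sphere"

lemma nsphere2_homeomorphic_unit_sphere: "sphere2 homeomorphic_space S2"
proof -
  obtain f :: "(nat \<Rightarrow> real) \<Rightarrow> complex \<times> real" and g
    where "homeomorphic_maps (nsphere (3 - 1)) (top_of_set (sphere 0 1 \<inter> span Basis)) f g"
  proof (rule homeomorphic_maps_nsphere_euclidean_sphere[of "Basis :: (complex \<times> real) set" 3])
    show "pairwise orthogonal (Basis :: (complex \<times> real) set)" by (rule orthogonal_Basis)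
  qed (use independent_Basis in auto)
  then show ?thesis
    by (auto simp: homeomorphic_space_def)
qed

lemma stereographic:
  assumes "q \<in> unit_sphere"
  obtains F G where "homeomorphism (unit_sphere - {q}) (UNIV :: complex set) F G"
proof -
  have "(unit_sphere - {q}) homeomorphic (UNIV :: complex set)"
    using assms by (intro homeomorphic_punctured_sphere_affine) auto
  then show thesis using that by (auto simp: homeomorphic_def)
qed

lemma infinite_unit_sphere: "infinite unit_sphere"
proof
  assume fin: "finite unit_sphere"
  have q: "(1, 0) \<in> unit_sphere" by (simp add: norm_Pair)
  obtain F G where "homeomorphism (unit_sphere - {(1, 0)}) (UNIV :: complex set) F G"
    using stereographic[OF q] .
  then have "(UNIV :: complex set) = F ` (unit_sphere - {(1, 0)})" by (simp add: homeomorphism_def)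
  moreover have "finite (F ` (unit_sphere - {(1, 0)}))" using fin by blast
  ultimately have "finite (UNIV :: complex set)" by metis
  then show False using infinite_UNIV_char_0 by blast
qed

lemma connected_unit_sphere: "connected unit_sphere"
  by (rule connected_sphere) simp

text \<open>Stereographic projection from one of the removed points turns the rest into the plane
  minus a finite set.\<close>

lemma connected_unit_sphere_minus_finite:
  assumes "finite A" shows "connected (unit_sphere - A)"
proof (cases "unit_sphere \<inter> A = {}")
  case True
  then have "unit_sphere - A = unit_sphere" by blast
  then show ?thesis using connected_unit_sphere by simp
next
  case False
  then obtain q where q: "q \<in> unit_sphere" "q \<in> A" by blast
  obtain F G where FG: "homeomorphism (unit_sphere - {q}) (UNIV :: complex set) F G"
    using stereographic[OF q(1)] .
  have "connected (UNIV - F ` (A \<inter> (unit_sphere - {q})))"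
    using assms by (intro connected_open_diff_countable) (auto intro: countable_finite)
  then have "connected (G ` (UNIV - F ` (A \<inter> (unit_sphere - {q}))))"
    using FG by (meson connected_continuous_image continuous_on_subset homeomorphism_def subset_UNIV)
  moreover have "G ` (UNIV - F ` (A \<inter> (unit_sphere - {q}))) = unit_sphere - A"
  proof (intro equalityI subsetI)
    fix x assume "x \<in> G ` (UNIV - F ` (A \<inter> (unit_sphere - {q})))"
    then obtain w where w: "x = G w" "w \<notin> F ` (A \<inter> (unit_sphere - {q}))" by blast
    have "G w \<in> unit_sphere - {q}" "F (G w) = w" using FG unfolding homeomorphism_def by blast+
    then have "x \<in> unit_sphere - {q}" "F x = w" using w by blast+
    then show "x \<in> unit_sphere - A" using w by blast
  next
    fix x assume x: "x \<in> unit_sphere - A"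
    then have "x \<in> unit_sphere - {q}" using q by blast
    then have "x = G (F x)" using FG by (auto simp: homeomorphism_def)
    moreover have "F x \<notin> F ` (A \<inter> (unit_sphere - {q}))"
    proof
      assume "F x \<in> F ` (A \<inter> (unit_sphere - {q}))"
      then obtain y where "y \<in> A" "y \<in> unit_sphere - {q}" "F x = F y" by blast
      then have "x = y" using FG \<open>x \<in> unit_sphere - {q}\<close> by (metis homeomorphism_apply1)
      then show False using x \<open>y \<in> A\<close> by blast
    qed
    ultimately show "x \<in> G ` (UNIV - F ` (A \<inter> (unit_sphere - {q})))" by blast
  qed
  ultimately show ?thesis by simp
qed

text \<open>A stereographic chart is available only if the image misses a point. By injectivity this
  is so once a point of \<open>U\<close> is deleted, and two such deletions cover
  \<open>U\<close>.\<close>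

lemma invariance_of_domain_into_sphere:
  fixes f :: "complex \<Rightarrow> complex \<times> real"
  assumes "open U" and cont: "continuous_on U f" and inj: "inj_on f U" and im: "f ` U \<subseteq> unit_sphere"
  shows "openin S2 (f ` U)"
proof (cases "U = {}")
  case True then show ?thesis by simp
next
  case False
  have local: "openin S2 (f ` V)"
    if V: "open V" "V \<subseteq> U" and q: "q \<in> unit_sphere" "q \<notin> f ` V" for V q
  proof -
    obtain F G where FG: "homeomorphism (unit_sphere - {q}) (UNIV :: complex set) F G"
      using stereographic[OF q(1)] .
    have fV: "f ` V \<subseteq> unit_sphere - {q}" using im V q by auto
    have "continuous_on V (F \<circ> f)"
      using cont FG fV V
      by (intro continuous_on_compose) (auto simp: homeomorphism_def intro: continuous_on_subset)
    moreover have "inj_on (F \<circ> f) V"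
    proof (rule comp_inj_on)
      show "inj_on f V" using inj V by (blast intro: inj_on_subset)
      show "inj_on F (f ` V)"
      proof (rule inj_on_inverseI)
        fix y assume "y \<in> f ` V"
        then have "y \<in> unit_sphere - {q}" using fV by blast
        then show "G (F y) = y" by (rule homeomorphism_apply1[OF FG])
      qed
    qed
    ultimately have "open ((F \<circ> f) ` V)" using V by (intro invariance_of_domain)
    then have "openin (top_of_set (unit_sphere - {q})) ((unit_sphere - {q}) \<inter> F -` ((F \<circ> f) ` V))"
      using FG by (meson continuous_openin_preimage_gen homeomorphism_def)
    moreover have "(unit_sphere - {q}) \<inter> F -` ((F \<circ> f) ` V) = f ` V"
    proof -
      have "x = f v" if x: "x \<in> unit_sphere - {q}" "F x = F (f v)" "v \<in> V" for x v
      proof -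
        have "f v \<in> unit_sphere - {q}" using x fV by blast
        then show ?thesis using x(1,2) homeomorphism_apply1[OF FG] by metis
      qed
      then show ?thesis using fV unfolding comp_def by blast
    qed
    ultimately have "openin (top_of_set (unit_sphere - {q})) (f ` V)" by simp
    moreover have "openin S2 (unit_sphere - {q})"
      by (intro openin_delete openin_subtopology_self)
    ultimately show ?thesis by (rule openin_trans)
  qed
  obtain u where u: "u \<in> U" using False by blast
  have fu: "f u \<in> unit_sphere" using u im by blast
  have "open (U - {u})" using \<open>open U\<close> by (simp add: open_delete)
  have 1: "openin S2 (f ` (U - {u}))"
    using \<open>open (U - {u})\<close> fu inj u
    by (intro local[of _ "f u"]) (auto simp: inj_on_def)
  have "U \<noteq> {u}" using \<open>open U\<close> not_open_singleton by blast
  then obtain v where v: "v \<in> U" "v \<noteq> u" using u by blast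
  have "open (U - {v})" using \<open>open U\<close> by (simp add: open_delete)
  have fv: "f v \<in> unit_sphere" using v im by blast
  have 2: "openin S2 (f ` (U - {v}))"
    using \<open>open (U - {v})\<close> fv inj v
    by (intro local[of _ "f v"]) (auto simp: inj_on_def)
  have "f ` U = f ` (U - {u}) \<union> f ` (U - {v})" using u v by blast
  then show ?thesis using openin_Un[OF 1 2] by simp
qed

text \<open>After projection from a point \<open>q\<close> away from all the given ones, a
  homeomorphism of the plane with bounded support does the move. It extends over \<open>q\<close>
  because it is the identity near infinity.\<close>

lemma sphere_homeomorphism_moving_points:
  assumes "finite K" and "\<And>i. i \<in> K \<Longrightarrow> x i \<in> unit_sphere" "\<And>i. i \<in> K \<Longrightarrow> y i \<in> unit_sphere"
    and inj: "inj_on x K" "inj_on y K"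
  obtains h h' where "homeomorphism unit_sphere unit_sphere h h'" "\<And>i. i \<in> K \<Longrightarrow> h (x i) = y i"
proof -
  have "finite (x ` K \<union> y ` K)" using assms by simp
  then obtain q where q: "q \<in> unit_sphere" "q \<notin> x ` K \<union> y ` K"
    using infinite_unit_sphere by (meson finite_subset subsetI)
  obtain F G where FG: "homeomorphism (unit_sphere - {q}) (UNIV :: complex set) F G"
    using stereographic[OF q(1)] .
  have pt: "x i \<in> unit_sphere - {q}" "y i \<in> unit_sphere - {q}" if "i \<in> K" for i
    using assms q that by auto
  have Finj: "u = v" if "F u = F v" "u \<in> unit_sphere - {q}" "v \<in> unit_sphere - {q}" for u v
    using FG that by (metis homeomorphism_apply1)
  have GF: "G (F u) = u" if "u \<in> unit_sphere - {q}" for u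
    using FG that by (metis homeomorphism_apply1)
  have FGu: "F (G w) = w" "G w \<in> unit_sphere - {q}" for w
    using FG unfolding homeomorphism_def by blast+
  have "pairwise (\<lambda>i j. F (x i) \<noteq> F (x j) \<and> F (y i) \<noteq> F (y j)) K"
    using inj Finj pt by (simp add: pairwise_def inj_on_def) blast
  then obtain f g where fg: "homeomorphism UNIV UNIV f g"
    and move: "\<And>i. i \<in> K \<Longrightarrow> f (F (x i)) = F (y i)"
    and bd: "bounded {w. \<not> (f w = w \<and> g w = w)}"
    using homeomorphism_moving_points_exists[of "UNIV :: complex set" UNIV K "\<lambda>i. F (x i)" "\<lambda>i. F (y i)"]
      \<open>finite K\<close> by auto
  \<comment> \<open>A compact set carrying the whole move. It avoids \<open>q\<close>, so its
    complement is a neighbourhood of \<open>q\<close> where the extension is the identity.\<close>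
  define C where "C = G ` closure {w. \<not> (f w = w \<and> g w = w)}"
  have "compact C" unfolding C_def
    using bd FG by (intro compact_continuous_image) (auto simp: homeomorphism_def intro: continuous_on_subset)
  then have "closed C" by (rule compact_imp_closed)
  have C: "C \<subseteq> unit_sphere - {q}" unfolding C_def using FGu by blast
  define ext where "ext k u = (if u = q then q else G (k (F u)))" for k u
  have ext_id: "ext k u = u" if "u \<in> unit_sphere - C" "k = f \<or> k = g" for k u
  proof (cases "u = q")
    case False
    then have "u = G (F u)" using that GF by simp
    have "F u \<notin> closure {w. \<not> (f w = w \<and> g w = w)}"
    proof
      assume "F u \<in> closure {w. \<not> (f w = w \<and> g w = w)}"
      then have "G (F u) \<in> C" unfolding C_def by (rule imageI)
      then show False using \<open>u = G (F u)\<close> that(1) by simp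
    qed
    then have "F u \<notin> {w. \<not> (f w = w \<and> g w = w)}" by (rule contra_subsetD[OF closure_subset])
    then have "k (F u) = F u" using that by auto
    then show ?thesis using False GF that by (simp add: ext_def)
  qed (simp add: ext_def)
  have cont: "continuous_on unit_sphere (ext k)" if k: "k = f \<or> k = g" for k
  proof -
    have "continuous_on (unit_sphere - C) (ext k)"
      using ext_id k by (subst continuous_on_cong[where g = "\<lambda>u. u"]) auto
    moreover have "continuous_on (unit_sphere - {q}) (ext k)"
    proof -
      have "continuous_on (unit_sphere - {q}) (\<lambda>u. G (k (F u)))"
      proof (rule continuous_on_compose2[OF homeomorphism_cont2[OF FG]])
        have "continuous_on UNIV k"
          using k homeomorphism_cont1[OF fg] homeomorphism_cont2[OF fg] by blast
        then show "continuous_on (unit_sphere - {q}) (\<lambda>u. k (F u))"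
          by (rule continuous_on_compose2[OF _ homeomorphism_cont1[OF FG]]) simp
      qed simp
      then show ?thesis by (rule continuous_on_eq) (auto simp: ext_def)
    qed
    moreover have "openin S2 (unit_sphere - C)"
      unfolding Diff_eq using \<open>closed C\<close> by (intro openin_open_Int open_Compl)
    moreover have "openin S2 (unit_sphere - {q})"
      by (intro openin_delete openin_subtopology_self)
    moreover have "unit_sphere = (unit_sphere - C) \<union> (unit_sphere - {q})" using C by blast
    ultimately show ?thesis
      using continuous_on_Un_local_open[of "unit_sphere - C" "unit_sphere - {q}" "ext k"] by simp
  qed
  have maps: "ext k u \<in> unit_sphere" if "u \<in> unit_sphere" for k u
    using FGu q by (auto simp: ext_def)
  have inv: "ext k' (ext k u) = u" if "u \<in> unit_sphere" "\<And>w. k' (k w) = w" for k k' u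
    using that FGu GF by (auto simp: ext_def)
  have hom: "homeomorphism unit_sphere unit_sphere (ext f) (ext g)"
  proof (rule homeomorphismI)
    show "ext g (ext f u) = u" "ext f (ext g u) = u" if "u \<in> unit_sphere" for u
      using that fg by (auto intro!: inv simp: homeomorphism_def)
  qed (use cont maps in auto)
  show thesis
  proof (rule that[OF hom])
    fix i assume i: "i \<in> K"
    then have "x i \<noteq> q" using q by blast
    then show "ext f (x i) = y i" using move[OF i] pt[OF i] GF by (simp add: ext_def)
  qed
qed

section \<open>The triangle map\<close>

text \<open>The factor after \<open>2 * pi\<close> is the coefficient of 1 in the real basis
  \<open>1, omega\<close>, so this is a character of the plane that is trivial on the
  lattice.\<close>

definition lattice_character :: "complex \<Rightarrow> complex" where
  "lattice_character z = cis (2 * pi * (Re z + Im z / sqrt 3))"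

lemma lattice_character_add:
  "lattice_character (z + w) = lattice_character z * lattice_character w"
  by (simp add: lattice_character_def cis_mult algebra_simps add_divide_distrib)

lemma lattice_character_0 [simp]: "lattice_character 0 = 1"
  by (simp add: lattice_character_def)

lemma norm_lattice_character [simp]: "cmod (lattice_character z) = 1"
  by (simp add: lattice_character_def)

text \<open>\<open>1 + omega + omega^2 = 0\<close>, so the three arguments add up to 0.\<close>

lemma lattice_character_prod:
  "lattice_character z * lattice_character (omega * z) * lattice_character (omega * (omega * z)) = 1"
proof -
  have "z + omega * z + omega * (omega * z) = z + omega * z + (omega * omega) * z"
    by (simp add: algebra_simps)
  also have "\<dots> = 0" by (simp add: omega_squared algebra_simps)
  finally show ?thesis by (metis lattice_character_add lattice_character_0)
qed

lemma continuous_lattice_character [continuous_intros]: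
  "continuous_on S f \<Longrightarrow> continuous_on S (\<lambda>z. lattice_character (f z))"
  unfolding lattice_character_def by (intro continuous_intros) auto

lemma Re_Im_combination:
  "Re (of_real x + of_real y * omega) + Im (of_real x + of_real y * omega) / sqrt 3 = x"
  by (simp add: omega_def)

lemma cis_2pi_eq_1_iff: "cis (2 * pi * x) = 1 \<longleftrightarrow> x \<in> \<int>"
proof
  assume "cis (2 * pi * x) = 1"
  then have "cos (2 * pi * x) = 1" by (simp add: complex_eq_iff)
  then obtain n :: int where "2 * pi * x = of_int n * 2 * pi"
    using cos_one_2pi_int by blast
  then have "x = of_int n" by simp
  then show "x \<in> \<int>" by simp
next
  assume "x \<in> \<int>"
  then show "cis (2 * pi * x) = 1" by (auto elim!: Ints_cases)
qed

text \<open>For \<open>z = x + y * omega\<close> the first character reads \<open>x\<close> and the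
  second, after the rotation, reads \<open>- y\<close>; together they see both coordinates modulo
  1.\<close>

lemma lattice_character_eq_1_iff:
  "lattice_character z = 1 \<and> lattice_character (omega * z) = 1 \<longleftrightarrow> z \<in> Eisenstein"
proof -
  obtain x y where z: "z = of_real x + of_real y * omega"
    using complex_real_combination by blast
  have "omega * z = of_real x * omega + of_real y * (omega * omega)"
    by (simp add: z algebra_simps)
  then have oz: "omega * z = of_real (- y) + of_real (x - y) * omega"
    by (simp add: omega_squared algebra_simps)
  have 1: "lattice_character z = 1 \<longleftrightarrow> x \<in> \<int>"
    unfolding lattice_character_def z Re_Im_combination by (rule cis_2pi_eq_1_iff)
  have 2: "lattice_character (omega * z) = 1 \<longleftrightarrow> - y \<in> \<int>"
    unfolding lattice_character_def oz Re_Im_combination by (rule cis_2pi_eq_1_iff)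
  have "x \<in> \<int> \<and> y \<in> \<int> \<longleftrightarrow> z \<in> Eisenstein"
  proof
    assume "x \<in> \<int> \<and> y \<in> \<int>"
    then obtain a b where "x = of_int a" "y = of_int b" by (auto elim!: Ints_cases)
    then have "z = eis a b" by (simp add: z eis_def)
    then show "z \<in> Eisenstein" by simp
  next
    assume "z \<in> Eisenstein"
    then obtain a b where "z = of_real (of_int a) + of_real (of_int b) * omega"
      by (auto elim!: EisensteinE simp: eis_def)
    then have e: "of_real x + of_real y * omega = of_real (of_int a) + of_real (of_int b) * omega"
      unfolding z .
    then have "y = of_int b" by (simp add: omega_def complex_eq_iff)
    with e have "x = of_int a" by (simp add: omega_def complex_eq_iff)
    with \<open>y = of_int b\<close> show "x \<in> \<int> \<and> y \<in> \<int>" by simp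
  qed
  with 1 2 show ?thesis by simp
qed

lemma lattice_character_eq_iff:
  "lattice_character z = lattice_character w \<and> lattice_character (omega * z) = lattice_character (omega * w)
    \<longleftrightarrow> z - w \<in> Eisenstein"
proof -
  have *: "lattice_character u = lattice_character v \<longleftrightarrow> lattice_character (u - v) = 1" for u v
  proof -
    have "lattice_character u = lattice_character (u - v) * lattice_character v"
      using lattice_character_add[of "u - v" v] by simp
    moreover have "lattice_character v \<noteq> 0" by (metis norm_lattice_character norm_zero zero_neq_one)
    ultimately show ?thesis by auto
  qed
  show ?thesis
    using *[of z w] *[of "omega * z" "omega * w"] lattice_character_eq_1_iff[of "z - w"]
    by (simp add: right_diff_distrib)
qed

text \<open>
  If \<open>Z\<close> is the sum of three unimodular numbers of product 1 and \<open>i s\<close> is their Vandermonde product,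
  then \<open>- s^2\<close> is the discriminant of the cubic with these roots; this reads \<open>height Z s = 27\<close>.
\<close>

definition height :: "complex \<Rightarrow> real \<Rightarrow> real" where
  "height Z s = s\<^sup>2 + 18 * (cmod Z)\<^sup>2 - 8 * Re (Z ^ 3) + (cmod Z) ^ 4"

text \<open>The derivative \<open>4 t (t - 3)^2\<close> vanishes at 3, so strictness is obtained
  algebraically: the difference is divided by \<open>u - t\<close>, and the quotient is written in
  the sum and the product of \<open>t\<close> and \<open>u\<close>.\<close>

lemma height_profile_mono:
  fixes t u :: real
  assumes "0 \<le> t" "t < u"
  shows "18 * t\<^sup>2 - 8 * t ^ 3 + t ^ 4 < 18 * u\<^sup>2 - 8 * u ^ 3 + u ^ 4"
proof -
  define \<sigma> where "\<sigma> = t + u"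
  define \<pi> where "\<pi> = t * u"
  have "(u - t)\<^sup>2 > 0" using assms by simp
  then have \<pi>: "4 * \<pi> < \<sigma>\<^sup>2" "0 \<le> \<pi>" "0 < \<sigma>"
    using assms by (auto simp: \<sigma>_def \<pi>_def power2_eq_square algebra_simps)
  \<comment> \<open>This is linear in \<open>\<pi>\<close> with a coefficient that changes sign at
    \<open>\<sigma> = 4\<close>, so the two cases use the two bounds 0 and
    \<open>\<sigma>^2 / 4\<close> of the product.\<close>
  have "\<sigma> ^ 3 - 8 * \<sigma>\<^sup>2 + 18 * \<sigma> + \<pi> * (8 - 2 * \<sigma>) > 0"
  proof (cases "\<sigma> \<le> 4")
    case True
    have "\<sigma> ^ 3 - 8 * \<sigma>\<^sup>2 + 18 * \<sigma> = \<sigma> * ((\<sigma> - 4)\<^sup>2 + 2)"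
      by (simp add: power2_eq_square power3_eq_cube algebra_simps)
    moreover have "\<dots> > 0" using \<pi> by (simp add: add_nonneg_pos)
    moreover have "\<pi> * (8 - 2 * \<sigma>) \<ge> 0" using \<pi> True by simp
    ultimately show ?thesis by linarith
  next
    case False
    have "\<pi> * (2 * \<sigma> - 8) < \<sigma>\<^sup>2 / 4 * (2 * \<sigma> - 8)"
      using \<pi> False by (intro mult_strict_right_mono) auto
    moreover have "\<sigma> ^ 3 - 8 * \<sigma>\<^sup>2 + 18 * \<sigma> - \<sigma>\<^sup>2 / 4 * (2 * \<sigma> - 8) = \<sigma> / 2 * (\<sigma> - 6)\<^sup>2"
      by (simp add: power2_eq_square power3_eq_cube field_simps)
    moreover have "\<sigma> / 2 * (\<sigma> - 6)\<^sup>2 \<ge> 0" using \<pi> by simp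
    ultimately show ?thesis by (simp add: algebra_simps)
  qed
  then have "(u - t) * (\<sigma> ^ 3 - 8 * \<sigma>\<^sup>2 + 18 * \<sigma> + \<pi> * (8 - 2 * \<sigma>)) > 0"
    using assms by simp
  moreover have "(18 * u\<^sup>2 - 8 * u ^ 3 + u ^ 4) - (18 * t\<^sup>2 - 8 * t ^ 3 + t ^ 4)
      = (u - t) * (\<sigma> ^ 3 - 8 * \<sigma>\<^sup>2 + 18 * \<sigma> + \<pi> * (8 - 2 * \<sigma>))"
    unfolding \<sigma>_def \<pi>_def by (simp add: power2_eq_square power3_eq_cube power4_eq_xxxx algebra_simps)
  ultimately show ?thesis by linarith
qed

text \<open>This is star-shapedness: the height grows strictly along rays from the origin, so a ray
  meets a level at most once. Only the cubic term can decrease; its worst case is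
  \<open>Re (Z^3) = cmod Z ^ 3\<close>, which is the monotone profile. For \<open>Z = 0\<close> the
  term in \<open>s\<close> gives strictness.\<close>

lemma height_scale_mono:
  assumes "1 < m" "(Z, s) \<noteq> 0"
  shows "height Z s < height (of_real m * Z) (m * s)"
proof -
  define r where "r = cmod Z"
  define c where "c = Re (Z ^ 3)"
  have c: "c \<le> r ^ 3"
    unfolding c_def r_def by (metis complex_Re_le_cmod norm_power)
  have "1 \<le> m ^ 3" using assms by (simp add: one_le_power)
  then have c': "c * (m ^ 3 - 1) \<le> r ^ 3 * (m ^ 3 - 1)"
    using c by (intro mult_right_mono) auto
  have "(of_real m * Z) ^ 3 = of_real (m ^ 3) * Z ^ 3" by (simp add: power_mult_distrib)
  then have "Re ((of_real m * Z) ^ 3) = m ^ 3 * c" by (simp add: c_def)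
  then have h: "height (of_real m * Z) (m * s) - height Z s
      = s\<^sup>2 * (m\<^sup>2 - 1) + (18 * (m * r)\<^sup>2 + (m * r) ^ 4 - 18 * r\<^sup>2 - r ^ 4) - 8 * (c * (m ^ 3 - 1))"
    using assms by (simp add: height_def norm_mult r_def[symmetric] c_def[symmetric] algebra_simps power_mult_distrib)
  have m2: "m\<^sup>2 - 1 > 0" using assms by (simp add: one_less_power)
  show ?thesis
  proof (cases "r = 0")
    case True
    then have "s\<^sup>2 > 0" using assms by (auto simp: r_def zero_prod_def)
    then have "s\<^sup>2 * (m\<^sup>2 - 1) > 0" using m2 by simp
    moreover have "c = 0" using True by (simp add: r_def c_def)
    ultimately show ?thesis using h True by simp
  next
    case False
    then have "r > 0" by (simp add: r_def)
    then have "18 * r\<^sup>2 - 8 * r ^ 3 + r ^ 4 < 18 * (m * r)\<^sup>2 - 8 * (m * r) ^ 3 + (m * r) ^ 4"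
      using assms by (intro height_profile_mono) auto
    moreover have "(m * r) ^ 3 - r ^ 3 = r ^ 3 * (m ^ 3 - 1)"
      by (simp add: power_mult_distrib algebra_simps)
    moreover have "s\<^sup>2 * (m\<^sup>2 - 1) \<ge> 0" using m2 by simp
    ultimately show ?thesis using h c' by linarith
  qed
qed

text \<open>Conjugation inverts unimodular numbers. With product 1 it therefore exchanges the first
  two elementary symmetric functions and negates the Vandermonde product; the height equation is
  then the discriminant formula of a cubic.\<close>

lemma vandermonde_level:
  assumes "cmod a = 1" "cmod b = 1" "cmod c = 1" and abc: "a * b * c = 1"
  defines "D \<equiv> (a - b) * (b - c) * (c - a)"
  shows "cnj (a + b + c) = a * b + b * c + c * a" and "D = \<i> * of_real (Im D)"
    and "height (a + b + c) (Im D) = 27"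
proof -
  have cnj1: "cnj u = v" if "cmod u = 1" "u * v = 1" for u v
  proof -
    have "u * cnj u = 1" using that(1) by (simp add: complex_norm_square[symmetric])
    then have "u * cnj u = u * v" using that by simp
    moreover have "u \<noteq> 0" using that by auto
    ultimately show ?thesis by simp
  qed
  have cnj: "cnj a = b * c" "cnj b = c * a" "cnj c = a * b"
    using assms by (auto intro!: cnj1 simp: algebra_simps)
  show Z: "cnj (a + b + c) = a * b + b * c + c * a"
    by (simp add: cnj algebra_simps)
  have "cnj D = (b * c - c * a) * (c * a - a * b) * (a * b - b * c)"
    by (simp add: D_def cnj)
  also have "\<dots> = - (a * b * c) * D" unfolding D_def by (simp add: power2_eq_square power3_eq_cube power4_eq_xxxx algebra_simps)
  finally have "cnj D = - D" using abc by simp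
  then have "Re D = 0" by (metis complex_cnj_diff minus_complex.simps(1) cnj.simps(1) uminus_complex.simps(1) equal_neg_zero)
  then show D: "D = \<i> * of_real (Im D)" by (simp add: complex_eq_iff)
  define Z W where "Z = a + b + c" and "W = a * b + b * c + c * a"
  \<comment> \<open>Discriminant of the monic cubic with roots \<open>a\<close>, \<open>b\<close>,
    \<open>c\<close>, expressed in its coefficients.\<close>
  have "D\<^sup>2 = Z\<^sup>2 * W\<^sup>2 - 4 * W ^ 3 - 4 * Z ^ 3 * (a * b * c) + 18 * Z * W * (a * b * c) - 27 * (a * b * c)\<^sup>2"
    unfolding D_def Z_def W_def by (simp add: power2_eq_square power3_eq_cube power4_eq_xxxx algebra_simps)
  then have D2: "D\<^sup>2 = (Z * W)\<^sup>2 - 4 * (Z ^ 3 + W ^ 3) + 18 * (Z * W) - 27"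
    unfolding abc by (simp add: algebra_simps power_mult_distrib)
  have W: "W = cnj Z" using Z by (simp add: Z_def W_def)
  have ZW: "Z * W = of_real ((cmod Z)\<^sup>2)" unfolding W by (rule complex_norm_square[symmetric])
  have Z3: "Z ^ 3 + W ^ 3 = of_real (2 * Re (Z ^ 3))"
    unfolding W by (metis complex_add_cnj complex_cnj_power)
  have "D\<^sup>2 = - of_real ((Im D)\<^sup>2)"
    by (subst D) (simp add: power_mult_distrib)
  with D2 have "- of_real ((Im D)\<^sup>2)
      = (of_real (((cmod Z)\<^sup>2)\<^sup>2 - 4 * (2 * Re (Z ^ 3)) + 18 * (cmod Z)\<^sup>2 - 27) :: complex)"
    unfolding ZW Z3 by simp
  then have "- ((Im D)\<^sup>2) = ((cmod Z)\<^sup>2)\<^sup>2 - 4 * (2 * Re (Z ^ 3)) + 18 * (cmod Z)\<^sup>2 - 27"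
    by (metis of_real_eq_iff of_real_minus)
  then show "height (a + b + c) (Im D) = 27"
    unfolding height_def Z_def[symmetric] by (simp add: power_mult[symmetric])
qed

text \<open>The symmetric functions determine the roots up to order, and the Vandermonde product
  changes sign under odd permutations, which leaves the cyclic ones. If it vanishes, two roots
  coincide and an odd permutation has the same effect as a cyclic one.\<close>

lemma vandermonde_determines:
  fixes a b c a' b' c' :: complex
  assumes e1: "a + b + c = a' + b' + c'" and e2: "a * b + b * c + c * a = a' * b' + b' * c' + c' * a'"
    and e3: "a * b * c = 1" "a' * b' * c' = 1"
    and D: "(a - b) * (b - c) * (c - a) = (a' - b') * (b' - c') * (c' - a')"
  shows "a' = a \<and> b' = b \<and> c' = c \<or> a' = b \<and> b' = c \<and> c' = a \<or> a' = c \<and> b' = a \<and> c' = b"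
proof -
  \<comment> \<open>The root \<open>a'\<close> is one of the three, and a cyclic shift, under which
    all hypotheses are invariant, makes it the first.\<close>
  have step: "b' = b \<and> c' = c \<or> a' = b \<and> b' = c \<and> c' = a \<or> a' = c \<and> b' = a \<and> c' = b"
    if "a' = a" and e1: "a + b + c = a' + b' + c'" and e3: "a * b * c = 1" "a' * b' * c' = 1"
      and D: "(a - b) * (b - c) * (c - a) = (a' - b') * (b' - c') * (c' - a')"
    for a b c :: complex
  proof -
    have "a \<noteq> 0" using e3 by auto
    have s: "b' + c' = b + c" using e1 \<open>a' = a\<close> by simp
    have "a * (b * c) = a * (b' * c')" using e3 \<open>a' = a\<close> by (simp add: mult.assoc)
    then have p: "b * c = b' * c'" using \<open>a \<noteq> 0\<close> by simp
    have "(b' - b) * (b' - c) = b' * (b' - (b + c)) + b * c" by (simp add: algebra_simps)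
    also have "\<dots> = 0" unfolding s[symmetric] p by (simp add: algebra_simps)
    finally consider "b' = b" | "b' = c" by auto
    then show ?thesis
    proof cases
      case 1 then show ?thesis using s by simp
    next
      case 2
      then have "c' = b" using s by simp
      then have "(a - b) * (b - c) * (c - a) = (a - c) * (c - b) * (b - a)"
        using D 2 \<open>a' = a\<close> by simp
      also have "\<dots> = - ((a - b) * (b - c) * (c - a))" by (simp add: power2_eq_square power3_eq_cube power4_eq_xxxx algebra_simps)
      finally have "(a - b) * (b - c) * (c - a) = 0" by simp
      then have "a = b \<or> b = c \<or> c = a" by simp
      then show ?thesis using 2 \<open>c' = b\<close> \<open>a' = a\<close> by auto
    qed
  qed
  have "(a' - a) * (a' - b) * (a' - c) = a' ^ 3 - (a + b + c) * a'\<^sup>2 + (a * b + b * c + c * a) * a' - a * b * c"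
    by (simp add: power2_eq_square power3_eq_cube power4_eq_xxxx algebra_simps)
  also have "\<dots> = a' ^ 3 - (a' + b' + c') * a'\<^sup>2 + (a' * b' + b' * c' + c' * a') * a' - a' * b' * c'"
    using e1 e2 e3 by simp
  also have "\<dots> = 0" by (simp add: power2_eq_square power3_eq_cube power4_eq_xxxx algebra_simps)
  finally consider "a' = a" | "a' = b" | "a' = c" by auto
  then show ?thesis
  proof cases
    case 1 then show ?thesis using step[of a b c] e1 e3 D by blast
  next
    case 2 then show ?thesis using step[of b c a] e1 e3 D by (simp add: algebra_simps) blast
  next
    case 3 then show ?thesis using step[of c a b] e1 e3 D by (simp add: algebra_simps) blast
  qed
qed

text \<open>Rotation by \<open>omega\<close> permutes the three characters cyclically and so changes
  neither coordinate. The Vandermonde product is purely imaginary, hence its imaginary part loses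
  nothing.\<close>

definition triangle_surface :: "complex \<Rightarrow> complex \<times> real" where
  "triangle_surface z =
    (let a = lattice_character z; b = lattice_character (omega * z);
         c = lattice_character (omega * (omega * z))
     in (a + b + c, Im ((a - b) * (b - c) * (c - a))))"

lemma height_triangle_surface:
  "height (fst (triangle_surface z)) (snd (triangle_surface z)) = 27"
  unfolding triangle_surface_def Let_def fst_conv snd_conv
  by (rule vandermonde_level(3)) (simp_all add: lattice_character_prod)

lemma triangle_surface_nonzero: "triangle_surface z \<noteq> 0"
  using height_triangle_surface[of z] by (auto simp: height_def)

text \<open>Equal values determine the triple of characters up to a cyclic shift, which amounts to a
  rotation by a power of \<open>omega\<close>; two of the characters then fix the point modulo the
  lattice.\<close>

lemma triangle_surface_eq_iff:
  "triangle_surface z = triangle_surface w \<longleftrightarrow> (\<exists>j<3. w - omega ^ j * z \<in> Eisenstein)"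
proof -
  let ?\<chi> = lattice_character
  let ?o = "\<lambda>z. omega * z"
  have o3: "?o (?o (?o u)) = u" for u
    using omega_cubed by (metis mult.assoc mult_1 power3_eq_cube)
  have split: "(\<exists>j<3. w - omega ^ j * z \<in> Eisenstein) \<longleftrightarrow>
      w - z \<in> Eisenstein \<or> w - ?o z \<in> Eisenstein \<or> w - ?o (?o z) \<in> Eisenstein"
    by (simp add: numeral_3_eq_3 less_Suc_eq power2_eq_square ex_disj_distrib conj_disj_distribR mult.assoc)
  have rot: "triangle_surface (?o u) = triangle_surface u" for u
    unfolding triangle_surface_def Let_def o3 by (simp add: algebra_simps)
  have "triangle_surface z = triangle_surface w" if "w - z \<in> Eisenstein" for z w
  proof -
    have "?\<chi> w = ?\<chi> z" "?\<chi> (?o w) = ?\<chi> (?o z)"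
      using that lattice_character_eq_iff by blast+
    moreover have "?o w - ?o z \<in> Eisenstein"
      using Eisenstein_mult[OF omega_in that] by (simp add: algebra_simps)
    then have "?\<chi> (?o (?o w)) = ?\<chi> (?o (?o z))"
      using lattice_character_eq_iff by blast
    ultimately show ?thesis by (simp add: triangle_surface_def)
  qed
  then have "triangle_surface z = triangle_surface w" if "\<exists>j<3. w - omega ^ j * z \<in> Eisenstein"
    using that rot unfolding split by metis
  moreover have "\<exists>j<3. w - omega ^ j * z \<in> Eisenstein" if eq: "triangle_surface z = triangle_surface w"
  proof -
    define a b c where "a = ?\<chi> z" and "b = ?\<chi> (?o z)" and "c = ?\<chi> (?o (?o z))"
    define a' b' c' where "a' = ?\<chi> w" and "b' = ?\<chi> (?o w)" and "c' = ?\<chi> (?o (?o w))"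
    have n: "cmod a = 1" "cmod b = 1" "cmod c = 1" "cmod a' = 1" "cmod b' = 1" "cmod c' = 1"
      by (simp_all add: a_def b_def c_def a'_def b'_def c'_def)
    have p: "a * b * c = 1" "a' * b' * c' = 1"
      by (simp_all add: a_def b_def c_def a'_def b'_def c'_def lattice_character_prod)
    have 1: "a + b + c = a' + b' + c'"
      and 2: "Im ((a - b) * (b - c) * (c - a)) = Im ((a' - b') * (b' - c') * (c' - a'))"
      using eq by (simp_all add: triangle_surface_def Let_def a_def b_def c_def a'_def b'_def c'_def)
    have "a' = a \<and> b' = b \<and> c' = c \<or> a' = b \<and> b' = c \<and> c' = a \<or> a' = c \<and> b' = a \<and> c' = b"
    proof (rule vandermonde_determines[OF 1 _ p])
      show "a * b + b * c + c * a = a' * b' + b' * c' + c' * a'"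
        using vandermonde_level(1)[OF n(1-3) p(1)] vandermonde_level(1)[OF n(4-6) p(2)] 1 by metis
      show "(a - b) * (b - c) * (c - a) = (a' - b') * (b' - c') * (c' - a')"
        using vandermonde_level(2)[OF n(1-3) p(1)] vandermonde_level(2)[OF n(4-6) p(2)] 2 by metis
    qed
    then have "w - z \<in> Eisenstein \<or> w - ?o z \<in> Eisenstein \<or> w - ?o (?o z) \<in> Eisenstein"
      unfolding a_def b_def c_def a'_def b'_def c'_def
      using lattice_character_eq_iff[of w z] lattice_character_eq_iff[of w "?o z"]
        lattice_character_eq_iff[of w "?o (?o z)"] o3[of z] by metis
    then show ?thesis unfolding split .
  qed
  ultimately show ?thesis by blast
qed

definition triangle_projection :: "complex \<Rightarrow> complex \<times> real" where
  "triangle_projection z = triangle_surface z /\<^sub>R norm (triangle_surface z)"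

text \<open>Two points of the surface on one ray coincide: if one were a proper multiple of the
  other their heights would differ, yet both are 27.\<close>

lemma triangle_projection_eq_iff:
  "triangle_projection z = triangle_projection w \<longleftrightarrow> (\<exists>j<3. w - omega ^ j * z \<in> Eisenstein)"
proof -
  have not_less: "\<not> norm (triangle_surface u) < norm (triangle_surface v)"
    if eq: "triangle_projection u = triangle_projection v" for u v
  proof
    assume less: "norm (triangle_surface u) < norm (triangle_surface v)"
    define m where "m = norm (triangle_surface v) / norm (triangle_surface u)"
    have nz: "norm (triangle_surface u) > 0" "norm (triangle_surface v) > 0"
      by (simp_all add: triangle_surface_nonzero)
    have m: "m > 1" using less nz by (simp add: m_def)
    have "triangle_surface v = norm (triangle_surface v) *\<^sub>R triangle_projection v"
      using nz by (simp add: triangle_projection_def)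
    also have "\<dots> = m *\<^sub>R triangle_surface u"
      unfolding eq[symmetric] by (simp add: triangle_projection_def m_def divide_inverse)
    finally have v: "triangle_surface v = m *\<^sub>R triangle_surface u" .
    have "height (fst (triangle_surface u)) (snd (triangle_surface u))
        < height (of_real m * fst (triangle_surface u)) (m * snd (triangle_surface u))"
      by (rule height_scale_mono[OF m]) (simp add: triangle_surface_nonzero)
    also have "\<dots> = height (fst (triangle_surface v)) (snd (triangle_surface v))"
      by (simp add: v scaleR_conv_of_real)
    finally show False by (simp add: height_triangle_surface)
  qed
  have "triangle_surface z = triangle_surface w" if eq: "triangle_projection z = triangle_projection w"
  proof -
    have "norm (triangle_surface z) = norm (triangle_surface w)"
      using not_less[OF eq] not_less[OF eq[symmetric]] by linarith
    then show ?thesis using eq triangle_surface_nonzero[of z] triangle_surface_nonzero[of w]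
      by (simp add: triangle_projection_def)
  qed
  then show ?thesis
    unfolding triangle_surface_eq_iff[symmetric] by (auto simp: triangle_projection_def)
qed

lemma continuous_triangle_projection: "continuous_on UNIV triangle_projection"
  unfolding triangle_projection_def triangle_surface_def Let_def
  using triangle_surface_nonzero
  by (intro continuous_intros) (simp add: triangle_surface_def Let_def)

lemma triangle_projection_in: "triangle_projection z \<in> unit_sphere"
  by (simp add: triangle_projection_def triangle_surface_nonzero)

section \<open>Charts of the orbifold projection\<close>

lemma complex_root_in_ball:
  fixes v :: complex
  assumes "v \<in> ball 0 (r ^ k)" "0 < k" "0 < r"
  obtains w where "w \<in> ball 0 r" "w ^ k = v"
proof -
  obtain w where w: "w ^ k = v"
  proof (cases "v = 0")
    case True then show ?thesis using that[of 0] assms by simp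
  next
    case False
    have "exp (Ln v / of_nat k) ^ k = v" using assms False by (simp flip: exp_of_nat_mult)
    then show ?thesis using that by blast
  qed
  have "cmod w ^ k < r ^ k" using w assms by (metis dist_0_norm mem_ball norm_power)
  then have "cmod w < r" using assms by (meson less_imp_le power_less_imp_less_base)
  then show thesis using that w by simp
qed

text \<open>Distinct lattice points are at least 1 apart, so at most one of them is closer than 1/2
  to \<open>p\<close>.\<close>

lemma Eisenstein_isolated: "\<exists>\<epsilon>>0. \<forall>t\<in>Eisenstein. t \<noteq> p \<longrightarrow> \<epsilon> \<le> cmod (t - p)"
proof (cases "\<exists>t\<in>Eisenstein. t \<noteq> p \<and> cmod (t - p) < 1/2")
  case False
  then show ?thesis by (intro exI[of _ "1/2"]) force
next
  case True
  then obtain t where t: "t \<in> Eisenstein" "t \<noteq> p" "cmod (t - p) < 1/2" by blast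
  have "cmod (t - p) \<le> cmod (s - p)" if s: "s \<in> Eisenstein" for s
  proof (cases "s = t")
    case False
    then have "1 \<le> cmod (s - t)"
      using norm_Eisenstein_ge_1[of "s - t"] s t by auto
    also have "\<dots> \<le> cmod (s - p) + cmod (t - p)"
      by (metis norm_triangle_ineq4 diff_diff_eq2 diff_add_cancel add_diff_cancel_right)
    finally show ?thesis using t by linarith
  qed simp
  then show ?thesis using t by (intro exI[of _ "cmod (t - p)"]) auto
qed

lemma cube_eq_iff: "u ^ 3 = v ^ 3 \<longleftrightarrow> (\<exists>j<3. v = omega ^ j * u)"
proof
  assume "u ^ 3 = v ^ 3"
  have "(v - u) * (v - omega * u) * (v - omega * omega * u)
      = v ^ 3 - (1 + omega + omega * omega) * (v\<^sup>2 * u) + omega * (1 + omega + omega * omega) * (v * u\<^sup>2) - omega ^ 3 * u ^ 3"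
    by (simp add: power2_eq_square power3_eq_cube algebra_simps)
  also have "\<dots> = v ^ 3 - u ^ 3" by (simp add: omega_cubed omega_squared)
  also have "\<dots> = 0" using \<open>u ^ 3 = v ^ 3\<close> by simp
  finally have "v = omega ^ 0 * u \<or> v = omega ^ 1 * u \<or> v = omega ^ 2 * u"
    by (auto simp: power2_eq_square)
  then show "\<exists>j<3. v = omega ^ j * u"
    by (elim disjE) (force intro: exI[of _ 0], force intro: exI[of _ 1], force intro: exI[of _ 2])
next
  assume "\<exists>j<3. v = omega ^ j * u"
  then obtain j where j: "v = omega ^ j * u" by blast
  have "(omega ^ j) ^ 3 = 1" using omega_cubed by (metis mult.commute power_mult power_one)
  then show "u ^ 3 = v ^ 3" by (simp add: j power_mult_distrib)
qed

text \<open>These are the fixed points of the rotations in the group: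
  \<open>omega * z + t = z\<close> for a lattice vector \<open>t\<close>.\<close>

definition cone_point :: "complex \<Rightarrow> bool" where
  "cone_point z \<longleftrightarrow> (1 - omega) * z \<in> Eisenstein"

definition cone_index :: "complex \<Rightarrow> nat" where
  "cone_index z = (if cone_point z then 3 else 1)"

lemma cone_index_pos [simp]: "0 < cone_index z" "Suc 0 \<le> cone_index z"
  by (simp_all add: cone_index_def)

lemma cone_point_0 [simp]: "cone_point 0" by (simp add: cone_point_def)

lemma cone_point_Eisenstein_mult: "e \<in> Eisenstein \<Longrightarrow> cone_point z \<Longrightarrow> cone_point (e * z)"
  unfolding cone_point_def using Eisenstein_mult[of e "(1 - omega) * z"] by (simp add: algebra_simps)

text \<open>Rotations by \<open>omega\<close> and by \<open>omega^2\<close> have the same centres,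
  since \<open>1 - omega\<close> and \<open>1 - omega^2\<close> differ by the unit
  \<open>- omega\<close>.\<close>

lemma cone_point_power_diff:
  assumes "j < 3" "(1 - omega ^ j) * z \<in> Eisenstein" "j \<noteq> 0" shows "cone_point z"
proof -
  consider "j = 1" | "j = 2" using assms by linarith
  then show ?thesis
  proof cases
    case 1 then show ?thesis using assms by (simp add: cone_point_def)
  next
    case 2
    have "- omega * ((1 - omega ^ 2) * z) = (omega ^ 3 - omega) * z"
      by (simp add: power2_eq_square power3_eq_cube algebra_simps)
    then have "- omega * ((1 - omega ^ 2) * z) = (1 - omega) * z" by (simp add: omega_cubed)
    moreover have "- omega * ((1 - omega ^ 2) * z) \<in> Eisenstein"
      using assms 2 by (intro Eisenstein_mult[of "- omega"] Eisenstein_minus) auto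
    ultimately show ?thesis by (simp add: cone_point_def)
  qed
qed

lemma cone_point_power_diff_in:
  assumes "cone_point z" shows "(1 - omega ^ j) * z \<in> Eisenstein"
proof (induction j)
  case (Suc j)
  have "(1 - omega ^ Suc j) * z = (1 - omega) * z + omega * ((1 - omega ^ j) * z)"
    by (simp add: algebra_simps)
  moreover have "(1 - omega) * z + omega * ((1 - omega ^ j) * z) \<in> Eisenstein"
    using Suc assms by (intro Eisenstein_add Eisenstein_mult[of omega]) (auto simp: cone_point_def)
  ultimately show ?case by simp
qed simp

lemma countable_Eisenstein: "countable Eisenstein"
proof -
  have "Eisenstein = range (\<lambda>(a, b). eis a b)" by (auto simp: Eisenstein_def)
  then show ?thesis by (metis countableI_type countable_image)
qed

lemma countable_cone_points: "countable {z. cone_point z}"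
proof -
  have "{z. cone_point z} \<subseteq> (\<lambda>t. t / (1 - omega)) ` Eisenstein"
  proof
    fix z assume "z \<in> {z. cone_point z}"
    moreover have "z = ((1 - omega) * z) / (1 - omega)" by simp
    ultimately show "z \<in> (\<lambda>t. t / (1 - omega)) ` Eisenstein"
      unfolding cone_point_def by blast
  qed
  then show ?thesis using countable_Eisenstein by (meson countable_image countable_subset)
qed

text \<open>
  The quotient map from the plane to the orbifold \<open>S(3,3,3)\<close>, that is, to the quotient by the group
  generated by the Eisenstein translations and the rotation \<open>omega\<close>.
\<close>

locale orbifold_projection =
  fixes P :: "complex \<Rightarrow> complex \<times> real"
  assumes cont: "continuous_on UNIV P"
    and in_sphere: "P z \<in> unit_sphere"
    and eq_iff: "P z = P w \<longleftrightarrow> (\<exists>j<3. w - omega ^ j * z \<in> Eisenstein)"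
begin

lemma translate: "t \<in> Eisenstein \<Longrightarrow> P (z + t) = P z"
  using eq_iff[of z "z + t"] by (metis add_diff_cancel_left' mult_1 power_0 zero_less_numeral)

lemma rotate: "P (omega ^ j * z) = P z"
proof -
  have "P (omega * u) = P u" for u
    using eq_iff[of u "omega * u"] by (metis Eisenstein_0 diff_self one_less_numeral_iff power_one_right semiring_norm(77))
  then show ?thesis by (induction j) (simp_all add: mult.assoc)
qed

text \<open>A group element that carries a point near \<open>z\<close> to another such point moves
  \<open>z\<close> very little, so by discreteness it fixes \<open>z\<close>. The stabiliser of
  \<open>z\<close> is trivial or consists of the three rotations about \<open>z\<close>, and these
  are what the power \<open>cone_index z\<close> forgets.\<close>

lemma local_identification:
  "\<exists>r>0. \<forall>u v. cmod u \<le> r \<longrightarrow> cmod v \<le> r \<longrightarrow>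
     (P (z + u) = P (z + v) \<longleftrightarrow> u ^ cone_index z = v ^ cone_index z)"
proof -
  have "\<forall>j. \<exists>\<epsilon>>0. \<forall>t\<in>Eisenstein. t \<noteq> (omega ^ j - 1) * z \<longrightarrow> \<epsilon> \<le> cmod (t - (omega ^ j - 1) * z)"
    using Eisenstein_isolated by blast
  then obtain \<epsilon> where \<epsilon>: "\<And>j::nat. 0 < \<epsilon> j"
    "\<And>j t. t \<in> Eisenstein \<Longrightarrow> t \<noteq> (omega ^ j - 1) * z \<Longrightarrow> \<epsilon> j \<le> cmod (t - (omega ^ j - 1) * z)"
    by metis
  \<comment> \<open>A third, because \<open>cmod (omega ^ j * u - v)\<close> is at most
    \<open>2 * r\<close> and has to stay strictly below every isolation distance.\<close>
  define r where "r = Min (\<epsilon> ` {..<3}) / 3"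
  have fin: "finite (\<epsilon> ` {..<3})" "\<epsilon> ` {..<3} \<noteq> {}" by (auto simp: lessThan_empty_iff)
  have r: "r > 0" unfolding r_def using fin \<epsilon> by (simp add: Min_gr_iff)
  have r\<epsilon>: "3 * r \<le> \<epsilon> j" if "j < 3" for j unfolding r_def using fin that by (auto intro: Min_le)
  have "P (z + u) = P (z + v) \<longleftrightarrow> u ^ cone_index z = v ^ cone_index z"
    if uv: "cmod u \<le> r" "cmod v \<le> r" for u v
  proof
    assume "P (z + u) = P (z + v)"
    then obtain j where j: "j < 3" and t: "(z + v) - omega ^ j * (z + u) \<in> Eisenstein"
      unfolding eq_iff by blast
    define t where "t = - ((z + v) - omega ^ j * (z + u))"
    have tE: "t \<in> Eisenstein" unfolding t_def using t by blast
    have tj: "t - (omega ^ j - 1) * z = omega ^ j * u - v" by (simp add: t_def algebra_simps)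
    have "cmod (omega ^ j * u - v) \<le> cmod (omega ^ j * u) + cmod v" by (rule norm_triangle_ineq4)
    also have "\<dots> = cmod u + cmod v" by (simp add: norm_mult norm_power)
    also have "\<dots> < \<epsilon> j" using uv r r\<epsilon>[OF j] by linarith
    finally have t2: "t = (omega ^ j - 1) * z" using \<epsilon>(2)[OF tE, of j] tj by force
    then have v: "v = omega ^ j * u" using tj by simp
    show "u ^ cone_index z = v ^ cone_index z"
    proof (cases "cone_point z")
      case True
      then show ?thesis using v j cube_eq_iff[of u v] by (auto simp: cone_index_def)
    next
      case False
      have "(1 - omega ^ j) * z = - t" by (simp add: t2 algebra_simps)
      then have "j = 0" using tE False cone_point_power_diff[OF j] by (metis Eisenstein_minus)
      then show ?thesis using v by simp
    qed
  next
    assume eq: "u ^ cone_index z = v ^ cone_index z"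
    show "P (z + u) = P (z + v)"
    proof (cases "cone_point z")
      case True
      then obtain j where j: "j < 3" "v = omega ^ j * u"
        using eq cube_eq_iff[of u v] by (auto simp: cone_index_def)
      then have "(z + v) - omega ^ j * (z + u) = (1 - omega ^ j) * z" by (simp add: algebra_simps)
      then show ?thesis using cone_point_power_diff_in[OF True] j unfolding eq_iff by metis
    next
      case False
      then show ?thesis using eq by (simp add: cone_index_def)
    qed
  qed
  then show ?thesis using r by blast
qed

text \<open>In the coordinate \<open>w^k\<close> the projection becomes injective, hence an inverse
  chart \<open>Q\<close> of the sphere. Closed discs are used for compactness: the power map is then
  a quotient map, which makes \<open>Q\<close> continuous, and \<open>Q\<close> is a homeomorphism
  onto its image. Openness comes from invariance of domain.\<close>

lemma chart:
  obtains r Q Q' where "r > 0"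
    "homeomorphism (cball 0 (r ^ cone_index z)) (Q ` cball 0 (r ^ cone_index z)) Q Q'"
    "\<And>w. cmod w \<le> r \<Longrightarrow> P (z + w) = Q (w ^ cone_index z)"
    "\<And>U. open U \<Longrightarrow> U \<subseteq> cball 0 (r ^ cone_index z) \<Longrightarrow> openin S2 (Q ` U)"
proof -
  define k where "k = cone_index z"
  have k: "0 < k" by (simp add: k_def)
  obtain r where r: "r > 0" and id: "\<And>u v :: complex. cmod u \<le> r \<Longrightarrow> cmod v \<le> r \<Longrightarrow>
      (P (z + u) = P (z + v) \<longleftrightarrow> u ^ k = v ^ k)"
    using local_identification[of z] unfolding k_def by blast
  have root: "\<exists>w :: complex. w ^ k = v \<and> cmod w \<le> r" if v: "v \<in> cball 0 (r ^ k)" for v :: complex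
  proof -
    obtain w where w: "w ^ k = v"
    proof (cases "v = 0")
      case True then show ?thesis using that[of 0] k by simp
    next
      case False
      have "exp (Ln v / of_nat k) ^ k = v" using k False by (simp flip: exp_of_nat_mult)
      then show ?thesis using that by blast
    qed
    then have "cmod w ^ k \<le> r ^ k" using v by (metis dist_0_norm mem_cball norm_power)
    then have "cmod w \<le> r" using r k by (meson less_imp_le power_mono_iff norm_ge_zero)
    then show ?thesis using w by blast
  qed
  define Q where "Q v = P (z + (SOME w. w ^ k = v \<and> cmod w \<le> r))" for v
  have Q: "P (z + w) = Q (w ^ k)" if "cmod w \<le> r" for w
  proof -
    have "\<exists>w'. w' ^ k = w ^ k \<and> cmod w' \<le> r" using that by blast
    then have "(SOME w'. w' ^ k = w ^ k \<and> cmod w' \<le> r) ^ k = w ^ k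
        \<and> cmod (SOME w'. w' ^ k = w ^ k \<and> cmod w' \<le> r) \<le> r"
      by (rule someI_ex)
    then show ?thesis unfolding Q_def using id that by metis
  qed
  have im: "(\<lambda>w::complex. w ^ k) ` cball 0 r = cball 0 (r ^ k)"
  proof (intro equalityI subsetI)
    fix v :: complex assume "v \<in> (\<lambda>w. w ^ k) ` cball 0 r"
    then obtain w where "v = w ^ k" "cmod w \<le> r" by auto
    then show "v \<in> cball 0 (r ^ k)" by (simp add: norm_power power_mono)
  next
    fix v :: complex assume "v \<in> cball 0 (r ^ k)"
    then obtain w :: complex where "w ^ k = v" "cmod w \<le> r" using root by blast
    then show "v \<in> (\<lambda>w. w ^ k) ` cball 0 r" by (intro image_eqI[of _ _ w]) simp_all
  qed
  have quot: "quotient_map (top_of_set (cball 0 r)) (top_of_set (cball 0 (r ^ k))) (\<lambda>w::complex. w ^ k)"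
  proof (rule T1_Spaces.continuous_imp_quotient_map)
    show "continuous_map (top_of_set (cball 0 r)) (top_of_set (cball 0 (r ^ k))) (\<lambda>w::complex. w ^ k)"
      using im by (auto simp: continuous_map_subtopology_eu intro!: continuous_intros)
    show "compact_space (top_of_set (cball 0 r :: complex set))"
      by (simp add: compact_space_subtopology)
    show "Hausdorff_space (top_of_set (cball 0 (r ^ k) :: complex set))"
      by (simp add: Hausdorff_space_subtopology Hausdorff_space_euclidean)
  qed (simp add: im)
  have "continuous_on (cball 0 r) (\<lambda>w. P (z + w))"
    by (rule continuous_on_compose2[OF cont]) (auto intro: continuous_intros)
  then have "continuous_on (cball 0 r) (Q \<circ> (\<lambda>w. w ^ k))"
    by (rule continuous_on_eq) (auto simp: Q)
  then have "continuous_map (top_of_set (cball 0 r)) euclidean (Q \<circ> (\<lambda>w. w ^ k))"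
    by simp
  then have "continuous_map (top_of_set (cball 0 (r ^ k))) euclidean Q"
    using continuous_compose_quotient_map[OF quot] by blast
  then have contQ: "continuous_on (cball 0 (r ^ k)) Q" by simp
  have injQ: "inj_on Q (cball 0 (r ^ k))"
  proof (rule inj_onI)
    fix u v assume uv: "u \<in> cball 0 (r ^ k)" "v \<in> cball 0 (r ^ k)" "Q u = Q v"
    obtain w w' where w: "w ^ k = u" "cmod w \<le> r" "w' ^ k = v" "cmod w' \<le> r"
      using root uv by meson
    then have "P (z + w) = P (z + w')" using Q uv by simp
    then show "u = v" using id w by blast
  qed
  obtain Q' where hom: "homeomorphism (cball 0 (r ^ k)) (Q ` cball 0 (r ^ k)) Q Q'"
    using homeomorphism_compact[OF _ contQ refl injQ] by (meson compact_cball)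
  have "openin S2 (Q ` U)" if "open U" "U \<subseteq> cball 0 (r ^ k)" for U
  proof (rule invariance_of_domain_into_sphere[OF that(1)])
    show "continuous_on U Q" "inj_on Q U"
      using that contQ injQ by (blast intro: continuous_on_subset inj_on_subset)+
    show "Q ` U \<subseteq> unit_sphere" unfolding Q_def using in_sphere by blast
  qed
  then show thesis using that[of r Q Q'] r hom Q unfolding k_def by blast
qed

lemma image_ball_open: "\<exists>N. openin S2 N \<and> P z \<in> N \<and> N \<subseteq> P ` ball z e" if "e > 0"
proof -
  define k where "k = cone_index z"
  obtain r Q Q' where r: "r > 0" and Q: "\<And>w. cmod w \<le> r \<Longrightarrow> P (z + w) = Q (w ^ k)"
    and op: "\<And>U. open U \<Longrightarrow> U \<subseteq> cball 0 (r ^ k) \<Longrightarrow> openin S2 (Q ` U)"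
    using chart[of z] unfolding k_def by metis
  define s where "s = min r e"
  have s: "0 < s" "s \<le> r" "s \<le> e" using r that by (auto simp: s_def)
  have "Q ` ball 0 (s ^ k) \<subseteq> P ` ball z e"
  proof (rule image_subsetI)
    fix v :: complex assume v: "v \<in> ball 0 (s ^ k)"
    then obtain w where w: "w \<in> ball 0 s" "w ^ k = v"
      using complex_root_in_ball[OF v _ s(1)] by (auto simp: k_def)
    then have "Q v = P (z + w)" "z + w \<in> ball z e" using Q[of w] w s by (auto simp: dist_norm)
    then show "Q v \<in> P ` ball z e" by blast
  qed
  moreover have "openin S2 (Q ` ball 0 (s ^ k))"
    using s power_mono[of s r k] by (intro op) auto
  moreover have "P z = Q 0" using Q[of 0] r by (simp add: k_def zero_power[OF cone_index_pos(1)])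
  then have "P z \<in> Q ` ball 0 (s ^ k)" using s by simp
  ultimately show ?thesis by blast
qed

lemma image_cball: "P ` cball 0 1 = range P"
proof (intro equalityI subsetI)
  fix y assume "y \<in> range P"
  then obtain z where z: "y = P z" by blast
  obtain e where e: "e \<in> Eisenstein" "cmod (z - e) < 1" using Eisenstein_approx by blast
  have "P z = P (z - e)" using translate[of e "z - e"] e by simp
  then show "y \<in> P ` cball 0 1" using e z by (intro image_eqI[of _ _ "z - e"]) auto
qed auto

text \<open>The image is compact, because the unit disc already covers it, and open, by the charts;
  the sphere is connected.\<close>

lemma surj: "range P = unit_sphere"
proof -
  have "compact (range P)"
    by (metis image_cball compact_cball compact_continuous_image cont continuous_on_subset subset_UNIV)
  then have 1: "closedin S2 (range P)"
    by (meson closed_subset compact_imp_closed image_subsetI in_sphere)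
  have 2: "openin S2 (range P)"
  proof (subst openin_subopen, intro ballI)
    fix y assume "y \<in> range P"
    then obtain z where "y = P z" by blast
    moreover obtain N where "openin S2 N" "P z \<in> N" "N \<subseteq> P ` ball z 1"
      using image_ball_open[of 1 z] by auto
    ultimately show "\<exists>N. openin S2 N \<and> y \<in> N \<and> N \<subseteq> range P" by blast
  qed
  show ?thesis
    using connected_unit_sphere[unfolded connected_clopen, rule_format, of "range P"] 1 2 by blast
qed

text \<open>This is what allows the cone points to be placed at prescribed points of the
  sphere.\<close>

lemma compose_homeomorphism:
  assumes "homeomorphism unit_sphere unit_sphere h h'"
  shows "orbifold_projection (h \<circ> P)"
proof
  show "continuous_on UNIV (h \<circ> P)"
    by (meson assms cont continuous_on_compose continuous_on_subset homeomorphism_def image_subsetI in_sphere)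
  show "(h \<circ> P) z \<in> unit_sphere" for z
    using assms in_sphere by (metis comp_apply homeomorphism_image1 imageI)
  show "(h \<circ> P) z = (h \<circ> P) w \<longleftrightarrow> (\<exists>j<3. w - omega ^ j * z \<in> Eisenstein)" for z w
    using assms in_sphere eq_iff by (metis comp_apply homeomorphism_apply1)
qed

end

interpretation triangle: orbifold_projection triangle_projection
  by unfold_locales (rule continuous_triangle_projection triangle_projection_in triangle_projection_eq_iff)+

section \<open>Local degrees\<close>

text \<open>In the second pair of charts, \<open>l\<close> points of a small circle have a common
  image under \<open>f\<close>. The first chart sends them injectively to roots of one equation
  \<open>z^k = c\<close>, of which there are at most \<open>k\<close>. Exchanging the roles makes
  the local degree unique.\<close>

lemma has_local_degree_le:
  assumes "has_local_degree X Y f x k" "has_local_degree X Y f x l"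
  shows "l \<le> k"
proof -
  obtain U1 V1 D1 E1 \<phi>1 \<psi>1 where 1: "k \<ge> 1" "openin X U1" "x \<in> U1" "openin Y V1" "f ` U1 \<subseteq> V1"
      "homeomorphic_map (subtopology X U1) (top_of_set (D1 :: complex set)) \<phi>1" "\<forall>u\<in>U1. \<psi>1 (f u) = \<phi>1 u ^ k"
    using assms(1) unfolding has_local_degree_def by blast
  obtain U2 V2 D2 E2 \<phi>2 \<psi>2 where 2: "l \<ge> 1" "openin X U2" "x \<in> U2" "openin Y V2" "f ` U2 \<subseteq> V2"
      "open (D2 :: complex set)" "homeomorphic_map (subtopology X U2) (top_of_set D2) \<phi>2" "\<phi>2 x = 0"
      "homeomorphic_map (subtopology Y V2) (top_of_set (E2 :: complex set)) \<psi>2"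
      "\<forall>u\<in>U2. \<psi>2 (f u) = \<phi>2 u ^ l"
    using assms(2) unfolding has_local_degree_def by metis
  have tU1: "topspace (subtopology X U1) = U1" and tU2: "topspace (subtopology X U2) = U2"
    and tV2: "topspace (subtopology Y V2) = V2"
    using 1 2 by (auto dest: openin_subset)
  have inj\<phi>1: "inj_on \<phi>1 U1" using 1(6) tU1 homeomorphic_imp_injective_map by metis
  have inj\<psi>2: "inj_on \<psi>2 V2" using 2(9) tV2 homeomorphic_imp_injective_map by metis
  have "openin (subtopology X U2) (U1 \<inter> U2)" using 1 2 by (auto simp: openin_subtopology)
  then have "openin (top_of_set D2) (\<phi>2 ` (U1 \<inter> U2))"
    using homeomorphic_imp_open_map[OF 2(7)] by (simp add: open_map_def)
  then have "open (\<phi>2 ` (U1 \<inter> U2))" using \<open>open D2\<close> openin_open_trans by blast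
  moreover have "0 \<in> \<phi>2 ` (U1 \<inter> U2)" using 1 2 by (intro image_eqI[of _ _ x]) auto
  ultimately obtain r where r: "r > 0" "cball 0 r \<subseteq> \<phi>2 ` (U1 \<inter> U2)"
    using open_contains_cball by blast
  define R where "R = {z :: complex. z ^ l = of_real r ^ l}"
  have cardR: "card R = l" unfolding R_def using r 2 by (intro card_nth_roots) auto
  have "R \<subseteq> cball 0 r"
  proof
    fix z assume "z \<in> R"
    then have "cmod (z ^ l) = cmod (of_real r ^ l)" by (simp add: R_def)
    then have "cmod z ^ l = r ^ l" using r by (simp add: norm_power)
    then have "cmod z = r" by (rule power_eq_imp_eq_base) (use r 2(1) in auto)
    then show "z \<in> cball 0 r" by simp
  qed
  then have "\<forall>z\<in>R. \<exists>u. u \<in> U1 \<inter> U2 \<and> \<phi>2 u = z" using r by blast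
  then obtain u where u: "\<And>z. z \<in> R \<Longrightarrow> u z \<in> U1 \<inter> U2 \<and> \<phi>2 (u z) = z" by metis
  have same: "f (u z) = f (u (of_real r))" if "z \<in> R" for z
  proof -
    have r': "of_real r \<in> R" by (simp add: R_def)
    have "\<psi>2 (f (u z)) = \<psi>2 (f (u (of_real r)))"
      using 2(10) u[OF that] u[OF r'] that by (simp add: R_def)
    moreover have "f (u z) \<in> V2" "f (u (of_real r)) \<in> V2" using 2 u[OF that] u[OF r'] by blast+
    ultimately show ?thesis using inj\<psi>2 by (meson inj_onD)
  qed
  define c where "c = \<psi>1 (f (u (of_real r)))"
  have sub: "(\<phi>1 \<circ> u) ` R \<subseteq> {z. z ^ k = c}"
    using 1 u same unfolding c_def by (auto simp flip: same)
  have fin: "finite {z::complex. z ^ k = c}" using 1 by (intro finite_nth_roots) auto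
  have "inj_on (\<phi>1 \<circ> u) R"
  proof (rule comp_inj_on)
    show "inj_on u R" using u by (metis inj_onI)
    show "inj_on \<phi>1 (u ` R)" using inj\<phi>1 u by (meson image_subset_iff inj_on_subset IntD1)
  qed
  then have "card R \<le> card {z. z ^ k = c}" using sub fin by (metis card_image card_mono)
  also have "\<dots> \<le> k"
  proof (cases "c = 0")
    case True
    then have "{z. z ^ k = c} = {0}" using 1 by auto
    then show ?thesis using 1 by simp
  next
    case False
    then show ?thesis using 1 card_nth_roots[of c k] by simp
  qed
  finally show ?thesis using cardR by simp
qed

lemma local_degree_eq: "has_local_degree X Y f x k \<Longrightarrow> local_degree X Y f x = k"
  unfolding local_degree_def by (rule the_equality) (auto intro: antisym has_local_degree_le)

lemma has_local_degree_transport: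
  assumes deg: "has_local_degree X Y f x k"
    and g: "homeomorphic_maps X X' g g'" and h: "homeomorphic_maps Y Y' h h'"
  shows "has_local_degree X' Y' (h \<circ> f \<circ> g') (g x) k"
proof -
  obtain U V D E \<phi> \<psi> where *: "k \<ge> 1" "openin X U" "x \<in> U" "openin Y V" "f ` U \<subseteq> V"
    "open (D :: complex set)" "homeomorphic_map (subtopology X U) (top_of_set D) \<phi>" "\<phi> x = 0"
    "open (E :: complex set)" "homeomorphic_map (subtopology Y V) (top_of_set E) \<psi>" "\<psi> (f x) = 0"
    "\<forall>u\<in>U. \<psi> (f u) = \<phi> u ^ k"
    using deg unfolding has_local_degree_def by metis
  have push: "openin X' (g ` U) \<and> homeomorphic_map (subtopology X' (g ` U)) (top_of_set D) (\<phi> \<circ> g')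
      \<and> (\<forall>u\<in>U. g' (g u) = u)"
    if g: "homeomorphic_maps X X' g g'" and U: "openin X U"
      and \<phi>: "homeomorphic_map (subtopology X U) (top_of_set D) \<phi>"
    for X :: "'x topology" and X' :: "'y topology" and g g' U and D :: "complex set" and \<phi>
  proof (intro conjI)
    have gm: "homeomorphic_map X X' g" using g homeomorphic_maps_map by blast
    show "openin X' (g ` U)" using homeomorphic_imp_open_map[OF gm] U by (simp add: open_map_def)
    have sub: "U \<subseteq> topspace X" using U by (rule openin_subset)
    show gg: "\<forall>u\<in>U. g' (g u) = u" using g sub by (auto simp: homeomorphic_maps_def)
    have "g' ` g ` U = U" using gg by force
    moreover have "homeomorphic_map X' X g'" using g homeomorphic_maps_map by blast
    moreover have "g ` U \<subseteq> topspace X'" using \<open>openin X' (g ` U)\<close> by (rule openin_subset)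
    ultimately have "g' ` (topspace X' \<inter> g ` U) = topspace X \<inter> U"
      using sub by (simp add: Int_absorb1)
    then have "homeomorphic_map (subtopology X' (g ` U)) (subtopology X U) g'"
      by (intro homeomorphic_map_subtopologies) (use g homeomorphic_maps_map in blast)+
    then show "homeomorphic_map (subtopology X' (g ` U)) (top_of_set D) (\<phi> \<circ> g')"
      using \<phi> homeomorphic_map_compose by blast
  qed
  note X = push[OF g *(2) *(7)] and Y = push[OF h *(4) *(10)]
  have fU: "f u \<in> V" if "u \<in> U" for u using * that by blast
  show ?thesis
    unfolding has_local_degree_def
    by (intro conjI exI[of _ "g ` U"] exI[of _ "h ` V"] exI[of _ D] exI[of _ E]
          exI[of _ "\<phi> \<circ> g'"] exI[of _ "\<psi> \<circ> h'"])
       (use X Y * fU in auto)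
qed

lemma branched_cover_local_degree:
  assumes "branched_cover X Y f" "x \<in> topspace X"
  shows "has_local_degree X Y f x (local_degree X Y f x)"
  using assms local_degree_eq unfolding branched_cover_def by metis

lemma branched_cover_transport:
  assumes f: "branched_cover X Y f"
    and g: "homeomorphic_maps X X' g g'" and h: "homeomorphic_maps Y Y' h h'"
    and cos: "closed_orientable_surface X'" "closed_orientable_surface Y'"
  defines "f' \<equiv> h \<circ> f \<circ> g'"
  shows "branched_cover X' Y' f'"
    and "\<And>x. x \<in> topspace X \<Longrightarrow> local_degree X' Y' f' (g x) = local_degree X Y f x"
    and "\<And>y. y \<in> topspace Y \<Longrightarrow> local_degrees X' Y' f' (h y) = local_degrees X Y f y"
    and "branching_points X' Y' f' = h ` branching_points X Y f"
    and "has_degree X Y f d \<Longrightarrow> has_degree X' Y' f' d"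
proof -
  have gX: "\<And>x. x \<in> topspace X \<Longrightarrow> g x \<in> topspace X' \<and> g' (g x) = x"
    "\<And>x. x \<in> topspace X' \<Longrightarrow> g' x \<in> topspace X \<and> g (g' x) = x"
    using g by (auto simp: homeomorphic_maps_def continuous_map_def)
  have hY: "\<And>x. x \<in> topspace Y \<Longrightarrow> h x \<in> topspace Y' \<and> h' (h x) = x"
    "\<And>x. x \<in> topspace Y' \<Longrightarrow> h' x \<in> topspace Y \<and> h (h' x) = x"
    using h by (auto simp: homeomorphic_maps_def continuous_map_def)
  have fX: "f x \<in> topspace Y" if "x \<in> topspace X" for x
    using f that by (auto simp: branched_cover_def continuous_map_def)
  have deg: "has_local_degree X' Y' f' (g x) (local_degree X Y f x)" if "x \<in> topspace X" for x
    unfolding f'_def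
    by (rule has_local_degree_transport[OF branched_cover_local_degree[OF f that] g h])
  show ld: "local_degree X' Y' f' (g x) = local_degree X Y f x" if "x \<in> topspace X" for x
    using deg[OF that] by (rule local_degree_eq)
  have "continuous_map X' Y' f'"
    unfolding f'_def using f g h
    by (auto simp: homeomorphic_maps_def branched_cover_def intro: continuous_map_compose)
  moreover have "\<exists>k. has_local_degree X' Y' f' x k" if "x \<in> topspace X'" for x
    using deg[of "g' x"] gX that by metis
  ultimately show "branched_cover X' Y' f'"
    using cos by (simp add: branched_cover_def)
  have fib: "fibre X' f' (h y) = g ` fibre X f y" if y: "y \<in> topspace Y" for y
  proof (intro equalityI subsetI)
    fix x assume "x \<in> fibre X' f' (h y)"
    then have x: "x \<in> topspace X'" "h (f (g' x)) = h y" by (auto simp: fibre_def f'_def)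
    then have "f (g' x) = y" using hY fX gX y by metis
    then have "g' x \<in> fibre X f y" using x gX by (simp add: fibre_def)
    then show "x \<in> g ` fibre X f y" using gX x by (metis imageI)
  next
    fix x assume "x \<in> g ` fibre X f y"
    then show "x \<in> fibre X' f' (h y)" using gX by (auto simp: fibre_def f'_def)
  qed
  have inj: "inj_on g (fibre X f y)" for y
    using gX by (metis (mono_tags, lifting) fibre_def inj_onI mem_Collect_eq)
  have fibX: "fibre X f y \<subseteq> topspace X" for y by (auto simp: fibre_def)
  show "local_degrees X' Y' f' (h y) = local_degrees X Y f y" if y: "y \<in> topspace Y" for y
  proof -
    have "local_degrees X' Y' f' (h y)
        = image_mset (local_degree X' Y' f') (image_mset g (mset_set (fibre X f y)))"
      unfolding local_degrees_def fib[OF y] by (simp add: image_mset_mset_set[OF inj])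
    also have "\<dots> = image_mset (local_degree X Y f) (mset_set (fibre X f y))"
      unfolding multiset.map_comp
    proof (rule image_mset_cong)
      fix x assume "x \<in># mset_set (fibre X f y)"
      then have "x \<in> fibre X f y" by (metis elem_mset_set empty_iff mset_set.infinite set_mset_empty)
      then show "(local_degree X' Y' f' \<circ> g) x = local_degree X Y f x"
        using ld fibX by auto
    qed
    finally show ?thesis by (simp add: local_degrees_def)
  qed
  show br: "branching_points X' Y' f' = h ` branching_points X Y f"
  proof (intro equalityI subsetI)
    fix y assume "y \<in> branching_points X' Y' f'"
    then obtain x where y: "y \<in> topspace Y'" and x: "x \<in> fibre X' f' y" "local_degree X' Y' f' x > 1"
      by (auto simp: branching_points_def)
    have "x \<in> g ` fibre X f (h' y)" using fib[of "h' y"] hY y x by simp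
    then obtain x0 where "x0 \<in> fibre X f (h' y)" "x = g x0" by blast
    then have "h' y \<in> branching_points X Y f"
      using x ld fibX hY y by (auto simp: branching_points_def subset_iff)
    then show "y \<in> h ` branching_points X Y f" using hY y by (metis imageI)
  next
    fix y assume "y \<in> h ` branching_points X Y f"
    then obtain z x where z: "y = h z" "z \<in> topspace Y" "x \<in> fibre X f z" "local_degree X Y f x > 1"
      by (auto simp: branching_points_def)
    have "local_degree X' Y' f' (g x) > 1" using ld[of x] z fibX[of z] by auto
    moreover have "g x \<in> fibre X' f' y" using fib z by blast
    ultimately show "y \<in> branching_points X' Y' f'"
      using hY z by (auto simp: branching_points_def)
  qed
  show "has_degree X' Y' f' d" if "has_degree X Y f d"
    unfolding has_degree_def
  proof (intro conjI ballI)
    show "1 \<le> d" using that by (simp add: has_degree_def)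
    fix y assume y: "y \<in> topspace Y' - branching_points X' Y' f'"
    then have "h' y \<in> topspace Y - branching_points X Y f" using hY br by (metis Diff_iff imageI)
    then have "card (fibre X f (h' y)) = d" using that by (simp add: has_degree_def)
    moreover have "fibre X' f' y = g ` fibre X f (h' y)" using fib[of "h' y"] hY y by simp
    ultimately show "card (fibre X' f' y) = d" using inj by (simp add: card_image)
  qed
qed

lemma realizable_transport:
  assumes "realizable X Y d Ps" "X homeomorphic_space X'" "Y homeomorphic_space Y'"
    and cos: "closed_orientable_surface X'" "closed_orientable_surface Y'"
  shows "realizable X' Y' d Ps"
proof -
  obtain f where f: "branched_cover X Y f" "has_degree X Y f d" "finite (branching_points X Y f)"
    "image_mset (local_degrees X Y f) (mset_set (branching_points X Y f)) = Ps"
    using assms(1) unfolding realizable_def by blast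
  obtain g g' where g: "homeomorphic_maps X X' g g'" using assms(2) unfolding homeomorphic_space_def by blast
  obtain h h' where h: "homeomorphic_maps Y Y' h h'" using assms(3) unfolding homeomorphic_space_def by blast
  note T = branched_cover_transport[OF f(1) g h cos]
  have B: "branching_points X Y f \<subseteq> topspace Y" by (auto simp: branching_points_def)
  have inj: "inj_on h (branching_points X Y f)"
    using h B by (metis homeomorphic_maps_def inj_on_inverseI subsetD)
  have "image_mset (local_degrees X' Y' (h \<circ> f \<circ> g')) (mset_set (branching_points X' Y' (h \<circ> f \<circ> g')))
      = image_mset (local_degrees X' Y' (h \<circ> f \<circ> g') \<circ> h) (mset_set (branching_points X Y f))"
    unfolding T(4) image_mset_mset_set[OF inj, symmetric] multiset.map_comp ..
  also have "\<dots> = Ps"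
    unfolding f(4)[symmetric] using T(3) B f(3) by (intro image_mset_cong) auto
  finally show ?thesis
    unfolding realizable_def using T(1,4,5) f by (intro exI[of _ "h \<circ> f \<circ> g'"]) auto
qed

section \<open>The sphere as a closed orientable surface\<close>

lemma homeomorphism_iff_homeomorphic_maps:
  "homeomorphism S T f g \<longleftrightarrow> homeomorphic_maps (top_of_set S) (top_of_set T) f g"
  by (auto simp: homeomorphism_def homeomorphic_maps_def continuous_map_in_subtopology image_subset_iff
      intro!: image_eqI)

section \<open>Infinite cyclic groups, homology and orientation of the sphere\<close>

lemma cyclic_generatorE:
  assumes G: "group G" and iso: "G \<cong> integer_group"
  obtains g where "g \<in> carrier G" "carrier G = range (\<lambda>n::int. g [^]\<^bsub>G\<^esub> n)"
    "\<And>n::int. g [^]\<^bsub>G\<^esub> n = \<one>\<^bsub>G\<^esub> \<Longrightarrow> n = 0"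
proof -
  have "integer_group \<cong> G" using group.iso_sym[OF G iso] .
  then obtain \<phi> where \<phi>: "\<phi> \<in> iso integer_group G" by (auto simp: is_iso_def)
  interpret group_hom integer_group G \<phi>
    using \<phi> G by (simp add: group_hom_def group_hom_axioms_def iso_def)
  have pow: "\<phi> n = \<phi> 1 [^]\<^bsub>G\<^esub> n" for n
    using hom_int_pow[of 1 n] by simp
  have inj: "inj \<phi>" and surj: "range \<phi> = carrier G"
    using \<phi> by (auto simp: iso_def bij_betw_def)
  show thesis
  proof
    show "\<phi> 1 \<in> carrier G" using surj by blast
    show "carrier G = range (\<lambda>n::int. \<phi> 1 [^]\<^bsub>G\<^esub> n)"
      by (rule trans[OF surj[symmetric] arg_cong[OF ext[OF pow], of range]])
    show "n = 0" if "\<phi> 1 [^]\<^bsub>G\<^esub> n = \<one>\<^bsub>G\<^esub>" for n :: int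
      using that pow[of n] hom_one inj by (metis injD one_integer_group)
  qed
qed

text \<open>Two elements \<open>g^m\<close> and \<open>g^n\<close> satisfy the relation with
  exponents \<open>n\<close> and \<open>- m\<close>, so no independent set has two elements.\<close>

lemma abelian_rank_integer_group:
  assumes G: "comm_group G" and iso: "G \<cong> integer_group"
  shows "abelian_rank G = 1"
proof -
  interpret comm_group G by (rule G)
  obtain g where g: "g \<in> carrier G" "carrier G = range (\<lambda>n::int. g [^]\<^bsub>G\<^esub> n)"
    and inf: "\<And>n::int. g [^]\<^bsub>G\<^esub> n = \<one>\<^bsub>G\<^esub> \<Longrightarrow> n = 0"
    using cyclic_generatorE[OF is_group iso] by metis
  have "int_independent G {g}"
    unfolding int_independent_def using g inf by auto
  then have 1: "1 \<in> {card B | B. int_independent G B}" by force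
  have "card B \<le> 1" if B: "int_independent G B" for B
  proof (rule ccontr)
    assume "\<not> card B \<le> 1"
    then have "1 < card B" by simp
    then obtain a b where ab: "a \<in> B" "b \<in> B" "a \<noteq> b"
      by (metis B card_le_Suc0_iff_eq int_independent_def not_less One_nat_def)
    have Bsub: "finite B" "B \<subseteq> carrier G" using B by (auto simp: int_independent_def)
    obtain m n :: int where mn: "a = g [^]\<^bsub>G\<^esub> m" "b = g [^]\<^bsub>G\<^esub> n" using g ab Bsub by blast
    define c where "c x = (if x = a then n else if x = b then - m else 0)" for x
    have carr: "a \<in> carrier G" "b \<in> carrier G" using ab Bsub by blast+
    have "finprod G (\<lambda>x. x [^]\<^bsub>G\<^esub> c x) B = finprod G (\<lambda>x. x [^]\<^bsub>G\<^esub> c x) {a, b}"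
      using Bsub ab carr by (intro finprod_mono_neutral_cong_right) (auto simp: c_def)
    also have "\<dots> = a [^]\<^bsub>G\<^esub> n \<otimes>\<^bsub>G\<^esub> b [^]\<^bsub>G\<^esub> (- m)"
      using ab carr by (simp add: c_def)
    also have "\<dots> = g [^]\<^bsub>G\<^esub> (m * n) \<otimes>\<^bsub>G\<^esub> g [^]\<^bsub>G\<^esub> (- (m * n))"
      using g(1) by (simp add: mn int_pow_pow mult.commute)
    also have "\<dots> = g [^]\<^bsub>G\<^esub> (m * n + - (m * n))"
      by (rule int_pow_mult[OF g(1), symmetric])
    also have "\<dots> = \<one>\<^bsub>G\<^esub>" by simp
    finally have "\<forall>x\<in>B. c x = 0" using B by (simp add: int_independent_def)
    then have "n = 0" "m = 0" using ab by (auto simp: c_def)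
    then show False using ab mn by simp
  qed
  with 1 show ?thesis unfolding abelian_rank_def by (intro cSup_eq_maximum) auto
qed

text \<open>The singleton of the identity is dependent with coefficient 1, which leaves only the
  empty set.\<close>

lemma abelian_rank_trivial_group:
  assumes "comm_group G" "trivial_group G"
  shows "abelian_rank G = 0"
proof -
  interpret comm_group G by (rule assms)
  have carr: "carrier G = {\<one>\<^bsub>G\<^esub>}" using assms by (simp add: trivial_group_def)
  have empty: "B = {}" if B: "int_independent G B" for B
  proof (rule ccontr)
    assume "B \<noteq> {}"
    then have "B = {\<one>\<^bsub>G\<^esub>}" using B carr by (auto simp: int_independent_def)
    then have "finprod G (\<lambda>b. b [^]\<^bsub>G\<^esub> (1::int)) B = \<one>\<^bsub>G\<^esub>" by simp
    then show False
      using B[unfolded int_independent_def, THEN conjunct2, THEN conjunct2, rule_format, of "\<lambda>b. 1"]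
        \<open>B \<noteq> {}\<close> by auto
  qed
  have "int_independent G {}" by (simp add: int_independent_def)
  then have "{card B | B. int_independent G B} = {0}" by (auto dest: empty intro!: exI[of _ "{}"])
  then show ?thesis by (simp add: abelian_rank_def)
qed

lemma infinite_topspace_sphere:
  assumes "X homeomorphic_space S2"
  shows "infinite (topspace X)"
proof -
  obtain h where "homeomorphic_map X S2 h"
    using assms homeomorphic_space by blast
  then have "h ` topspace X = unit_sphere" using homeomorphic_imp_surjective_map by force
  then show ?thesis using infinite_unit_sphere by (metis finite_imageI)
qed

lemma homology_group_sphere:
  assumes "X homeomorphic_space sphere2"
  shows "homology_group 2 X \<cong> integer_group" "homology_group 0 X \<cong> integer_group"
    and "p \<noteq> 0 \<Longrightarrow> p \<noteq> 2 \<Longrightarrow> trivial_group (homology_group p X)"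
proof -
  have iso: "reduced_homology_group p X \<cong> reduced_homology_group p sphere2" for p
    using assms by (rule homeomorphic_space_imp_isomorphic_reduced_homology_groups)
  have "reduced_homology_group 2 sphere2 \<cong> integer_group"
    using reduced_homology_group_nsphere(1)[of 2] by simp
  then have "reduced_homology_group 2 X \<cong> integer_group" using iso iso_trans by blast
  then show "homology_group 2 X \<cong> integer_group" by (simp add: un_reduced_homology_group)
  show "trivial_group (homology_group p X)" if "p \<noteq> 0" "p \<noteq> 2"
  proof -
    have "trivial_group (reduced_homology_group p sphere2)"
      using that reduced_homology_group_nsphere(2)[of p 2] by simp
    then have "trivial_group (reduced_homology_group p X)"
      using isomorphic_group_triviality[OF iso[of p]] by simp
    then show ?thesis using that by (simp add: un_reduced_homology_group)
  qed
  have X: "X homeomorphic_space S2"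
    using assms nsphere2_homeomorphic_unit_sphere homeomorphic_space_trans by blast
  have "path_connected unit_sphere" by (rule path_connected_sphere) simp
  then have "path_connected_space S2"
    using path_connectedin_euclidean unfolding path_connectedin_def by blast
  then have "path_connected_space X" using X homeomorphic_path_connected_space by blast
  moreover have "topspace X \<noteq> {}"
    using infinite_topspace_sphere[OF X] by auto
  ultimately show "homology_group 0 X \<cong> integer_group"
    by (rule isomorphic_integer_zeroth_homology_group)
qed

lemma euler_char_sphere:
  assumes "X homeomorphic_space sphere2"
  shows "euler_char X = 2"
proof -
  have 2: "betti 2 X = 1" and 0: "betti 0 X = 1"
    using homology_group_sphere(1,2)[OF assms]
    by (simp_all add: betti_def abelian_rank_integer_group abelian_relative_homology_group)
  have p: "betti p X = 0" if "p \<noteq> 0" "p \<noteq> 2" for p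
    unfolding betti_def using that homology_group_sphere(3)[OF assms, of "int p"]
    by (intro abelian_rank_trivial_group) (auto simp: abelian_relative_homology_group)
  have "betti p X \<noteq> 0 \<longleftrightarrow> p = 0 \<or> p = 2" for p
    using 0 2 p[of p] by (cases "p = 0"; cases "p = 2") auto
  then have "{p. betti p X \<noteq> 0} = {0, 2}" by auto
  then show ?thesis by (simp add: euler_char_def 0 2)
qed

text \<open>By this the second homology of the whole sphere agrees with the local group at any
  point.\<close>

lemma contractible_punctured_sphere:
  assumes X: "X homeomorphic_space S2" and x: "x \<in> topspace X"
  shows "contractible_space (subtopology X (topspace X - {x}))"
proof -
  obtain g g' where g: "homeomorphic_maps X S2 g g'"
    using X unfolding homeomorphic_space_def by blast
  then have gm: "homeomorphic_map X S2 g" using homeomorphic_maps_map by blast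
  have inj: "inj_on g (topspace X)" and im: "g ` topspace X = unit_sphere"
    using homeomorphic_imp_injective_map[OF gm] homeomorphic_imp_surjective_map[OF gm] by simp_all
  have "g x \<in> unit_sphere" using im x by blast
  then obtain F G where FG: "homeomorphism (unit_sphere - {g x}) (UNIV :: complex set) F G"
    by (rule stereographic)
  have "g ` (topspace X - {x}) = unit_sphere - {g x}"
    using im inj x by (simp add: inj_on_image_set_diff[of _ "topspace X"])
  then have "homeomorphic_map (subtopology X (topspace X - {x}))
      (subtopology S2 (unit_sphere - {g x})) g"
    using gm by (intro homeomorphic_map_subtopologies) (auto simp: Int_absorb1)
  then have 1: "subtopology X (topspace X - {x}) homeomorphic_space top_of_set (unit_sphere - {g x})"
    by (metis homeomorphic_map_imp_homeomorphic_space subtopology_subtopology Int_Diff inf.idem Int_absorb1 Diff_subset)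
  have "contractible (unit_sphere - {g x})"
    using FG by (metis convex_UNIV convex_imp_contractible homeomorphic_contractible_eq homeomorphic_def)
  then show ?thesis using homeomorphic_space_contractibility[OF 1] by simp
qed

text \<open>A generator of the global second homology group restricts to a generator of every local
  group, since the complement of a point is contractible. One global class thus induces all choices,
  and the whole space can serve as the neighbourhood of every point.\<close>

lemma orientation_sphere:
  assumes "X homeomorphic_space sphere2"
  shows "\<exists>\<mu>. orientation X \<mu>"
proof -
  have X: "X homeomorphic_space S2"
    using assms nsphere2_homeomorphic_unit_sphere homeomorphic_space_trans by blast
  obtain g where g: "g \<in> carrier (homology_group 2 X)"
    "carrier (homology_group 2 X) = range (\<lambda>n::int. g [^]\<^bsub>homology_group 2 X\<^esub> n)"
    using cyclic_generatorE[OF group_relative_homology_group homology_group_sphere(1)[OF assms]] by metis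
  define \<mu> where "\<mu> x = hom_induced 2 X {} X (topspace X - {x}) id g" for x
  have gen: "\<mu> x \<in> carrier (relative_homology_group 2 X (topspace X - {x})) \<and>
      generate (relative_homology_group 2 X (topspace X - {x})) {\<mu> x}
        = carrier (relative_homology_group 2 X (topspace X - {x}))"
    if x: "x \<in> topspace X" for x
  proof -
    let ?R = "relative_homology_group 2 X (topspace X - {x})"
    let ?h = "hom_induced 2 X {} X (topspace X - {x}) id"
    have ne: "topspace X \<inter> (topspace X - {x}) \<noteq> {}"
    proof
      assume "topspace X \<inter> (topspace X - {x}) = {}"
      then have "topspace X \<subseteq> {x}" by blast
      then have fin: "finite (topspace X)" by (meson finite.emptyI finite.insertI finite_subset)
      then show False using infinite_topspace_sphere[OF X] by blast
    qed
    have "?h \<in> iso (reduced_homology_group 2 X) ?R"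
      by (rule iso_reduced_homology_by_contractible[OF contractible_punctured_sphere[OF X x] ne])
    then have iso: "?h \<in> iso (homology_group 2 X) ?R" by (simp add: un_reduced_homology_group)
    interpret group_hom "homology_group 2 X" ?R ?h
      using iso by (simp add: group_hom_def group_hom_axioms_def iso_def)
    have "carrier ?R = ?h ` carrier (homology_group 2 X)" using iso by (auto simp: iso_def bij_betw_def)
    also have "\<dots> = range (\<lambda>n::int. \<mu> x [^]\<^bsub>?R\<^esub> n)"
      unfolding g(2) image_image \<mu>_def by (rule image_cong[OF refl hom_int_pow[OF g(1)]])
    also have "\<dots> = generate ?R {\<mu> x}"
      using H.generate_pow[OF hom_closed[OF g(1)]] unfolding \<mu>_def by blast
    finally show ?thesis using hom_closed[OF g(1)] unfolding \<mu>_def by simp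
  qed
  have "\<exists>U \<alpha>. openin X U \<and> x \<in> U \<and> \<alpha> \<in> carrier (relative_homology_group 2 X (topspace X - U)) \<and>
        (\<forall>y\<in>U. hom_induced 2 X (topspace X - U) X (topspace X - {y}) id \<alpha> = \<mu> y)"
    if "x \<in> topspace X" for x
    using that g(1) by (intro exI[of _ "topspace X"] exI[of _ g]) (auto simp: \<mu>_def)
  then show ?thesis unfolding orientation_def using gen by (intro exI[of _ \<mu>]) blast
qed

lemma locally_planar_sphere:
  assumes "X homeomorphic_space S2"
  shows "locally_planar X"
  unfolding locally_planar_def
proof
  fix x assume x: "x \<in> topspace X"
  obtain g g' where g: "homeomorphic_maps X S2 g g'"
    using assms unfolding homeomorphic_space_def by blast
  then have gm: "homeomorphic_map X S2 g" using homeomorphic_maps_map by blast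
  have inj: "inj_on g (topspace X)" and im: "g ` topspace X = unit_sphere"
    using homeomorphic_imp_injective_map[OF gm] homeomorphic_imp_surjective_map[OF gm] by simp_all
  obtain q where q: "q \<in> topspace X" "q \<noteq> x"
    using infinite_topspace_sphere[OF assms]
    by (metis finite.emptyI finite.insertI finite_subset insertI1 subsetI)
  have "g q \<in> unit_sphere" using im q by blast
  then obtain F G where FG: "homeomorphism (unit_sphere - {g q}) (UNIV :: complex set) F G"
    by (rule stereographic)
  have "g ` (topspace X - {q}) = unit_sphere - {g q}"
    using im inj q by (simp add: inj_on_image_set_diff[of _ "topspace X"])
  then have "homeomorphic_map (subtopology X (topspace X - {q}))
      (subtopology S2 (unit_sphere - {g q})) g"
    using gm by (intro homeomorphic_map_subtopologies) (auto simp: Int_absorb1)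
  then have "subtopology X (topspace X - {q}) homeomorphic_space top_of_set (unit_sphere - {g q})"
    by (metis homeomorphic_map_imp_homeomorphic_space subtopology_subtopology Int_Diff inf.idem Int_absorb1 Diff_subset)
  moreover have "top_of_set (unit_sphere - {g q}) homeomorphic_space top_of_set (UNIV :: complex set)"
    using FG homeomorphism_iff_homeomorphic_maps homeomorphic_maps_imp_homeomorphic_space by blast
  ultimately have "subtopology X (topspace X - {q}) homeomorphic_space top_of_set (UNIV :: complex set)"
    by (rule homeomorphic_space_trans)
  moreover have "openin X (topspace X - {q})"
    using homeomorphic_Hausdorff_space[OF assms] q
    by (intro openin_diff) (auto simp: Hausdorff_space_subtopology Hausdorff_space_euclidean closedin_Hausdorff_sing_eq)
  ultimately show "\<exists>U (D :: complex set). openin X U \<and> x \<in> U \<and> open D \<and> subtopology X U homeomorphic_space top_of_set D"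
    using x q by (intro exI[of _ "topspace X - {q}"] exI[of _ UNIV]) auto
qed

lemma closed_orientable_surface_sphere:
  assumes "X homeomorphic_space sphere2"
  shows "closed_orientable_surface X"
proof -
  have X: "X homeomorphic_space S2"
    using assms nsphere2_homeomorphic_unit_sphere homeomorphic_space_trans by blast
  have "topspace X \<noteq> {}" using infinite_topspace_sphere[OF X] by auto
  moreover have "connected_space X"
    using homeomorphic_connected_space[OF X] connected_unit_sphere connectedin_def
    by (metis connectedin_iff_connected)
  moreover have "compact_space X"
    using homeomorphic_compact_space[OF X] by (simp add: compact_space_subtopology)
  moreover have "Hausdorff_space X"
    using homeomorphic_Hausdorff_space[OF X] by (simp add: Hausdorff_space_subtopology Hausdorff_space_euclidean)
  ultimately show ?thesis
    unfolding closed_orientable_surface_def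
    using locally_planar_sphere[OF X] orientation_sphere[OF assms] by blast
qed

section \<open>Lifting the projection through a branched cover\<close>

lemma exp_eq_1_separated:
  assumes "exp a = 1" "exp b = 1" "a \<noteq> b" shows "2 * pi \<le> cmod (a - b)"
proof -
  have "exp (a - b) = 1" using assms by (simp add: exp_diff)
  then obtain n :: int where n: "Re (a - b) = 0" "Im (a - b) = of_int (2 * n) * pi"
    unfolding exp_eq_1 by blast
  then have "n \<noteq> 0" using assms by (auto simp: complex_eq_iff)
  then have "1 \<le> \<bar>n\<bar>" by simp
  then have "1 \<le> \<bar>real_of_int n\<bar>" by (metis of_int_1_le_iff of_int_abs)
  then have "2 * pi \<le> \<bar>Im (a - b)\<bar>" unfolding n by (simp add: abs_mult)
  then show ?thesis using abs_Im_le_cmod[of "a - b"] by linarith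
qed

text \<open>
  The winding number of \<open>w \<mapsto> h (w ^ 3)\<close> around 0 is a multiple of 3, whatever \<open>h\<close> is: a logarithm
  of \<open>h \<circ> exp\<close> on a half plane changes by a constant \<open>c \<in> 2 \<pi> i \<int>\<close> under translation by \<open>2 \<pi> i\<close>.
\<close>

lemma cube_root_of_cubed_argument:
  fixes h :: "complex \<Rightarrow> complex"
  assumes r: "r > 0" and h: "continuous_on (ball 0 (r ^ 3)) h"
    and h0: "\<And>v. v \<in> ball 0 (r ^ 3) \<Longrightarrow> h v = 0 \<longleftrightarrow> v = 0"
  obtains g where "continuous_on (ball 0 r) g" "\<And>w. w \<in> ball 0 r \<Longrightarrow> g w ^ 3 = h (w ^ 3)"
proof -
  \<comment> \<open>The logarithms of the nonzero points of the ball of radius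
    \<open>r^3\<close>.\<close>
  define H where "H = {\<zeta>. Re \<zeta> < ln (r ^ 3)}"
  have convH: "convex H" unfolding H_def by (rule convex_halfspace_Re_lt)
  have expH: "exp \<zeta> \<in> ball 0 (r ^ 3)" if "\<zeta> \<in> H" for \<zeta>
  proof -
    have "exp (Re \<zeta>) < exp (ln (r ^ 3))" using that by (simp add: H_def)
    then show ?thesis using r by simp
  qed
  have "continuous_on H (\<lambda>\<zeta>. h (exp \<zeta>))"
    by (rule continuous_on_compose2[OF h]) (use expH in \<open>auto intro: continuous_intros\<close>)
  then obtain L where L: "continuous_on H L" "\<And>\<zeta>. \<zeta> \<in> H \<Longrightarrow> h (exp \<zeta>) = exp (L \<zeta>)"
    using continuous_logarithm_on_contractible[OF _ convex_imp_contractible[OF convH]] h0 expH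
    by (metis exp_not_eq_zero)
  let ?p = "2 * of_real pi * \<i>"
  have shift: "\<zeta> + ?p \<in> H" if "\<zeta> \<in> H" for \<zeta> using that by (simp add: H_def)
  have period: "exp (L (\<zeta> + ?p) - L \<zeta>) = 1" if "\<zeta> \<in> H" for \<zeta>
  proof -
    have "exp (\<zeta> + ?p) = exp \<zeta>" by (simp add: exp_add)
    then have "exp (L (\<zeta> + ?p)) = exp (L \<zeta>)" using L(2) shift that by metis
    then show ?thesis by (simp add: exp_diff)
  qed
  have "(\<lambda>\<zeta>. L (\<zeta> + ?p) - L \<zeta>) constant_on H"
  proof (rule continuous_discrete_range_constant)
    show "connected H" using convH by (rule convex_connected)
    have "continuous_on H (\<lambda>\<zeta>. L (\<zeta> + ?p))"
      by (rule continuous_on_compose2[OF L(1)]) (use shift in \<open>auto intro!: continuous_intros\<close>)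
    then show "continuous_on H (\<lambda>\<zeta>. L (\<zeta> + ?p) - L \<zeta>)" using L(1) by (rule continuous_on_diff)
    fix x assume x: "x \<in> H"
    have "2 * pi \<le> cmod (L (y + ?p) - L y - (L (x + ?p) - L x))"
      if y: "y \<in> H" "L (y + ?p) - L y \<noteq> L (x + ?p) - L x" for y
      using period[OF x] period[OF y(1)] y(2) by (intro exp_eq_1_separated)
    then show "\<exists>e>0. \<forall>y. y \<in> H \<and> L (y + ?p) - L y \<noteq> L (x + ?p) - L x \<longrightarrow>
        e \<le> cmod (L (y + ?p) - L y - (L (x + ?p) - L x))"
      by (intro exI[of _ "2 * pi"]) auto
  qed
  then obtain c where c: "\<And>\<zeta>. \<zeta> \<in> H \<Longrightarrow> L (\<zeta> + ?p) = L \<zeta> + c"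
    unfolding constant_on_def by (metis diff_add_cancel add.commute)
  \<comment> \<open>The logarithms of the nonzero points of the ball of radius \<open>r\<close>;
    cubing becomes tripling, which leads into \<open>H\<close>.\<close>
  define A where "A = {\<zeta>. Re \<zeta> < ln r}"
  have A3: "3 * \<zeta> \<in> H" if "\<zeta> \<in> A" for \<zeta>
    using that r by (simp add: A_def H_def ln_realpow)
  define G where "G \<zeta> = exp (L (3 * \<zeta>) / 3)" for \<zeta>
  have contG: "continuous_on A G"
    unfolding G_def
    by (intro continuous_intros continuous_on_compose2[OF L(1)]) (use A3 in auto)
  have G3: "G \<zeta> ^ 3 = h (exp \<zeta> ^ 3)" if "\<zeta> \<in> A" for \<zeta>
  proof -
    have "G \<zeta> ^ 3 = exp (L (3 * \<zeta>))" unfolding G_def by (simp flip: exp_of_nat_mult)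
    also have "\<dots> = h (exp (3 * \<zeta>))" using L(2) A3[OF that] by simp
    also have "exp (3 * \<zeta>) = exp \<zeta> ^ 3" by (simp flip: exp_of_nat_mult)
    finally show ?thesis .
  qed
  \<comment> \<open>Shifting \<open>\<zeta>\<close> by one period shifts \<open>3 * \<zeta>\<close>
    by three, so \<open>L / 3\<close> changes by the whole constant \<open>c\<close>, whose
    exponential is 1. Hence \<open>G\<close> descends to the punctured disc.\<close>
  have Gper: "G (\<zeta> + ?p) = G \<zeta>" if "\<zeta> \<in> A" for \<zeta>
  proof -
    have "3 * \<zeta> \<in> H" using A3[OF that] .
    moreover have "3 * (\<zeta> + ?p) = 3 * \<zeta> + ?p + ?p + ?p" by (simp add: algebra_simps)
    ultimately have "L (3 * (\<zeta> + ?p)) = L (3 * \<zeta>) + c + c + c" using c shift by metis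
    then have "G (\<zeta> + ?p) = G \<zeta> * exp c"
      unfolding G_def by (simp add: add_divide_distrib flip: exp_add) (simp add: field_simps)
    moreover have "exp c = 1" using period[OF \<open>3 * \<zeta> \<in> H\<close>] c[OF \<open>3 * \<zeta> \<in> H\<close>] by simp
    ultimately show ?thesis by simp
  qed
  define g where "g w = (if w = 0 then 0 else G (Ln w))" for w
  have LnA: "Ln w \<in> A" if "w \<in> ball 0 r" "w \<noteq> 0" for w
    using that r by (simp add: A_def ln_less_cancel_iff)
  have g3: "g w ^ 3 = h (w ^ 3)" if "w \<in> ball 0 r" for w
    using that G3[OF LnA] h0[of 0] r by (auto simp: g_def)
  \<comment> \<open>\<open>Ln\<close> is continuous only off the negative axis, so two slit discs
    cover the punctured disc. On the second one \<open>Ln (- w) + of_real pi * \<i>\<close> is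
    continuous and differs from \<open>Ln w\<close> by 0 or one period of \<open>G\<close>.\<close>
  define B1 :: "complex set" where "B1 = ball 0 r - \<real>\<^sub>\<le>\<^sub>0"
  define B2 :: "complex set" where "B2 = {w \<in> ball 0 r. - w \<notin> \<real>\<^sub>\<le>\<^sub>0}"
  have B2: "B2 = ball 0 r \<inter> uminus -` (- \<real>\<^sub>\<le>\<^sub>0)" by (auto simp: B2_def)
  have op: "open B1" "open B2"
    unfolding B1_def B2
    by (auto intro!: open_Diff open_Int continuous_open_vimage continuous_intros
        simp: open_Compl closed_nonpos_Reals_complex)
  have "Ln ` B1 \<subseteq> A"
  proof (rule image_subsetI)
    fix w assume w: "w \<in> B1"
    then have "w \<noteq> 0" by (auto simp: B1_def)
    then show "Ln w \<in> A" using LnA w by (simp add: B1_def)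
  qed
  moreover have "continuous_on B1 Ln" by (auto simp: B1_def intro!: continuous_intros)
  ultimately have "continuous_on B1 (\<lambda>w. G (Ln w))"
    using continuous_on_compose2[OF contG] by blast
  then have c1: "continuous_on B1 g"
    by (rule continuous_on_eq) (auto simp: g_def B1_def)
  have "continuous_on B2 (\<lambda>w. G (Ln (- w) + of_real pi * \<i>))"
  proof (rule continuous_on_compose2[OF contG])
    show "continuous_on B2 (\<lambda>w. Ln (- w) + of_real pi * \<i>)"
      by (auto simp: B2_def intro!: continuous_intros)
    have "Ln (- w) + of_real pi * \<i> \<in> A" if w: "w \<in> B2" for w
    proof -
      have "- w \<noteq> 0" using w by (auto simp: B2_def)
      then show ?thesis using w LnA[of "- w"] by (simp add: B2_def A_def)
    qed
    then show "(\<lambda>w. Ln (- w) + of_real pi * \<i>) ` B2 \<subseteq> A" by blast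
  qed
  then have c2: "continuous_on B2 g"
  proof (rule continuous_on_eq)
    fix w assume w: "w \<in> B2"
    then have nz: "w \<noteq> 0" "w \<in> ball 0 r" by (auto simp: B2_def)
    consider "Ln w = Ln (- w) + of_real pi * \<i>" | "Ln w = Ln (- w) - of_real pi * \<i>"
      using Ln_minus[of "- w"] nz by (auto simp: mult.commute split: if_splits)
    then show "G (Ln (- w) + of_real pi * \<i>) = g w"
    proof cases
      case 1 then show ?thesis using nz by (simp add: g_def)
    next
      case 2
      then have "Ln (- w) + of_real pi * \<i> = Ln w + ?p" by simp
      then show ?thesis unfolding g_def using nz Gper[OF LnA[of w]] by metis
    qed
  qed
  have cover: "w \<in> B1 \<or> w \<in> B2" if "w \<in> ball 0 r" "w \<noteq> 0" for w
    using that by (auto simp: B1_def B2_def complex_nonpos_Reals_iff complex_eq_iff)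
  have "isCont g w" if w: "w \<in> ball 0 r" for w
  proof (cases "w = 0")
    case False
    then show ?thesis
      using cover[OF w False] c1 c2 op by (auto simp: continuous_on_eq_continuous_at)
  next
    case True
    \<comment> \<open>Continuity of \<open>g\<close> at the centre: its modulus is the real cube
      root of \<open>cmod (h (w^3))\<close>, which tends to 0.\<close>
    have "isCont (\<lambda>w. h (w ^ 3)) 0"
    proof -
      have "continuous_on (ball 0 r) (\<lambda>w. h (w ^ 3))"
        using r by (intro continuous_on_compose2[OF h] continuous_intros)
          (auto simp: norm_power power_strict_mono)
      then show ?thesis using r by (simp add: continuous_on_eq_continuous_at)
    qed
    then have "((\<lambda>w. root 3 (cmod (h (w ^ 3)))) \<longlongrightarrow> root 3 (cmod (h (0 ^ 3)))) (at 0)"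
      unfolding isCont_def by (intro tendsto_real_root tendsto_norm) simp
    then have t: "((\<lambda>w. root 3 (cmod (h (w ^ 3)))) \<longlongrightarrow> 0) (at 0)" using h0[of 0] r by simp
    have "\<forall>\<^sub>F w in at 0. w \<in> ball 0 r" using r by (intro eventually_at_in_open') auto
    then have "\<forall>\<^sub>F w in at 0. root 3 (cmod (h (w ^ 3))) = cmod (g w)"
    proof eventually_elim
      case (elim w)
      have "cmod (h (w ^ 3)) = cmod (g w) ^ 3" using g3[OF elim] by (metis norm_power)
      then show ?case by (simp add: real_root_power_cancel)
    qed
    then have "((\<lambda>w. cmod (g w)) \<longlongrightarrow> 0) (at 0)" using t by (rule Lim_transform_eventually[rotated])
    then have "(g \<longlongrightarrow> 0) (at 0)" by (rule tendsto_norm_zero_cancel)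
    then show ?thesis using True by (simp add: isCont_def g_def)
  qed
  then have "continuous_on (ball 0 r) g" by (rule continuous_at_imp_continuous_on[OF ballI])
  then show thesis using g3 by (rule that)
qed

section \<open>Local lifts through a branched cover\<close>

lemma has_local_degree_sphere:
  assumes "has_local_degree S2 S2 f x k"
  obtains U V D E and \<phi> \<psi> :: "complex \<times> real \<Rightarrow> complex" and \<phi>' \<psi>'
  where "k \<ge> 1" "openin S2 U" "x \<in> U" "openin S2 V" "f ` U \<subseteq> V"
    "open D" "homeomorphism U D \<phi> \<phi>'" "\<phi> x = 0" "open E" "homeomorphism V E \<psi> \<psi>'" "\<psi> (f x) = 0"
    "\<And>u. u \<in> U \<Longrightarrow> \<psi> (f u) = \<phi> u ^ k"
proof -
  obtain U V D E \<phi> \<psi> where *: "k \<ge> 1" "openin S2 U" "x \<in> U"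
    "openin S2 V" "f ` U \<subseteq> V" "open (D :: complex set)"
    "homeomorphic_map (subtopology S2 U) (top_of_set D) \<phi>" "\<phi> x = 0"
    "open (E :: complex set)" "homeomorphic_map (subtopology S2 V) (top_of_set E) \<psi>"
    "\<psi> (f x) = 0" "\<forall>u\<in>U. \<psi> (f u) = \<phi> u ^ k"
    using assms unfolding has_local_degree_def by metis
  have "unit_sphere \<inter> U = U" "unit_sphere \<inter> V = V"
    using *(2,4) by (auto dest: openin_imp_subset)
  then have "subtopology S2 U = top_of_set U"
    "subtopology S2 V = top_of_set V"
    by (simp_all add: subtopology_subtopology)
  then obtain \<phi>' \<psi>' where "homeomorphism U D \<phi> \<phi>'" "homeomorphism V E \<psi> \<psi>'"
    using *(7,10) unfolding homeomorphic_map_maps homeomorphism_iff_homeomorphic_maps by auto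
  then show thesis using that * by metis
qed

text \<open>The condition \<open>deg\<close> says that the local degree of \<open>f\<close> divides
  the local exponent of \<open>P\<close> whenever the images agree; this is what lets
  \<open>P\<close> factor through \<open>f\<close> locally.\<close>

locale branched_lifting = orbifold_projection P for P +
  fixes f :: "complex \<times> real \<Rightarrow> complex \<times> real"
  assumes bc: "branched_cover S2 S2 f"
    and deg: "\<And>x z. x \<in> unit_sphere \<Longrightarrow> f x = P z \<Longrightarrow>
      local_degree S2 S2 f x = 1 \<or>
      local_degree S2 S2 f x = 3 \<and> cone_point z"
begin

definition lift :: "complex set \<Rightarrow> (complex \<Rightarrow> complex \<times> real) \<Rightarrow> bool" where
  "lift U s \<longleftrightarrow> continuous_on U s \<and> s ` U \<subseteq> unit_sphere \<and> (\<forall>u\<in>U. f (s u) = P u)"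

lemma lift_subset: "lift U s \<Longrightarrow> V \<subseteq> U \<Longrightarrow> lift V s"
  unfolding lift_def by (meson continuous_on_subset image_mono order_trans subsetD)

lemma continuous_f: "continuous_on unit_sphere f" and f_in: "x \<in> unit_sphere \<Longrightarrow> f x \<in> unit_sphere"
  using bc by (auto simp: branched_cover_def continuous_map_in_subtopology)

lemma local_degree_f:
  "x \<in> unit_sphere \<Longrightarrow> has_local_degree S2 S2 f x
     (local_degree S2 S2 f x)"
  using branched_cover_local_degree[OF bc] by simp

lemma preimage_ball:
  assumes "openin S2 V" "P z \<in> V"
  obtains r where "r > 0" "P ` ball z r \<subseteq> V"
proof -
  obtain O' where O': "open O'" "V = unit_sphere \<inter> O'" using assms(1) by (auto simp: openin_open)
  have "open (P -` O')" using O' cont by (intro open_vimage)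
  moreover have "z \<in> P -` O'" using assms O' by auto
  ultimately obtain r where "r > 0" "ball z r \<subseteq> P -` O'" using open_contains_ball by blast
  then show thesis using that O' in_sphere by blast
qed

text \<open>In charts \<open>f\<close> is a \<open>k\<close>-th power, so lifting \<open>P\<close>
  means extracting a \<open>k\<close>-th root of \<open>\<psi> (P w)\<close>. For
  \<open>k = 3\<close> the point \<open>z\<close> is a cone point, \<open>P\<close> is a function of
  the cube of the coordinate, and the cube root lemma applies.\<close>

lemma local_root:
  assumes x: "x \<in> unit_sphere" "f x = P z"
    and V: "openin S2 V" "f x \<in> V" and \<psi>: "homeomorphism V E \<psi> \<psi>'" "\<psi> (f x) = 0"
    and k: "k = local_degree S2 S2 f x"
  obtains r and g :: "complex \<Rightarrow> complex" where "r > 0" "P ` ball z r \<subseteq> V" "continuous_on (ball z r) g"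
    "\<And>w. w \<in> ball z r \<Longrightarrow> g w ^ k = \<psi> (P w)"
    "\<And>w. w \<in> ball z r \<Longrightarrow> w \<noteq> z \<Longrightarrow> k = 1 \<or> k = 3 \<and> g w \<noteq> 0"
proof -
  obtain r0 where r0: "r0 > 0" "P ` ball z r0 \<subseteq> V" using preimage_ball V x by metis
  have cont\<psi>: "continuous_on V \<psi>" using \<psi>(1) by (rule homeomorphism_cont1)
  have inj\<psi>: "u = v" if "\<psi> u = \<psi> v" "u \<in> V" "v \<in> V" for u v
    using \<psi> that by (metis homeomorphism_apply1)
  consider "k = 1" | "k = 3" "cone_point z" using deg[OF x] k by blast
  then show thesis
  proof cases
    case 1
    have "continuous_on (ball z r0) (\<lambda>w. \<psi> (P w))"
      by (rule continuous_on_compose2[OF cont\<psi> continuous_on_subset[OF cont]]) (use r0 in auto)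
    then show thesis using that[of r0 "\<lambda>w. \<psi> (P w)"] r0 1 by simp
  next
    case 2
    obtain r1 Q Q' where r1: "r1 > 0"
      and Q: "homeomorphism (cball 0 (r1 ^ 3)) (Q ` cball 0 (r1 ^ 3)) Q Q'"
      and PQ: "\<And>w. cmod w \<le> r1 \<Longrightarrow> P (z + w) = Q (w ^ 3)"
    proof -
      obtain r1 Q Q' where "r1 > 0" "homeomorphism (cball 0 (r1 ^ cone_index z)) (Q ` cball 0 (r1 ^ cone_index z)) Q Q'"
        "\<And>w. cmod w \<le> r1 \<Longrightarrow> P (z + w) = Q (w ^ cone_index z)"
        using chart[of z] by metis
      then show thesis using that[of r1 Q Q'] 2 by (simp add: cone_index_def)
    qed
    define r where "r = min r0 r1"
    have r: "r > 0" "r \<le> r0" "r \<le> r1" using r0 r1 by (auto simp: r_def)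
    have QV: "Q v \<in> V" if v: "v \<in> ball 0 (r ^ 3)" for v
    proof -
      obtain w where w: "w \<in> ball 0 r" "w ^ 3 = v" using complex_root_in_ball[OF v _ r(1)] by auto
      have "z + w \<in> ball z r0" using w r by (auto simp: dist_norm)
      moreover have "Q v = P (z + w)" using PQ[of w] w r by auto
      ultimately show ?thesis using r0 by blast
    qed
    have sub: "ball 0 (r ^ 3) \<subseteq> (cball 0 (r1 ^ 3) :: complex set)"
    proof -
      have "r ^ 3 \<le> r1 ^ 3" using r by (intro power_mono) auto
      then show ?thesis by auto
    qed
    have Q0: "Q 0 = P z" using PQ[of 0] r1 by simp
    have cont: "continuous_on (ball 0 (r ^ 3)) (\<lambda>v. \<psi> (Q v))"
      by (rule continuous_on_compose2[OF cont\<psi> continuous_on_subset[OF homeomorphism_cont1[OF Q] sub]])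
        (use QV in auto)
    have zero: "\<psi> (Q v) = 0 \<longleftrightarrow> v = 0" if v: "v \<in> ball 0 (r ^ 3)" for v
    proof
      assume "\<psi> (Q v) = 0"
      then have "\<psi> (Q v) = \<psi> (f x)" using \<psi> by simp
      then have "Q v = Q 0" using inj\<psi> QV[OF v] V x Q0 by metis
      moreover have "v \<in> cball 0 (r1 ^ 3)" "0 \<in> (cball 0 (r1 ^ 3) :: complex set)"
        using v sub r1 by auto
      ultimately show "v = 0" using Q by (metis homeomorphism_apply1)
    next
      assume "v = 0"
      then show "\<psi> (Q v) = 0" using Q0 x \<psi> by simp
    qed
    obtain g where g: "continuous_on (ball 0 r) g" "\<And>w. w \<in> ball 0 r \<Longrightarrow> g w ^ 3 = \<psi> (Q (w ^ 3))"
      using cube_root_of_cubed_argument[OF r(1) cont zero] by blast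
    have ball: "w - z \<in> ball 0 r" if "w \<in> ball z r" for w
      using that by (simp add: dist_norm norm_minus_commute)
    show thesis
    proof (rule that[of r "\<lambda>w. g (w - z)"])
      show "P ` ball z r \<subseteq> V" using r0 r by auto
      show "continuous_on (ball z r) (\<lambda>w. g (w - z))"
        by (rule continuous_on_compose2[OF g(1)]) (use ball in \<open>auto intro!: continuous_intros\<close>)
      fix w assume w: "w \<in> ball z r"
      have "P w = Q ((w - z) ^ 3)" using PQ[of "w - z"] ball[OF w] r by auto
      then have "g (w - z) ^ 3 = \<psi> (P w)" using g(2)[OF ball[OF w]] by simp
      then show "g (w - z) ^ k = \<psi> (P w)" using 2 by simp
      have "g (w - z) \<noteq> 0" if "w \<noteq> z"
      proof
        assume "g (w - z) = 0"
        then have "\<psi> (Q ((w - z) ^ 3)) = 0" using g(2)[OF ball[OF w]] by simp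
        moreover have "(w - z) ^ 3 \<in> ball 0 (r ^ 3)"
          using ball[OF w] by (simp add: norm_power power_strict_mono)
        ultimately have "(w - z) ^ 3 = 0" using zero by blast
        then show False using that by simp
      qed
      then show "w \<noteq> z \<Longrightarrow> k = 1 \<or> k = 3 \<and> g (w - z) \<noteq> 0" using 2 by blast
    qed (rule r)
  qed
qed

text \<open>The root \<open>g\<close>, multiplied by a \<open>k\<close>-th root of unity and carried
  back by the chart, gives a lift through \<open>x\<close>. Every partial lift that stays near
  \<open>x\<close> is of this kind, because its quotient by \<open>g\<close> is continuous with
  finitely many values.\<close>

lemma local_lifts:
  assumes x: "x \<in> unit_sphere" "f x = P z"
  obtains N r where "openin S2 N" "x \<in> N" "r > 0"
    "\<And>u. u \<in> N \<Longrightarrow> f u = P z \<Longrightarrow> u = x"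
    "\<exists>s. lift (ball z r) s \<and> s z = x"
    "\<And>W s. open W \<Longrightarrow> convex W \<Longrightarrow> W \<noteq> {} \<Longrightarrow> W \<subseteq> ball z r \<Longrightarrow> lift W s \<Longrightarrow> s ` W \<subseteq> N \<Longrightarrow>
       \<exists>s'. lift (ball z r) s' \<and> (\<forall>w\<in>W. s' w = s w)"
proof -
  define k where "k = local_degree S2 S2 f x"
  obtain U V D E \<phi> \<psi> \<phi>' \<psi>' where k1: "k \<ge> 1" and U: "openin S2 U" "x \<in> U"
    and V: "openin S2 V" "f ` U \<subseteq> V"
    and D: "open (D :: complex set)" and \<phi>: "homeomorphism U D \<phi> \<phi>'" "\<phi> x = 0"
    and \<psi>: "homeomorphism V (E :: complex set) \<psi> \<psi>'" "\<psi> (f x) = 0"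
    and eq: "\<And>u. u \<in> U \<Longrightarrow> \<psi> (f u) = \<phi> u ^ k"
    using has_local_degree_sphere[OF local_degree_f[OF x(1), folded k_def]] by metis
  have US: "U \<subseteq> unit_sphere" using U by (auto dest: openin_imp_subset)
  have fxV: "f x \<in> V" using U V by blast
  have inj\<psi>: "u = v" if "\<psi> u = \<psi> v" "u \<in> V" "v \<in> V" for u v
    using \<psi> that by (metis homeomorphism_apply1)
  obtain r0 g where r0: "r0 > 0" "P ` ball z r0 \<subseteq> V" "continuous_on (ball z r0) g"
    and g: "\<And>w. w \<in> ball z r0 \<Longrightarrow> g w ^ k = \<psi> (P w)"
    and gnz: "\<And>w. w \<in> ball z r0 \<Longrightarrow> w \<noteq> z \<Longrightarrow> k = 1 \<or> k = 3 \<and> g w \<noteq> 0"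
    using local_root[OF x V(1) fxV \<psi> k_def] by metis
  have "g z ^ k = 0" using g[of z] r0 \<psi> x by simp
  then have gz: "g z = 0" using k1 by simp
  have "0 \<in> D" using \<phi> U by (metis homeomorphism_image1 imageI)
  then obtain \<rho> where \<rho>: "\<rho> > 0" "ball 0 \<rho> \<subseteq> D" using D open_contains_ball by blast
  have "isCont g z" using r0 by (simp add: continuous_on_eq_continuous_at)
  then obtain d where d: "d > 0" "\<And>w. dist w z < d \<Longrightarrow> dist (g w) (g z) < \<rho>"
    unfolding continuous_at_eps_delta using \<rho> by blast
  \<comment> \<open>On this ball the values of \<open>g\<close>, even after multiplication by roots
    of unity, stay in the range \<open>D\<close> of the chart.\<close>
  define r where "r = min r0 d"
  have r: "r > 0" "ball z r \<subseteq> ball z r0" using r0 d by (auto simp: r_def)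
  have small: "cmod (g w) < \<rho>" if "w \<in> ball z r" for w
    using d(2)[of w] that gz by (simp add: r_def dist_commute)
  have branch: "lift (ball z r) (\<lambda>w. \<phi>' (\<zeta> * g w)) \<and> \<phi>' (\<zeta> * g z) = x" if \<zeta>: "\<zeta> ^ k = 1" for \<zeta>
  proof
    have "cmod \<zeta> ^ k = 1" using \<zeta> by (metis norm_one norm_power)
    then have n\<zeta>: "cmod \<zeta> = 1" using k1 power_eq_imp_eq_base[of "cmod \<zeta>" k 1] by simp
    have inD: "\<zeta> * g w \<in> D" if "w \<in> ball z r" for w
      using small[OF that] \<rho> n\<zeta> by (auto simp: norm_mult)
    have "continuous_on (ball z r) (\<lambda>w. \<phi>' (\<zeta> * g w))"
      by (rule continuous_on_compose2[OF homeomorphism_cont2[OF \<phi>(1)]])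
        (use inD r0 r in \<open>auto intro!: continuous_intros intro: continuous_on_subset\<close>)
    moreover have inU: "\<phi>' (\<zeta> * g w) \<in> U" if "w \<in> ball z r" for w
      using inD[OF that] \<phi> by (metis homeomorphism_image2 imageI)
    moreover have "f (\<phi>' (\<zeta> * g w)) = P w" if w: "w \<in> ball z r" for w
    proof (rule inj\<psi>)
      have "\<psi> (f (\<phi>' (\<zeta> * g w))) = (\<zeta> * g w) ^ k"
        using eq[OF inU[OF w]] \<phi> inD[OF w] by (metis homeomorphism_apply2)
      also have "\<dots> = g w ^ k" using \<zeta> by (simp add: power_mult_distrib)
      also have "\<dots> = \<psi> (P w)" using g w r by blast
      finally show "\<psi> (f (\<phi>' (\<zeta> * g w))) = \<psi> (P w)" .
      show "f (\<phi>' (\<zeta> * g w)) \<in> V" using inU[OF w] V by blast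
      show "P w \<in> V" using w r r0 by blast
    qed
    ultimately show "lift (ball z r) (\<lambda>w. \<phi>' (\<zeta> * g w))" using US unfolding lift_def by blast
    show "\<phi>' (\<zeta> * g z) = x" using gz \<phi> U by (metis homeomorphism_apply1 mult_zero_right)
  qed
  show thesis
  proof (rule that[OF U r(1)])
    fix u assume u: "u \<in> U" "f u = P z"
    then have "\<phi> u ^ k = 0" using eq[OF u(1)] x \<psi> by simp
    then have "\<phi> u = \<phi> x" using \<phi> by simp
    then show "u = x" using \<phi> u U by (metis homeomorphism_apply1)
  next
    show "\<exists>s. lift (ball z r) s \<and> s z = x" using branch[of 1] by auto
  next
    fix W s assume W: "open W" "convex W" "W \<noteq> {}" "W \<subseteq> ball z r" and s: "lift W s" "s ` W \<subseteq> U"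
    have pow: "\<phi> (s w) ^ k = g w ^ k" if w: "w \<in> W" for w
    proof -
      have "s w \<in> U" using s w by blast
      then have "\<phi> (s w) ^ k = \<psi> (f (s w))" using eq by metis
      also have "\<dots> = \<psi> (P w)" using s w by (simp add: lift_def)
      also have "\<dots> = g w ^ k" using g w W r by (metis subsetD)
      finally show ?thesis .
    qed
    have "\<exists>\<zeta>. \<zeta> ^ k = 1 \<and> (\<forall>w\<in>W. \<phi> (s w) = \<zeta> * g w)"
    \<comment> \<open>For \<open>k = 1\<close> the root of unity is 1 and there is no division. For
      \<open>k = 3\<close> the quotient by \<open>g\<close> makes sense off \<open>z\<close>, and at
      \<open>z\<close> both sides vanish.\<close>
    proof (cases "k = 1")
      case True
      then show ?thesis using pow by (intro exI[of _ 1]) auto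
    next
      case False
      have gnz': "g w \<noteq> 0" if "w \<in> W - {z}" for w using gnz[of w] False that W r by blast
      have "connected (W - {z})" using W by (intro connected_open_delete convex_connected) auto
      moreover have "continuous_on (W - {z}) (\<lambda>w. \<phi> (s w) / g w)"
      proof (intro continuous_on_divide)
        show "continuous_on (W - {z}) (\<lambda>w. \<phi> (s w))"
          by (rule continuous_on_compose2[OF homeomorphism_cont1[OF \<phi>(1)], of _ s])
            (use s in \<open>auto simp: lift_def intro: continuous_on_subset\<close>)
        show "continuous_on (W - {z}) g" using r0 W r by (meson Diff_subset continuous_on_subset order_trans)
      qed (use gnz' in blast)
      moreover have "(\<lambda>w. \<phi> (s w) / g w) ` (W - {z}) \<subseteq> {u. u ^ k = 1}"
        using pow gnz' by (auto simp: power_divide)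
      then have "finite ((\<lambda>w. \<phi> (s w) / g w) ` (W - {z}))"
        by (rule finite_subset) (use k1 in \<open>auto intro!: finite_nth_roots\<close>)
      ultimately have "(\<lambda>w. \<phi> (s w) / g w) constant_on (W - {z})"
        by (rule continuous_finite_range_constant)
      then obtain \<zeta> where \<zeta>: "\<And>w. w \<in> W - {z} \<Longrightarrow> \<phi> (s w) / g w = \<zeta>" by (auto simp: constant_on_def)
      have "W \<noteq> {z}" using W(1) not_open_singleton by blast
      then obtain w0 where w0: "w0 \<in> W - {z}" using W by blast
      then have "\<zeta> ^ k = 1" using \<zeta>[OF w0] pow[of w0] gnz'[OF w0] by (auto simp: power_divide)
      moreover have "\<phi> (s w) = \<zeta> * g w" if w: "w \<in> W" for w
      proof (cases "w = z")
        case True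
        then have "\<phi> (s w) ^ k = 0" using pow[OF w] gz k1 by simp
        then show ?thesis using True gz by simp
      next
        case False
        then show ?thesis using \<zeta>[of w] gnz'[of w] w by (auto simp: field_simps)
      qed
      ultimately show ?thesis by blast
    qed
    then obtain \<zeta> where \<zeta>: "\<zeta> ^ k = 1" "\<And>w. w \<in> W \<Longrightarrow> \<phi> (s w) = \<zeta> * g w" by blast
    have "\<phi>' (\<zeta> * g w) = s w" if "w \<in> W" for w
      using \<zeta>(2)[OF that] s that \<phi> by (metis homeomorphism_apply1 image_subset_iff)
    then show "\<exists>s'. lift (ball z r) s' \<and> (\<forall>w\<in>W. s' w = s w)"
      using branch[OF \<zeta>(1)] by (intro exI[of _ "\<lambda>w. \<phi>' (\<zeta> * g w)"]) auto
  qed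
qed

text \<open>The fibre is compact, and each of its points is isolated by
  \<open>local_lifts\<close>.\<close>

lemma finite_fibre: "finite {x \<in> unit_sphere. f x = P z}"
proof (rule ccontr)
  let ?F = "{x \<in> unit_sphere. f x = P z}"
  assume inf: "infinite ?F"
  have "closedin S2 (unit_sphere \<inter> f -` {P z})"
    using continuous_f by (intro continuous_closedin_preimage) auto
  moreover have "unit_sphere \<inter> f -` {P z} = ?F" by auto
  ultimately have "compact ?F" using closedin_compact by (metis compact_sphere)
  then obtain x where x: "x \<in> ?F" "x islimpt ?F"
    using inf compact_eq_Bolzano_Weierstrass by blast
  then obtain N where N: "openin S2 N" "x \<in> N" "\<And>u. u \<in> N \<Longrightarrow> f u = P z \<Longrightarrow> u = x"
    using local_lifts[of x z] by blast
  then obtain G where "open G" "N = unit_sphere \<inter> G" by (auto simp: openin_open)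
  then show False using x N unfolding islimpt_def by blast
qed

text \<open>One radius serves all lifts at once, in place of an evenly covered neighbourhood.
  Outside small neighbourhoods of the finitely many preimages the values of \<open>f\<close> stay
  away from \<open>P z\<close>, so a lift over a connected \<open>W\<close> near \<open>z\<close>
  runs in a single neighbourhood, where \<open>local_lifts\<close> extends it.\<close>

lemma local_extension:
  "\<exists>r>0. \<forall>W s. open W \<longrightarrow> convex W \<longrightarrow> W \<noteq> {} \<longrightarrow> W \<subseteq> ball z r \<longrightarrow> lift W s \<longrightarrow>
     (\<exists>s'. lift (ball z r) s' \<and> (\<forall>w\<in>W. s' w = s w))"
proof -
  define F where "F = {x \<in> unit_sphere. f x = P z}"
  have fin: "finite F" unfolding F_def by (rule finite_fibre)
  define extends where "extends N r \<longleftrightarrow>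
      (\<forall>W s. open W \<longrightarrow> convex W \<longrightarrow> W \<noteq> {} \<longrightarrow> W \<subseteq> ball z r \<longrightarrow> lift W s \<longrightarrow> s ` W \<subseteq> N \<longrightarrow>
       (\<exists>s'. lift (ball z r) s' \<and> (\<forall>w\<in>W. s' w = s w)))" for N r
  have "\<forall>x\<in>F. \<exists>N r. openin S2 N \<and> x \<in> N \<and> r > 0 \<and> extends N r"
  proof
    fix x assume "x \<in> F"
    then have "x \<in> unit_sphere" "f x = P z" by (auto simp: F_def)
    then show "\<exists>N r. openin S2 N \<and> x \<in> N \<and> r > 0 \<and> extends N r"
      unfolding extends_def by (rule local_lifts[of x z]) blast
  qed
  then obtain N r where Nr: "\<And>x. x \<in> F \<Longrightarrow> openin S2 (N x) \<and> x \<in> N x \<and>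
      (r x :: real) > 0 \<and> extends (N x) (r x)"
    by metis
  then have N: "\<And>x. x \<in> F \<Longrightarrow> openin S2 (N x)" "\<And>x. x \<in> F \<Longrightarrow> x \<in> N x"
    and r: "\<And>x. x \<in> F \<Longrightarrow> r x > 0" by blast+
  have ext: "\<exists>s'. lift (ball z (r x)) s' \<and> (\<forall>w\<in>W. s' w = s w)"
    if "x \<in> F" "open W" "convex W" "W \<noteq> {}" "W \<subseteq> ball z (r x)" "lift W s" "s ` W \<subseteq> N x" for x W s
    using Nr[OF that(1)] that unfolding extends_def by blast
  have "\<forall>x\<in>F. \<exists>G. open G \<and> N x = unit_sphere \<inter> G" using N(1) by (auto simp: openin_open)
  then obtain G where G: "\<And>x. x \<in> F \<Longrightarrow> open (G x)" "\<And>x. x \<in> F \<Longrightarrow> N x = unit_sphere \<inter> G x" by metis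
  have "\<forall>x. \<exists>d>0. \<forall>y\<in>F. y \<noteq> x \<longrightarrow> d \<le> dist x y" using finite_set_avoid[OF fin] by blast
  then obtain \<delta> where \<delta>: "\<And>x. (\<delta> x :: real) > 0" "\<And>x y. y \<in> F \<Longrightarrow> y \<noteq> x \<Longrightarrow> \<delta> x \<le> dist x y" by metis
  \<comment> \<open>The neighbourhoods are shrunk until they are pairwise disjoint, so that a
    connected image lies in just one.\<close>
  define M where "M x = G x \<inter> ball x (\<delta> x / 2)" for x
  have M: "open (M x)" "x \<in> M x" if "x \<in> F" for x
    using G[OF that] N(2)[OF that] \<delta>(1)[of x] by (auto simp: M_def)
  have disj: "M x \<inter> M y = {}" if "x \<in> F" "y \<in> F" "x \<noteq> y" for x y
  proof (rule ccontr)
    assume "M x \<inter> M y \<noteq> {}"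
    then obtain u where "dist x u < \<delta> x / 2" "dist y u < \<delta> y / 2" by (auto simp: M_def)
    then have "dist x y < \<delta> x / 2 + \<delta> y / 2" using dist_triangle2[of x y u] by linarith
    moreover have "\<delta> x \<le> dist x y" "\<delta> y \<le> dist x y"
      using \<delta>(2)[of y x] \<delta>(2)[of x y] that by (auto simp: dist_commute)
    ultimately show False by linarith
  qed
  define C where "C = unit_sphere - (\<Union>x\<in>F. M x)"
  have "compact C" unfolding C_def using M by (intro compact_diff open_UN) auto
  then have "compact (f ` C)"
    using continuous_f by (intro compact_continuous_image) (auto simp: C_def intro: continuous_on_subset)
  then have "open (- (f ` C))" by (simp add: compact_imp_closed open_Compl)
  moreover have "P z \<notin> f ` C" using M by (auto simp: C_def F_def)
  ultimately have op: "openin S2 (unit_sphere \<inter> - (f ` C))" "P z \<in> unit_sphere \<inter> - (f ` C)"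
    using in_sphere[of z] by auto
  obtain r0 where r0: "r0 > 0" "P ` ball z r0 \<subseteq> unit_sphere \<inter> - (f ` C)"
    using preimage_ball[OF op] .
  define R where "R = Min (insert r0 (r ` F))"
  have R: "R > 0" "R \<le> r0" "\<And>x. x \<in> F \<Longrightarrow> R \<le> r x"
    using fin r r0 by (auto simp: R_def)
  have "\<exists>s'. lift (ball z R) s' \<and> (\<forall>w\<in>W. s' w = s w)"
    if W: "open W" "convex W" "W \<noteq> {}" "W \<subseteq> ball z R" and s: "lift W s" for W s
  proof -
    have sM: "\<exists>x\<in>F. s w \<in> M x" if w: "w \<in> W" for w
    proof (rule ccontr)
      assume "\<not> (\<exists>x\<in>F. s w \<in> M x)"
      then have "s w \<in> C" using s w by (auto simp: C_def lift_def)
      then have "P w \<in> f ` C" using s w by (metis imageI lift_def)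
      moreover have "w \<in> ball z r0" using w W(4) R(2) by auto
      then have "P w \<in> unit_sphere \<inter> - (f ` C)" using r0(2) by blast
      ultimately show False by blast
    qed
    obtain w0 where w0: "w0 \<in> W" using W by blast
    then obtain x where x: "x \<in> F" "s w0 \<in> M x" using sM by blast
    have "connected (s ` W)"
      using s W by (intro connected_continuous_image convex_connected) (auto simp: lift_def)
    moreover have "open (M x)" "open (\<Union>y\<in>F - {x}. M y)" using M x by auto
    moreover have "M x \<inter> (\<Union>y\<in>F - {x}. M y) \<inter> s ` W = {}" using disj x by blast
    moreover have "s ` W \<subseteq> M x \<union> (\<Union>y\<in>F - {x}. M y)" using sM by blast
    ultimately have "M x \<inter> s ` W = {} \<or> (\<Union>y\<in>F - {x}. M y) \<inter> s ` W = {}" by (rule connectedD)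
    moreover have "M x \<inter> s ` W \<noteq> {}" using x w0 by blast
    ultimately have "s ` W \<subseteq> M x" using \<open>s ` W \<subseteq> M x \<union> (\<Union>y\<in>F - {x}. M y)\<close> by blast
    then have "s ` W \<subseteq> N x" using G(2)[OF x(1)] s by (auto simp: M_def lift_def)
    moreover have "W \<subseteq> ball z (r x)" using W(4) R(3)[OF x(1)] by (meson order_trans subset_ball)
    ultimately obtain s' where s': "lift (ball z (r x)) s'" "\<forall>w\<in>W. s' w = s w"
      using ext[OF x(1) W(1-3) _ s] by blast
    then have "lift (ball z R) s'" using R(3)[OF x(1)] lift_subset subset_ball by blast
    then show ?thesis using s' by blast
  qed
  then show ?thesis using R by blast
qed

end

section \<open>Uniqueness and global continuation of lifts\<close>

lemma exists_non_cone_point: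
  assumes "open U" "U \<noteq> {}" shows "\<exists>u\<in>U. \<not> cone_point u"
proof (rule ccontr)
  assume "\<not> (\<exists>u\<in>U. \<not> cone_point u)"
  then have "U \<subseteq> {z. cone_point z}" by blast
  then have "countable U" using countable_cone_points countable_subset by blast
  moreover obtain u r where "r > 0" "ball u r \<subseteq> U" using assms open_contains_ball by blast
  ultimately show False using uncountable_ball countable_subset by blast
qed

context branched_lifting
begin

lemma locally_injective:
  assumes x: "x \<in> unit_sphere" and k: "local_degree S2 S2 f x = 1"
  obtains N where "openin S2 N" "x \<in> N" "inj_on f N"
proof -
  obtain U D \<phi> \<phi>' \<psi> where U: "openin S2 U" "x \<in> U"
    and \<phi>: "homeomorphism U (D :: complex set) \<phi> \<phi>'"
    and eq: "\<And>u. u \<in> U \<Longrightarrow> (\<psi> (f u) :: complex) = \<phi> u"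
    using has_local_degree_sphere[OF local_degree_f[OF x]] unfolding k power_one_right by metis
  have "inj_on f U"
  proof (rule inj_onI)
    fix u v assume uv: "u \<in> U" "v \<in> U" "f u = f v"
    then have "\<phi> u = \<phi> v" using eq by metis
    then show "u = v" using \<phi> uv by (metis homeomorphism_apply1)
  qed
  then show thesis using that U by blast
qed

lemma lifts_agree_near:
  assumes U: "open U" "u \<in> U" and s: "lift U s" "lift U s'" "s u = s' u"
    and k: "local_degree S2 S2 f (s u) = 1"
  obtains r where "r > 0" "ball u r \<subseteq> U" "\<And>v. v \<in> ball u r \<Longrightarrow> s v = s' v"
proof -
  have su: "s u \<in> unit_sphere" using s U by (auto simp: lift_def)
  obtain N where N: "openin S2 N" "s u \<in> N" "inj_on f N"
    using locally_injective[OF su k] .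
  obtain G where G: "open G" "N = unit_sphere \<inter> G" using N(1) by (auto simp: openin_open)
  have "open (U \<inter> s -` G)" "open (U \<inter> s' -` G)"
    using s U G by (auto simp: lift_def Int_commute intro: continuous_open_preimage)
  then have "open ((U \<inter> s -` G) \<inter> (U \<inter> s' -` G))" by (rule open_Int)
  moreover have "u \<in> (U \<inter> s -` G) \<inter> (U \<inter> s' -` G)" using U s N G by auto
  ultimately obtain r where r: "r > 0" "ball u r \<subseteq> (U \<inter> s -` G) \<inter> (U \<inter> s' -` G)"
    using open_contains_ball by blast
  show thesis
  proof (rule that[OF r(1)])
    show "ball u r \<subseteq> U" using r by blast
    fix v assume v: "v \<in> ball u r"
    then have "v \<in> U" "s v \<in> G" "s' v \<in> G" using r by auto
    then have "s v \<in> N" "s' v \<in> N" using s G by (auto simp: lift_def)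
    moreover have "f (s v) = f (s' v)" using s \<open>v \<in> U\<close> by (simp add: lift_def)
    ultimately show "s v = s' v" using N(3) by (meson inj_onD)
  qed
qed

lemma non_cone_degree:
  assumes "x \<in> unit_sphere" "f x = P z" "\<not> cone_point z"
  shows "local_degree S2 S2 f x = 1"
  using deg assms by blast

text \<open>Distinct lifts may meet at a point of local degree 3, so agreement is propagated only
  through points that are not cone points. Deleting the countably many cone points keeps
  \<open>U\<close> connected; the set of agreement is closed, so it contains the cone points
  too.\<close>

lemma lift_unique:
  assumes U: "open U" "connected U" and s: "lift U s" "lift U s'"
    and u0: "u0 \<in> U" "\<not> cone_point u0" "s u0 = s' u0" and u: "u \<in> U"
  shows "s u = s' u"
proof -
  define U' where "U' = U - {z. cone_point z}"
  define A where "A = {u \<in> U. s u = s' u}"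
  have "connected U'" unfolding U'_def
    using U countable_cone_points by (intro connected_open_diff_countable) auto
  have contd: "continuous_on U (\<lambda>u. s u - s' u)"
    using s by (intro continuous_on_diff) (auto simp: lift_def)
  have A_closed: "closedin (top_of_set U) A"
    using continuous_closedin_preimage[OF contd closed_singleton[of 0]]
    by (auto simp: A_def vimage_def Int_def)
  have 1: "closedin (top_of_set U') (U' \<inter> A)"
    using A_closed unfolding U'_def closedin_closed by blast
  have 2: "openin (top_of_set U') (U' \<inter> A)"
  proof (subst openin_subopen, intro ballI)
    fix v assume v: "v \<in> U' \<inter> A"
    then have vU: "v \<in> U" "\<not> cone_point v" "s v = s' v" by (auto simp: U'_def A_def)
    have "local_degree S2 S2 f (s v) = 1"
      using s vU by (intro non_cone_degree[of _ v]) (auto simp: lift_def)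
    then obtain r where r: "r > 0" "ball v r \<subseteq> U" "\<And>w. w \<in> ball v r \<Longrightarrow> s w = s' w"
      using lifts_agree_near[OF U(1) vU(1) s vU(3)] by metis
    then have "U' \<inter> ball v r \<subseteq> U' \<inter> A" by (auto simp: A_def)
    moreover have "openin (top_of_set U') (U' \<inter> ball v r)" by (simp add: openin_open_Int)
    ultimately show "\<exists>T. openin (top_of_set U') T \<and> v \<in> T \<and> T \<subseteq> U' \<inter> A"
      using v r by (intro exI[of _ "U' \<inter> ball v r"]) auto
  qed
  have "U' \<inter> A \<noteq> {}" using u0 by (auto simp: U'_def A_def)
  then have "U' \<inter> A = U'"
    using \<open>connected U'\<close>[unfolded connected_clopen, rule_format, of "U' \<inter> A"] 1 2 by blast
  then have sub: "U' \<subseteq> A" by blast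
  have "openin (top_of_set U) (U - A)" using A_closed by (simp add: openin_diff)
  then have "open (U - A)" using U by (metis openin_open_trans)
  have "U - A = {}"
  proof (rule ccontr)
    assume "U - A \<noteq> {}"
    then obtain v where "v \<in> U - A" "\<not> cone_point v"
      using exists_non_cone_point[OF \<open>open (U - A)\<close>] by blast
    then show False using sub by (auto simp: U'_def)
  qed
  then show ?thesis using u by (auto simp: A_def)
qed

lemma lift_unique_open:
  assumes "open U" "connected U" "lift U s" "lift U s'" "open W" "W \<noteq> {}" "W \<subseteq> U"
    "\<And>w. w \<in> W \<Longrightarrow> s w = s' w" "u \<in> U"
  shows "s u = s' u"
proof -
  obtain w where "w \<in> W" "\<not> cone_point w" using exists_non_cone_point assms by blast
  then show ?thesis using lift_unique[of U s s' w u] assms by blast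
qed

lemma lift_glue:
  assumes U: "\<And>i. i \<in> I \<Longrightarrow> open (U i) \<and> lift (U i) (s i)"
    and agree: "\<And>i j u. i \<in> I \<Longrightarrow> j \<in> I \<Longrightarrow> u \<in> U i \<Longrightarrow> u \<in> U j \<Longrightarrow> s i u = s j u"
  obtains s' where "lift (\<Union>i\<in>I. U i) s'" "\<And>i u. i \<in> I \<Longrightarrow> u \<in> U i \<Longrightarrow> s' u = s i u"
proof -
  define s' where "s' u = s (SOME i. i \<in> I \<and> u \<in> U i) u" for u
  have s': "s' u = s i u" if "i \<in> I" "u \<in> U i" for i u
  proof -
    have "(SOME i. i \<in> I \<and> u \<in> U i) \<in> I \<and> u \<in> U (SOME i. i \<in> I \<and> u \<in> U i)"
      by (rule someI[of "\<lambda>i. i \<in> I \<and> u \<in> U i" i]) (use that in simp)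
    then show ?thesis unfolding s'_def using agree that by blast
  qed
  have "continuous_on (U i) s'" if "i \<in> I" for i
    using U[OF that] s'[OF that] by (metis continuous_on_cong lift_def)
  then have "continuous_on (\<Union>i\<in>I. U i) s'" using U by (intro continuous_on_open_UN) auto
  moreover have "s' ` (\<Union>i\<in>I. U i) \<subseteq> unit_sphere" "\<forall>u\<in>(\<Union>i\<in>I. U i). f (s' u) = P u"
    using U s' by (fastforce simp: lift_def)+
  ultimately show thesis using that[of s'] s' by (simp add: lift_def)
qed

text \<open>Each boundary point has a ball to which the restriction of \<open>s\<close> to the part
  inside the disc extends. The extensions are glued, and compactness of the closed disc makes the
  gain in radius uniform.\<close>

lemma lift_step:
  assumes R: "R > 0" and s: "lift (ball z0 R) s"
  obtains R' s' where "R' > R" "lift (ball z0 R') s'" "\<And>u. u \<in> ball z0 R \<Longrightarrow> s' u = s u"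
proof -
  define extends where "extends z r \<longleftrightarrow>
      (\<forall>W s. open W \<longrightarrow> convex W \<longrightarrow> W \<noteq> {} \<longrightarrow> W \<subseteq> ball z r \<longrightarrow> lift W s \<longrightarrow>
       (\<exists>s'. lift (ball z r) s' \<and> (\<forall>w\<in>W. s' w = s w)))" for z r
  have "\<forall>z. \<exists>r. r > 0 \<and> extends z r" unfolding extends_def using local_extension by blast
  then obtain \<rho> where \<rho>e: "\<And>z. (\<rho> z :: real) > 0 \<and> extends z (\<rho> z)" by metis
  then have \<rho>: "\<And>z. \<rho> z > 0" by blast
  have ext: "\<exists>s'. lift (ball z (\<rho> z)) s' \<and> (\<forall>w\<in>W. s' w = s w)"
    if "open W" "convex W" "W \<noteq> {}" "W \<subseteq> ball z (\<rho> z)" "lift W s" for z W s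
    using \<rho>e[of z] that unfolding extends_def by blast
  let ?W = "\<lambda>z. ball z0 R \<inter> ball z (\<rho> z)"
  have ne: "?W z \<noteq> {}" if z: "z \<in> sphere z0 R" for z
  proof -
    have "z \<in> closure (ball z0 R)" using z R by (simp add: closure_ball)
    then obtain y where "y \<in> ball z0 R" "dist y z < \<rho> z"
      using \<rho>[of z] unfolding closure_approachable by blast
    then have "y \<in> ball z0 R \<inter> ball z (\<rho> z)" by (simp add: dist_commute)
    then show ?thesis by blast
  qed
  have "\<exists>s'. lift (ball z (\<rho> z)) s' \<and> (\<forall>w\<in>?W z. s' w = s w)" if "z \<in> sphere z0 R" for z
    using ext[of "?W z" z s] ne[OF that] lift_subset[OF s] by (auto simp: convex_Int)
  then obtain t where t: "\<And>z. z \<in> sphere z0 R \<Longrightarrow> lift (ball z (\<rho> z)) (t z)"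
    "\<And>z w. z \<in> sphere z0 R \<Longrightarrow> w \<in> ?W z \<Longrightarrow> t z w = s w"
    by metis
  \<comment> \<open>Two balls centred on the circle that meet also meet inside the disc, where both extensions are \<open>s\<close>.\<close>
  have tt: "t z u = t z' u"
    if z: "z \<in> sphere z0 R" "z' \<in> sphere z0 R" and u: "u \<in> ball z (\<rho> z)" "u \<in> ball z' (\<rho> z')" for z z' u
  proof (cases "z = z'")
    case False
    let ?B = "ball z (\<rho> z) \<inter> ball z' (\<rho> z')"
    \<comment> \<open>The point dividing the segment from \<open>z\<close> to \<open>z'\<close> in
      the ratio of the radii lies in both balls because they overlap. As an inner point of a chord
      it also lies in the open disc.\<close>
    define q where "q = \<rho> z / (\<rho> z + \<rho> z')"
    let ?p = "z + q *\<^sub>R (z' - z)"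
    have pos: "\<rho> z > 0" "\<rho> z' > 0" using \<rho> by auto
    have l: "0 < q" "q < 1" using pos by (auto simp: q_def)
    have d: "dist z z' < \<rho> z + \<rho> z'"
      using u dist_triangle2[of z z' u] by (simp add: dist_commute)
    have "dist z ?p = q * dist z z'"
      using l by (simp add: dist_norm norm_minus_commute)
    also have "\<dots> < q * (\<rho> z + \<rho> z')" using d l by (intro mult_strict_left_mono)
    also have "\<dots> = \<rho> z" using pos by (simp add: q_def)
    finally have p1: "?p \<in> ball z (\<rho> z)" by simp
    have "z' - ?p = (1 - q) *\<^sub>R (z' - z)" by (simp add: algebra_simps)
    then have "dist z' ?p = (1 - q) * dist z z'"
      using l by (simp add: dist_norm norm_minus_commute)
    also have "\<dots> < (1 - q) * (\<rho> z + \<rho> z')" using d l by (intro mult_strict_left_mono) auto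
    also have "\<dots> = \<rho> z'" using pos by (simp add: q_def field_simps)
    finally have p2: "?p \<in> ball z' (\<rho> z')" by simp
    have "?p \<in> open_segment z z'"
      unfolding in_segment using False l by (auto intro!: exI[of _ q] simp: algebra_simps)
    then have "dist z0 ?p < dist z0 z \<or> dist z0 ?p < dist z0 z'"
      by (rule dist_decreases_open_segment[rule_format, of ?p z z' z0])
    then have p3: "?p \<in> ball z0 R" using z by auto
    show ?thesis
    proof (rule lift_unique_open[of ?B "t z" "t z'" "ball z0 R \<inter> ?B"])
      show "open ?B" "connected ?B" by (auto intro: convex_connected convex_Int)
      show "lift ?B (t z)" "lift ?B (t z')" using t(1) z lift_subset by (meson inf_le1 inf_le2)+
      show "ball z0 R \<inter> ?B \<noteq> {}" using p1 p2 p3 by blast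
      show "t z w = t z' w" if "w \<in> ball z0 R \<inter> ?B" for w using t(2) z that by auto
    qed (use u in auto)
  qed simp
  \<comment> \<open>\<open>None\<close> stands for the given disc, \<open>Some z\<close> for the
    ball about the boundary point \<open>z\<close>.\<close>
  define U where "U i = (case i of None \<Rightarrow> ball z0 R | Some z \<Rightarrow> ball z (\<rho> z))" for i
  define \<sigma> where "\<sigma> i = (case i of None \<Rightarrow> s | Some z \<Rightarrow> t z)" for i
  define I where "I = insert None (Some ` sphere z0 R)"
    have glue1: "open (U i) \<and> lift (U i) (\<sigma> i)" if "i \<in> I" for i
      using that s t(1) by (auto simp: I_def U_def \<sigma>_def)
    have glue2: "\<sigma> i u = \<sigma> j u" if "i \<in> I" "j \<in> I" "u \<in> U i" "u \<in> U j" for i j u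
    proof -
      have st: "t z w = s w" if "Some z \<in> I" "w \<in> U (Some z)" "w \<in> U None" for z w
        using t(2)[of z w] that by (auto simp: I_def U_def)
      show ?thesis
      proof (cases i; cases j)
        fix z z' assume ij: "i = Some z" "j = Some z'"
        then have "z \<in> sphere z0 R" "z' \<in> sphere z0 R" using that by (auto simp: I_def)
        then show ?thesis using tt[of z z' u] that unfolding ij by (simp add: U_def \<sigma>_def)
      qed (use that st in \<open>auto simp: \<sigma>_def\<close>)
    qed
  obtain s' where s': "lift (\<Union>i\<in>I. U i) s'" "\<And>i u. i \<in> I \<Longrightarrow> u \<in> U i \<Longrightarrow> s' u = \<sigma> i u"
    using lift_glue[of I U \<sigma>] glue1 glue2 by blast
  have op: "open (\<Union>i\<in>I. U i)" by (intro open_UN) (auto simp: I_def U_def)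
  have "cball z0 R \<subseteq> (\<Union>i\<in>I. U i)"
  proof
    fix u assume "u \<in> cball z0 R"
    then consider "u \<in> ball z0 R" | "u \<in> sphere z0 R" by fastforce
    then show "u \<in> (\<Union>i\<in>I. U i)"
    proof cases
      case 1 then show ?thesis by (auto simp: I_def U_def)
    next
      case 2
      then have "Some u \<in> I" "u \<in> U (Some u)" using \<rho> by (auto simp: I_def U_def)
      then show ?thesis by blast
    qed
  qed
  then obtain e where e: "e > 0" "(\<Union>x\<in>cball z0 R. ball x e) \<subseteq> (\<Union>i\<in>I. U i)"
    using compact_subset_open_imp_ball_epsilon_subset[OF compact_cball op] by blast
  have "ball z0 (R + e) \<subseteq> (\<Union>x\<in>cball z0 R. ball x e)"
  proof
    fix u assume u: "u \<in> ball z0 (R + e)"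
    show "u \<in> (\<Union>x\<in>cball z0 R. ball x e)"
    proof (cases "u \<in> cball z0 R")
      case True then show ?thesis using e by (intro UN_I[of u]) auto
    next
      case False
      let ?d = "cmod (u - z0)"
      \<comment> \<open>The radial projection of \<open>u\<close> to the circle of radius
        \<open>R\<close>.\<close>
      let ?x = "z0 + (R / ?d) *\<^sub>R (u - z0)"
      have d: "R < ?d" "?d < R + e" using False u by (auto simp: dist_norm norm_minus_commute)
      then have uz: "u \<noteq> z0" using R by auto
      have "u - ?x = (1 - R / ?d) *\<^sub>R (u - z0)" by (simp add: algebra_simps)
      then have "cmod (u - ?x) = \<bar>1 - R / ?d\<bar> * ?d" by (metis norm_scaleR)
      also have "\<dots> = ?d - R" using d R uz by (simp add: field_simps abs_if)
      finally have "?x \<in> cball z0 R \<and> u \<in> ball ?x e"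
        using d R uz by (auto simp: dist_norm norm_minus_commute)
      then show ?thesis by blast
    qed
  qed
  then have sub: "ball z0 (R + e) \<subseteq> (\<Union>i\<in>I. U i)" using e by blast
  show thesis
  proof (rule that[of "R + e" s'])
    show "lift (ball z0 (R + e)) s'" using s'(1) sub by (rule lift_subset)
    show "s' u = s u" if "u \<in> ball z0 R" for u
      using s'(2)[of None u] that by (simp add: I_def U_def \<sigma>_def)
  qed (use e in simp)
qed

text \<open>The radii of discs that carry an extension are unbounded: otherwise the extensions,
  which agree by uniqueness, would unite to one on the disc of supremal radius, and
  \<open>lift_step\<close> would enlarge it.\<close>

lemma lift_extends_globally:
  assumes r: "r > 0" and s: "lift (ball z0 r) s"
  obtains s' where "lift UNIV s'" "\<And>u. u \<in> ball z0 r \<Longrightarrow> s' u = s u"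
proof -
  define A where "A = {R. R \<ge> r \<and> (\<exists>s'. lift (ball z0 R) s' \<and> (\<forall>u\<in>ball z0 r. s' u = s u))}"
  have rA: "r \<in> A" using s by (auto simp: A_def)
  have "\<forall>R\<in>A. \<exists>s'. lift (ball z0 R) s' \<and> (\<forall>u\<in>ball z0 r. s' u = s u)" by (auto simp: A_def)
  then obtain t where t: "\<And>R. R \<in> A \<Longrightarrow> lift (ball z0 R) (t R)"
    "\<And>R u. R \<in> A \<Longrightarrow> u \<in> ball z0 r \<Longrightarrow> t R u = s u" by metis
  have agree: "t R u = t R' u" if "R \<in> A" "R' \<in> A" "u \<in> ball z0 R" "u \<in> ball z0 R'" for R R' u
  proof (rule lift_unique_open[of "ball z0 R \<inter> ball z0 R'" "t R" "t R'" "ball z0 r"])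
    show "open (ball z0 R \<inter> ball z0 R')" "connected (ball z0 R \<inter> ball z0 R')"
      by (auto intro: convex_connected convex_Int)
    show "lift (ball z0 R \<inter> ball z0 R') (t R)" "lift (ball z0 R \<inter> ball z0 R') (t R')"
      using t(1) that lift_subset by (meson inf_le1 inf_le2)+
    show "ball z0 r \<subseteq> ball z0 R \<inter> ball z0 R'" using that by (auto simp: A_def)
    show "t R w = t R' w" if "w \<in> ball z0 r" for w using t(2) \<open>R \<in> A\<close> \<open>R' \<in> A\<close> that by simp
  qed (use that r in auto)
  obtain s' where s': "lift (\<Union>R\<in>A. ball z0 R) s'" "\<And>R u. R \<in> A \<Longrightarrow> u \<in> ball z0 R \<Longrightarrow> s' u = t R u"
    using lift_glue[of A "ball z0" t] t(1) agree by (metis open_ball)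
  have s's: "s' u = s u" if "u \<in> ball z0 r" for u using s'(2)[OF rA that] t(2)[OF rA that] by simp
  have "\<not> bdd_above A"
  proof
    assume bdd: "bdd_above A"
    have rS: "r \<le> Sup A" using cSup_upper[OF rA bdd] .
    have "ball z0 (Sup A) \<subseteq> (\<Union>R\<in>A. ball z0 R)"
    proof
      fix u assume "u \<in> ball z0 (Sup A)"
      then have "dist z0 u < Sup A" by simp
      then obtain R where "R \<in> A" "dist z0 u < R" using rA less_cSup_iff[OF _ bdd] by blast
      then show "u \<in> (\<Union>R\<in>A. ball z0 R)" by auto
    qed
    then have l: "lift (ball z0 (Sup A)) s'" using lift_subset[OF s'(1)] by blast
    obtain R' s'' where R': "R' > Sup A" "lift (ball z0 R') s''" "\<And>u. u \<in> ball z0 (Sup A) \<Longrightarrow> s'' u = s' u"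
      using lift_step[OF _ l] r rS by (metis less_le_trans)
    have "s'' u = s u" if "u \<in> ball z0 r" for u using R'(3)[of u] s's[OF that] that rS by auto
    then have "R' \<in> A" using R' rS by (auto simp: A_def)
    then show False using cSup_upper[OF _ bdd, of R'] R' by simp
  qed
  have "(\<Union>R\<in>A. ball z0 R) = UNIV"
  proof (intro equalityI subsetI)
    fix u :: complex
    obtain R where "R \<in> A" "dist z0 u < R" using \<open>\<not> bdd_above A\<close> unfolding bdd_above_def by (meson not_le)
    then show "u \<in> (\<Union>R\<in>A. ball z0 R)" by auto
  qed simp
  then show thesis using that[of s'] s'(1) s's by simp
qed

lemma global_lift:
  assumes "x \<in> unit_sphere" "f x = P z"
  obtains s where "lift UNIV s" "s z = x"
proof -
  obtain r s where r: "r > 0" and s: "lift (ball z r) s" "s z = x"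
    using local_lifts[OF assms] by metis
  obtain s' where "lift UNIV s'" "\<And>u. u \<in> ball z r \<Longrightarrow> s' u = s u"
    using lift_extends_globally[OF r s(1)] by metis
  then show thesis using that s r by simp
qed

end

section \<open>The degree is a norm\<close>

text \<open>The centre of the rotation sending \<open>z\<close> to \<open>omega * z + 1\<close>.
  Modulo the lattice the cone points are 0, \<open>kappa\<close> and \<open>- kappa\<close>.\<close>

definition kappa :: complex where "kappa = 1 / (1 - omega)"

lemma one_minus_omega_kappa [simp]: "(1 - omega) * kappa = 1"
  by (simp add: kappa_def)

lemma cone_point_kappa [simp]: "cone_point kappa"
  by (simp add: cone_point_def)

lemma cone_point_minus [simp]: "cone_point (- z) \<longleftrightarrow> cone_point z"
  by (auto simp: cone_point_def dest: Eisenstein_minus)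

lemma norm_one_minus_omega: "(cmod (1 - omega))\<^sup>2 = 3"
proof -
  have "1 - omega = eis 1 (- 1)" by (simp add: eis_def)
  then show ?thesis by (simp add: norm_eis)
qed

text \<open>Its modulus is the inverse square root of 3, too small for a nonzero lattice
  point.\<close>

lemma kappa_notin: "kappa \<notin> Eisenstein"
proof
  assume "kappa \<in> Eisenstein"
  then have "1 \<le> cmod kappa" by (intro norm_Eisenstein_ge_1) (auto simp: kappa_def)
  then have "cmod (1 - omega) * 1 \<le> cmod (1 - omega) * cmod kappa" by (intro mult_left_mono) auto
  also have "\<dots> = 1" using one_minus_omega_kappa by (metis norm_mult norm_one)
  finally have "(cmod (1 - omega))\<^sup>2 \<le> 1" by (simp add: power_le_one)
  then show False by (simp add: norm_one_minus_omega)
qed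

text \<open>\<open>3 = (1 - omega) * (1 - omega ^ 2)\<close>. With the preceding lemma,
  \<open>kappa\<close> has order 3 modulo the lattice.\<close>

lemma three_kappa: "3 * kappa \<in> Eisenstein"
proof -
  have "(1 - omega) * (1 - omega ^ 2) = 1 - omega - omega * omega + omega ^ 3"
    by (simp add: power2_eq_square power3_eq_cube algebra_simps)
  also have "\<dots> = 3" by (simp add: omega_squared omega_cubed)
  finally have "3 * kappa = ((1 - omega) * (1 - omega ^ 2)) * kappa" by metis
  also have "\<dots> = ((1 - omega) * kappa) * (1 - omega ^ 2)" by (simp only: mult_ac)
  finally have "3 * kappa = ((1 - omega) * kappa) * (1 - omega ^ 2)" .
  then have "3 * kappa = 1 - omega ^ 2" by simp
  then show ?thesis using Eisenstein_diff[OF Eisenstein_1 Eisenstein_power[OF omega_in, of 2]] by simp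
qed

section \<open>Cone points modulo the group\<close>

context orbifold_projection
begin

lemma cone_point_cong: "P z = P w \<Longrightarrow> cone_point z \<Longrightarrow> cone_point w"
proof -
  assume "P z = P w" and z: "cone_point z"
  then obtain j where j: "w - omega ^ j * z \<in> Eisenstein" using eq_iff by blast
  have "(1 - omega) * w = (1 - omega) * (w - omega ^ j * z) + omega ^ j * ((1 - omega) * z)"
    by (simp add: algebra_simps)
  moreover have "(1 - omega) * (w - omega ^ j * z) \<in> Eisenstein" using j by (intro Eisenstein_mult[of "1 - omega"]) auto
  moreover have "omega ^ j * ((1 - omega) * z) \<in> Eisenstein"
    using z by (intro Eisenstein_mult[of "omega ^ j"]) (auto simp: cone_point_def)
  ultimately show "cone_point w" unfolding cone_point_def by (metis Eisenstein_add)
qed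

text \<open>A rotation moves a cone point by a lattice vector, so the orbit of a cone point is a
  single translation class.\<close>

lemma eq_cone_point_iff:
  assumes "cone_point z" shows "P z = P w \<longleftrightarrow> w - z \<in> Eisenstein"
proof
  assume "P z = P w"
  then obtain j where j: "w - omega ^ j * z \<in> Eisenstein" using eq_iff by blast
  have "w - z = (w - omega ^ j * z) - (1 - omega ^ j) * z" by (simp add: algebra_simps)
  then show "w - z \<in> Eisenstein" using Eisenstein_diff[OF j cone_point_power_diff_in[OF assms]] by metis
next
  assume "w - z \<in> Eisenstein"
  then show "P z = P w" using translate[of "w - z" z] by simp
qed

lemma cone_images_distinct: "P 0 \<noteq> P kappa" "P 0 \<noteq> P (- kappa)" "P kappa \<noteq> P (- kappa)"
proof -
  show "P 0 \<noteq> P kappa" using eq_cone_point_iff[of 0] kappa_notin by simp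
  have "- kappa \<notin> Eisenstein" using kappa_notin Eisenstein_minus by fastforce
  then show "P 0 \<noteq> P (- kappa)" using eq_cone_point_iff[of 0] by simp
  show "P kappa \<noteq> P (- kappa)"
  proof
    assume "P kappa = P (- kappa)"
    then have "- kappa - kappa \<in> Eisenstein" using eq_cone_point_iff[of kappa] by simp
    \<comment> \<open>Adding \<open>3 * kappa\<close> to \<open>- 2 * kappa\<close> would put
      \<open>kappa\<close> into the lattice.\<close>
    from Eisenstein_add[OF this three_kappa] show False using kappa_notin by simp
  qed
qed

text \<open>Cone points are \<open>kappa\<close> times lattice points, and the image depends only on
  the residue of the latter modulo \<open>1 - omega\<close>.\<close>

lemma finite_cone_images: "finite (P ` {z. cone_point z})"
proof -
  have "1 - omega \<in> Eisenstein" "1 - omega \<noteq> 0" by auto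
  then obtain R where R: "finite R"
    "\<And>t. t \<in> Eisenstein \<Longrightarrow> \<exists>!r. r \<in> R \<and> (\<exists>e\<in>Eisenstein. t = r + (1 - omega) * e)"
    using Eisenstein_residues by metis
  have "P ` {z. cone_point z} \<subseteq> (\<lambda>r. P (kappa * r)) ` R"
  proof (rule image_subsetI)
    fix z assume "z \<in> {z. cone_point z}"
    then obtain r e where re: "r \<in> R" "e \<in> Eisenstein" "(1 - omega) * z = r + (1 - omega) * e"
      using R(2)[of "(1 - omega) * z"] unfolding cone_point_def by blast
    have "z = ((1 - omega) * kappa) * z" by simp
    also have "\<dots> = kappa * ((1 - omega) * z)" by (simp only: mult_ac)
    also have "\<dots> = kappa * r + ((1 - omega) * kappa) * e" unfolding re(3) by (simp only: distrib_left mult_ac)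
    also have "\<dots> = kappa * r + e" by simp
    finally have "P z = P (kappa * r)" using translate[OF re(2)] by simp
    then show "P z \<in> (\<lambda>r. P (kappa * r)) ` R" using re(1) by blast
  qed
  then show ?thesis using R(1) by (meson finite_imageI finite_subset)
qed

end

section \<open>Range and periods of a global lift\<close>

context branched_lifting
begin

lemma lift_compose_symmetry:
  assumes "lift UNIV s" "t \<in> Eisenstein"
  shows "lift UNIV (\<lambda>w. s (omega ^ j * w + t))"
proof -
  have "continuous_on UNIV (\<lambda>w. s (omega ^ j * w + t))"
  proof (rule continuous_on_compose2[of UNIV s])
    show "continuous_on UNIV s" using assms by (simp add: lift_def)
    show "continuous_on UNIV (\<lambda>w. omega ^ j * w + t)" by (intro continuous_intros)
  qed simp
  then show ?thesis
    using assms translate[OF assms(2)] rotate by (auto simp: lift_def)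
qed

lemma lift_unique_UNIV:
  assumes "lift UNIV s" "lift UNIV s'" "\<not> cone_point z" "s z = s' z"
  shows "s = s'"
  using lift_unique[of UNIV s s' z] assms by auto

lemma lift_range_neighbourhood:
  assumes s: "lift UNIV s" and z: "\<not> cone_point z"
  obtains N where "openin S2 N" "s z \<in> N" "N \<subseteq> range s"
proof -
  have sz: "s z \<in> unit_sphere" "f (s z) = P z" using s unfolding lift_def by blast+
  obtain N0 where N0: "openin S2 N0" "s z \<in> N0" "inj_on f N0"
    using locally_injective[OF sz(1) non_cone_degree[OF sz z]] .
  obtain G where G: "open G" "N0 = unit_sphere \<inter> G" using N0(1) by (auto simp: openin_open)
  have "open (s -` G)" using s G by (auto simp: lift_def intro: open_vimage)
  then obtain e where e: "e > 0" "ball z e \<subseteq> s -` G" using N0 G open_contains_ball by blast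
  obtain V where V: "openin S2 V" "P z \<in> V" "V \<subseteq> P ` ball z e"
    using image_ball_open[OF e(1)] by blast
  have "openin S2 (unit_sphere \<inter> f -` V)"
    using continuous_openin_preimage[OF continuous_f _ V(1)] f_in by blast
  then have "openin S2 (N0 \<inter> (unit_sphere \<inter> f -` V))" using N0 by blast
  moreover have "s z \<in> N0 \<inter> (unit_sphere \<inter> f -` V)" using N0 V sz by auto
  moreover have "N0 \<inter> (unit_sphere \<inter> f -` V) \<subseteq> range s"
  proof
    fix u assume u: "u \<in> N0 \<inter> (unit_sphere \<inter> f -` V)"
    then obtain w where w: "w \<in> ball z e" "f u = P w" using V by blast
    have "s w \<in> unit_sphere" using s unfolding lift_def by blast
    moreover have "s w \<in> G" using w(1) e by blast
    ultimately have "s w \<in> N0" using G by blast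
    moreover have "f (s w) = f u" using s w by (simp add: lift_def)
    ultimately have "u = s w" using u inj_onD[OF N0(3), of "s w" u] by simp
    then show "u \<in> range s" by blast
  qed
  ultimately show thesis by (rule that)
qed

text \<open>On the sphere without the finitely many points over cone values, which is connected, the
  range of \<open>s\<close> is open. So is its complement: a lift through a missed point fills a
  neighbourhood, and if that met the range of \<open>s\<close>, the two lifts would differ by a
  group element and have the same range.\<close>

lemma lift_surjective:
  assumes s: "lift UNIV s" and x: "x \<in> unit_sphere" "f x \<notin> P ` {z. cone_point z}"
  shows "x \<in> range s"
proof -
  define S' where "S' = unit_sphere - {x \<in> unit_sphere. f x \<in> P ` {z. cone_point z}}"
  have "{x \<in> unit_sphere. f x \<in> P ` {z. cone_point z}}
      = (\<Union>y\<in>P ` {z. cone_point z}. {x \<in> unit_sphere. f x = y})" by blast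
  moreover have "finite (\<Union>y\<in>P ` {z. cone_point z}. {x \<in> unit_sphere. f x = y})"
  proof (rule finite_UN_I[OF finite_cone_images])
    fix y assume "y \<in> P ` {z. cone_point z}"
    then obtain z where "y = P z" by blast
    then show "finite {x \<in> unit_sphere. f x = y}" using finite_fibre[of z] by simp
  qed
  ultimately have conn: "connected S'"
    unfolding S'_def by (intro connected_unit_sphere_minus_finite) simp
  have noncone: "\<not> cone_point z" if "u \<in> S'" "f u = P z" for u z
    using that by (auto simp: S'_def)
  have 1: "openin (top_of_set S') (S' \<inter> range s)"
  proof (subst openin_subopen, intro ballI)
    fix u assume u: "u \<in> S' \<inter> range s"
    then obtain z where z: "u = s z" by blast
    then have "f u = P z" using s by (simp add: lift_def)
    then have "\<not> cone_point z" using noncone u by blast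
    then obtain N where N: "openin S2 N" "s z \<in> N" "N \<subseteq> range s"
      using lift_range_neighbourhood[OF s] by metis
    obtain G where "open G" "N = unit_sphere \<inter> G" using N(1) by (auto simp: openin_open)
    then have "S' \<inter> N = S' \<inter> G" "open G" by (auto simp: S'_def)
    then have "openin (top_of_set S') (S' \<inter> N)" by (simp add: openin_open_Int)
    then show "\<exists>T. openin (top_of_set S') T \<and> u \<in> T \<and> T \<subseteq> S' \<inter> range s"
      using N u z by (intro exI[of _ "S' \<inter> N"]) auto
  qed
  have 2: "openin (top_of_set S') (S' - range s)"
  proof (subst openin_subopen, intro ballI)
    fix u assume u: "u \<in> S' - range s"
    then have uS: "u \<in> unit_sphere" by (simp add: S'_def)
    then obtain z where z: "f u = P z" using f_in surj by blast
    then have zc: "\<not> cone_point z" using noncone u by blast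
    obtain t where t: "lift UNIV t" "t z = u" using global_lift[OF uS z] .
    obtain N where N: "openin S2 N" "t z \<in> N" "N \<subseteq> range t"
      using lift_range_neighbourhood[OF t(1) zc] .
    obtain G where "open G" "N = unit_sphere \<inter> G" using N(1) by (auto simp: openin_open)
    then have "S' \<inter> N = S' \<inter> G" "open G" by (auto simp: S'_def)
    then have op: "openin (top_of_set S') (S' \<inter> N)" by (simp add: openin_open_Int)
    have "v \<notin> range s" if v: "v \<in> S' \<inter> N" for v
    proof
      assume "v \<in> range s"
      then obtain w' where w': "v = s w'" by blast
      obtain w where w: "v = t w" using v N by blast
      have "f (t w) = P w" "f (s w') = P w'" using s t(1) unfolding lift_def by blast+
      then have fv: "f v = P w" "f v = P w'" using w w' by metis+
      then obtain j where j: "w' - omega ^ j * w \<in> Eisenstein" using eq_iff by metis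
      have "lift UNIV (\<lambda>v. s (omega ^ j * v + (w' - omega ^ j * w)))"
        by (rule lift_compose_symmetry[OF s j])
      moreover have "\<not> cone_point w" using noncone v fv by blast
      moreover have "t w = s (omega ^ j * w + (w' - omega ^ j * w))" using w w' by simp
      ultimately have "t = (\<lambda>v. s (omega ^ j * v + (w' - omega ^ j * w)))"
        using lift_unique_UNIV[OF t(1)] by blast
      then have "u \<in> range s" using t(2) by (metis rangeI)
      then show False using u by blast
    qed
    then show "\<exists>T. openin (top_of_set S') T \<and> u \<in> T \<and> T \<subseteq> S' - range s"
      using op N u t by (intro exI[of _ "S' \<inter> N"]) auto
  qed
  obtain z where z: "\<not> cone_point z" using exists_non_cone_point[of UNIV] by auto
  have sz: "s z \<in> unit_sphere" "f (s z) = P z" using s unfolding lift_def by blast+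
  have "f (s z) \<notin> P ` {z. cone_point z}"
  proof
    assume "f (s z) \<in> P ` {z. cone_point z}"
    then obtain c where "cone_point c" "P c = P z" using sz by auto
    then show False using z cone_point_cong by blast
  qed
  then have "s z \<in> S' \<inter> range s" using sz by (simp add: S'_def)
  moreover have "S' \<inter> range s = {} \<or> S' \<inter> range s = S'"
  proof -
    have "S' - (S' \<inter> range s) = S' - range s" by blast
    then have "closedin (top_of_set S') (S' \<inter> range s)"
      using 2 by (simp add: closedin_def)
    then show ?thesis using conn 1 unfolding connected_clopen by blast
  qed
  ultimately have "S' \<subseteq> range s" by blast
  then show ?thesis using x by (auto simp: S'_def)
qed

lemma degree_is_norm:
  assumes x0: "x0 \<in> unit_sphere" "f x0 = P 0"
      "local_degree S2 S2 f x0 = 1"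
    and d: "has_degree S2 S2 f d"
  shows "\<exists>a b. int d = a\<^sup>2 - a * b + b\<^sup>2"
proof -
  obtain s where s: "lift UNIV s" "s 0 = x0" using global_lift[OF x0(1,2)] .
  \<comment> \<open>Both lifts pass through \<open>x0\<close> at the cone point 0, where equality of
    values alone does not identify lifts. Local injectivity of \<open>f\<close> at \<open>x0\<close>
    yields agreement on a small disc, and that disc contains points that are not cone
    points.\<close>
  have om: "s (omega * w) = s w" for w
  proof -
    have l: "lift UNIV (\<lambda>w. s (omega * w))" using lift_compose_symmetry[OF s(1), of 0 1] by simp
    obtain r where r: "r > 0" "\<And>v. v \<in> ball 0 r \<Longrightarrow> s v = s (omega * v)"
      using lifts_agree_near[of UNIV 0 s "\<lambda>w. s (omega * w)"] s l x0(3) by auto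
    obtain v where "v \<in> ball 0 r" "\<not> cone_point v"
      using exists_non_cone_point[of "ball 0 r"] r(1) by auto
    then have "s = (\<lambda>w. s (omega * w))" using lift_unique_UNIV[OF s(1) l] r by blast
    then show ?thesis by metis
  qed
  have om_pow: "s (omega ^ j * w) = s w" for j w
    by (induction j) (simp_all add: om mult.assoc)
  define T where "T = {t \<in> Eisenstein. \<forall>w. s (w + t) = s w}"
  have "\<exists>l\<in>T. T = {l * e | e. e \<in> Eisenstein}"
  proof (rule Eisenstein_ideal_principal)
    show "T \<subseteq> Eisenstein" "0 \<in> T" by (auto simp: T_def)
    fix a b assume ab: "a \<in> T" "b \<in> T"
    have "s (w + (a - b)) = s w" for w
    proof -
      have "s (w + (a - b)) = s ((w - b) + a)" by (simp add: algebra_simps)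
      also have "\<dots> = s (w - b)" using ab by (simp add: T_def)
      also have "\<dots> = s ((w - b) + b)" using ab(2) unfolding T_def by (metis (mono_tags, lifting) mem_Collect_eq)
      finally show ?thesis by simp
    qed
    then show "a - b \<in> T" using ab by (auto simp: T_def)
  next
    fix t assume t: "t \<in> T"
    have "s (w + omega * t) = s w" for w
    proof -
      \<comment> \<open>Rotation conjugates translation by \<open>t\<close> into translation by
        \<open>omega * t\<close>, and \<open>s\<close> does not notice rotations.\<close>
      have "omega * (omega ^ 2 * w + t) = omega ^ 3 * w + omega * t"
        by (simp add: power2_eq_square power3_eq_cube algebra_simps)
      then have "s (w + omega * t) = s (omega * (omega ^ 2 * w + t))" by (simp add: omega_cubed)
      also have "\<dots> = s (omega ^ 2 * w + t)" by (rule om)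
      also have "\<dots> = s (omega ^ 2 * w)" using t by (simp add: T_def)
      finally show ?thesis by (simp add: om_pow)
    qed
    then show "omega * t \<in> T" using t by (auto simp: T_def)
  qed
  then obtain l where lT: "l \<in> T" and T: "T = {l * e | e. e \<in> Eisenstein}" by blast
  obtain z0 where z0: "\<not> cone_point z0" using exists_non_cone_point[of UNIV] by auto
  define F where "F = {x \<in> unit_sphere. f x = P z0}"
  have finF: "finite F" unfolding F_def by (rule finite_fibre)
  have cardF: "card F = d"
  proof -
    have "P z0 \<notin> branching_points S2 S2 f"
      using non_cone_degree[OF _ _ z0] by (fastforce simp: branching_points_def fibre_def)
    moreover have "fibre S2 f (P z0) = F" by (simp add: fibre_def F_def)
    ultimately show ?thesis using d in_sphere[of z0] by (auto simp: has_degree_def)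
  qed
  \<comment> \<open>A point of the fibre is \<open>s w\<close> with \<open>w\<close> in the orbit of
    \<open>z0\<close>; rotating \<open>w\<close> back leaves a lattice translate of
    \<open>z0\<close>.\<close>
  have F: "F = (\<lambda>t. s (z0 + t)) ` Eisenstein"
  proof (intro equalityI subsetI)
    fix x assume x: "x \<in> F"
    then have fx: "f x = P z0" by (simp add: F_def)
    have "f x \<notin> P ` {z. cone_point z}"
    proof
      assume "f x \<in> P ` {z. cone_point z}"
      then obtain c where "cone_point c" "P c = P z0" using fx by auto
      then show False using z0 cone_point_cong by blast
    qed
    then obtain w where w: "x = s w" using lift_surjective[OF s(1), of x] x by (auto simp: F_def)
    then have "P z0 = P w" using x s(1) by (auto simp: F_def lift_def)
    then obtain j where j: "j < 3" "w - omega ^ j * z0 \<in> Eisenstein" using eq_iff by blast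
    define t where "t = omega ^ (3 - j) * (w - omega ^ j * z0)"
    have inv: "omega ^ j * omega ^ (3 - j) = 1" using j omega_cubed by (simp flip: power_add)
    have "omega ^ j * (z0 + t) = omega ^ j * z0 + (omega ^ j * omega ^ (3 - j)) * (w - omega ^ j * z0)"
      by (simp only: t_def distrib_left mult.assoc)
    then have "omega ^ j * (z0 + t) = w" by (simp add: inv)
    then have "x = s (z0 + t)" using w om_pow[of j "z0 + t"] by simp
    moreover have "t \<in> Eisenstein" unfolding t_def using j by (intro Eisenstein_mult[of "omega ^ (3 - j)"]) auto
    ultimately show "x \<in> (\<lambda>t. s (z0 + t)) ` Eisenstein" by blast
  next
    fix x assume "x \<in> (\<lambda>t. s (z0 + t)) ` Eisenstein"
    then obtain t where t: "t \<in> Eisenstein" "x = s (z0 + t)" by blast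
    then have "x \<in> unit_sphere" "f x = P (z0 + t)" using s(1) unfolding lift_def by blast+
    then show "x \<in> F" using translate[OF t(1)] by (simp add: F_def)
  qed
  have T_iff: "s (z0 + t) = s (z0 + t') \<longleftrightarrow> t - t' \<in> T" if t: "t \<in> Eisenstein" "t' \<in> Eisenstein" for t t'
  proof
    assume eq: "s (z0 + t) = s (z0 + t')"
    have "(\<lambda>w. s (w + t)) = (\<lambda>w. s (w + t'))"
      using lift_unique_UNIV[of "\<lambda>w. s (w + t)" "\<lambda>w. s (w + t')", OF _ _ z0] eq
        lift_compose_symmetry[OF s(1) t(1), of 0] lift_compose_symmetry[OF s(1) t(2), of 0] by simp
    then have "s (w + (t - t')) = s w" for w
      using fun_cong[of "\<lambda>w. s (w + t)" "\<lambda>w. s (w + t')" "w - t'"] by (simp add: algebra_simps)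
    then show "t - t' \<in> T" using t by (auto simp: T_def)
  next
    assume "t - t' \<in> T"
    then have "s ((z0 + t') + (t - t')) = s (z0 + t')" unfolding T_def by blast
    then show "s (z0 + t) = s (z0 + t')" by (simp add: algebra_simps)
  qed
  \<comment> \<open>Without a nonzero period the translates of \<open>z0\<close> would give
    infinitely many points of a finite fibre.\<close>
  have "l \<noteq> 0"
  proof
    assume "l = 0"
    then have "T = {0}" unfolding T by (auto intro: exI[of _ 0])
    then have "inj_on (\<lambda>t. s (z0 + t)) Eisenstein" using T_iff by (intro inj_onI) auto
    then have "finite Eisenstein" using F finF finite_image_iff by metis
    moreover have "range (of_nat :: nat \<Rightarrow> complex) \<subseteq> Eisenstein"
      by (metis Eisenstein_of_int image_subsetI of_int_of_nat_eq)
    ultimately have "finite (range (of_nat :: nat \<Rightarrow> complex))" by (rule finite_subset[rotated])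
    then show False using finite_imageD[of "of_nat :: nat \<Rightarrow> complex" UNIV] by (simp add: inj_of_nat)
  qed
  have lE: "l \<in> Eisenstein" using lT by (simp add: T_def)
  obtain R where R: "finite R" "R \<subseteq> Eisenstein" "of_nat (card R) = (cmod l)\<^sup>2"
    "\<And>t. t \<in> Eisenstein \<Longrightarrow> \<exists>!r. r \<in> R \<and> (\<exists>e\<in>Eisenstein. t = r + l * e)"
    using Eisenstein_residues[OF lE \<open>l \<noteq> 0\<close>] by metis
  have "bij_betw (\<lambda>t. s (z0 + t)) R F"
    unfolding bij_betw_def
  proof
    show "inj_on (\<lambda>t. s (z0 + t)) R"
    proof (rule inj_onI)
      fix a b assume ab: "a \<in> R" "b \<in> R" "s (z0 + a) = s (z0 + b)"
      then have "a - b \<in> T" using T_iff R(2) by blast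
      then obtain e where e: "e \<in> Eisenstein" "a - b = l * e" unfolding T by blast
      then have "a = b + l * e" by (simp add: algebra_simps)
      moreover have "a = a + l * 0" by simp
      ultimately show "a = b" using R(4)[of a] R(2) ab e Eisenstein_0 by blast
    qed
    have "s (z0 + t) \<in> (\<lambda>t. s (z0 + t)) ` R" if t: "t \<in> Eisenstein" for t
    proof -
      obtain r e where re: "r \<in> R" "e \<in> Eisenstein" "t = r + l * e" using R(4)[OF t] by blast
      then have "t - r \<in> T" unfolding T by auto
      then show ?thesis using T_iff t re R(2) by blast
    qed
    then show "(\<lambda>t. s (z0 + t)) ` R = F" unfolding F using R(2) by blast
  qed
  then have "card R = d" using cardF bij_betw_same_card by metis
  moreover obtain a b where "l = eis a b" using lE by (rule EisensteinE)
  ultimately have "of_int (int d) = (of_int (a\<^sup>2 - a * b + b\<^sup>2) :: real)" using R(3) norm_eis by simp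
  then show ?thesis by (metis of_int_eq_iff)
qed

end

section \<open>Partitions with orbifold type (3,3,3)\<close>

text \<open>The branching point whose partition contains 1 is matched with the cone point 0, the
  other two with \<open>kappa\<close> and \<open>- kappa\<close>; a preimage of local degree 1 then
  lies over the image of 0.\<close>

lemma realizable_sphere_imp_norm:
  assumes real: "realizable S2 S2 d Ps"
    and size: "size Ps = 3"
    and parts: "\<And>p e. p \<in># Ps \<Longrightarrow> e \<in># p \<Longrightarrow> e = 1 \<or> e = 3" "\<And>p. p \<in># Ps \<Longrightarrow> p \<noteq> {#}"
    and one: "p1 \<in># Ps" "1 \<in># p1"
  shows "\<exists>a b. int d = a\<^sup>2 - a * b + b\<^sup>2"
proof -
  let ?S = "S2"
  obtain f where f: "branched_cover ?S ?S f" "has_degree ?S ?S f d" "finite (branching_points ?S ?S f)"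
    "image_mset (local_degrees ?S ?S f) (mset_set (branching_points ?S ?S f)) = Ps"
    using real unfolding realizable_def by blast
  define B where "B = branching_points ?S ?S f"
  have finB: "finite B" using f by (simp add: B_def)
  have Ps: "Ps = image_mset (local_degrees ?S ?S f) (mset_set B)" using f(4) by (simp add: B_def)
  have cardB: "card B = 3" using size unfolding Ps by simp
  have BS: "B \<subseteq> unit_sphere" by (auto simp: B_def branching_points_def)
  have inPs: "local_degrees ?S ?S f b \<in># Ps" if "b \<in> B" for b
    using that finB unfolding Ps by simp
  \<comment> \<open>An infinite fibre would give the empty multiset, the default value of
    \<open>mset_set\<close>. As all partitions are nonempty, the fibres over branching points are
    finite.\<close>
  have in_deg: "local_degree ?S ?S f x \<in># local_degrees ?S ?S f b" if b: "b \<in> B" "x \<in> fibre ?S f b" for b x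
  proof -
    have "local_degrees ?S ?S f b \<noteq> {#}" using parts(2) inPs[OF b(1)] by blast
    then have "finite (fibre ?S f b)" unfolding local_degrees_def by (metis image_mset_empty mset_set.infinite)
    then show ?thesis using b by (simp add: local_degrees_def)
  qed
  obtain b0 where b0: "b0 \<in> B" "p1 = local_degrees ?S ?S f b0" using one(1) finB unfolding Ps by auto
  obtain x0 where x0: "x0 \<in> fibre ?S f b0" "local_degree ?S ?S f x0 = 1"
    using one(2) unfolding b0(2) local_degrees_def
    by (metis (no_types, lifting) elem_mset_set image_iff mset_set.infinite set_image_mset set_mset_empty empty_iff)
  have "card (B - {b0}) = 2" using cardB b0(1) finB by simp
  then obtain b1 b2 where b12: "B - {b0} = {b1, b2}" "b1 \<noteq> b2" by (meson card_2_iff)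
  then have B: "B = {b0, b1, b2}" "b0 \<noteq> b1" "b0 \<noteq> b2" using b0(1) by auto
  define c where "c i = (if i = 0 then 0 else if i = (1::nat) then kappa else - kappa)" for i
  define b where "b i = (if i = 0 then b0 else if i = (1::nat) then b1 else b2)" for i
  obtain h h' where h: "homeomorphism unit_sphere unit_sphere h h'"
    and hb: "\<And>i. i \<in> {0, 1, 2} \<Longrightarrow> h (triangle_projection (c i)) = b i"
  proof (rule sphere_homeomorphism_moving_points[of "{0, 1, 2}" "\<lambda>i. triangle_projection (c i)" b])
    show "inj_on (\<lambda>i. triangle_projection (c i)) {0, 1, 2}"
      using triangle.cone_images_distinct by (auto simp: inj_on_def c_def)
    show "inj_on b {0, 1, 2}" using B b12 by (auto simp: inj_on_def b_def)
    show "b i \<in> unit_sphere" for i using BS unfolding B b_def by auto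
  qed (use triangle_projection_in in auto)
  interpret Q: orbifold_projection "h \<circ> triangle_projection"
    by (rule triangle.compose_homeomorphism[OF h])
  have Qb: "(h \<circ> triangle_projection) 0 = b0" "(h \<circ> triangle_projection) kappa = b1"
    "(h \<circ> triangle_projection) (- kappa) = b2"
    using hb[of 0] hb[of 1] hb[of 2] by (simp_all add: c_def b_def)
  interpret branched_lifting "h \<circ> triangle_projection" f
  proof
    show "branched_cover ?S ?S f" by (rule f)
    fix x z assume x: "x \<in> unit_sphere" "f x = (h \<circ> triangle_projection) z"
    have fx: "x \<in> fibre ?S f (f x)" using x by (simp add: fibre_def)
    show "local_degree ?S ?S f x = 1 \<or> local_degree ?S ?S f x = 3 \<and> cone_point z"
    proof (cases "f x \<in> B")
      case True
      then have "local_degree ?S ?S f x = 1 \<or> local_degree ?S ?S f x = 3"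
        using parts(1)[OF inPs in_deg] fx by blast
      moreover have "\<exists>c. cone_point c \<and> (h \<circ> triangle_projection) c = (h \<circ> triangle_projection) z"
        using True Qb unfolding x(2) B(1) by (metis cone_point_0 cone_point_kappa cone_point_minus insertE singletonD)
      then have "cone_point z" using Q.cone_point_cong by blast
      ultimately show ?thesis by blast
    next
      case False
      have "f x \<in> unit_sphere" unfolding x(2) by (rule Q.in_sphere)
      then have "\<not> local_degree ?S ?S f x > 1" using False fx by (auto simp: B_def branching_points_def)
      moreover have "local_degree ?S ?S f x \<ge> 1"
        using branched_cover_local_degree[OF f(1), of x] x by (auto simp: has_local_degree_def)
      ultimately show ?thesis by linarith
    qed
  qed
  show ?thesis
  proof (rule degree_is_norm)
    show "x0 \<in> unit_sphere" "f x0 = (h \<circ> triangle_projection) 0" using x0 Qb by (simp_all add: fibre_def)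
  qed (use x0 f in auto)
qed

section \<open>Classification of the candidate covers\<close>

lemma filter_mset_replicate_mset:
  "filter_mset Q (replicate_mset n x) = (if Q x then replicate_mset n x else {#})"
  by (induction n) auto

lemma replicate_mset_plus:
  "replicate_mset (m + n) x = replicate_mset m x + replicate_mset n x"
  by (induction m) auto

text \<open>To be applied to the multiplicities of 1 in the three partitions, which are all
  congruent to \<open>d\<close> modulo 3.\<close>

lemma sum_3_same_residue:
  fixes a b c :: nat
  assumes "a + b + c = 3" "a mod 3 = b mod 3" "b mod 3 = c mod 3"
  shows "a = 1 \<and> b = 1 \<and> c = 1 \<or> a = 3 \<and> b = 0 \<and> c = 0 \<or> a = 0 \<and> b = 3 \<and> c = 0 \<or> a = 0 \<and> b = 0 \<and> c = 3"
proof -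
  have "a = 0 \<or> a = 1 \<or> a = 2 \<or> a = 3" "b = 0 \<or> b = 1 \<or> b = 2 \<or> b = 3"
    "c = 0 \<or> c = 1 \<or> c = 2 \<or> c = 3" using assms(1) by linarith+
  then show ?thesis using assms by (elim disjE) simp_all
qed

text \<open>Every entry divides the cone order 3. An entry 1 contributes a cone point of order 3
  upstairs and an entry 3 contributes none, so the entries 1 number exactly three, and they are
  distributed equally modulo 3.\<close>

lemma partitions_of_S333:
  assumes parts: "\<And>P. P \<in># Ps \<Longrightarrow> partition_of d P \<and> (\<exists>e\<in>#P. e > 1)"
    and base: "filter_mset (\<lambda>p. p \<noteq> 1) (image_mset cone_order Ps) = {#3, 3, 3#}"
    and total: "filter_mset (\<lambda>p. p \<noteq> 1) (\<Sum>P\<in>#Ps. image_mset (\<lambda>e. cone_order P div e) P) = {#3, 3, 3#}"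
  shows "\<exists>k\<ge>1.
         d = 3 * k + 1 \<and>
           Ps = {# replicate_mset k 3 + {#1#}, replicate_mset k 3 + {#1#}, replicate_mset k 3 + {#1#} #} \<or>
         d = 3 * k + 3 \<and>
           Ps = {# replicate_mset (k + 1) 3, replicate_mset (k + 1) 3, replicate_mset k 3 + {#1, 1, 1#} #}"
proof -
  have dvd: "e dvd cone_order P" if "e \<in># P" for e P
    unfolding cone_order_def using that by (intro dvd_Lcm)
  \<comment> \<open>Every partition has an entry above 1, so the filter drops no cone order and
    there are exactly three partitions.\<close>
  have "cone_order P \<noteq> 1" if "P \<in># Ps" for P
    using parts[OF that] dvd[of _ P] by fastforce
  then have "filter_mset (\<lambda>p. p \<noteq> 1) (image_mset cone_order Ps) = image_mset cone_order Ps"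
    by (intro filter_mset_eq_conv[THEN iffD2]) auto
  then have img: "image_mset cone_order Ps = {#3, 3, 3#}" using base by simp
  then have "size Ps = 3" by (metis add_2_eq_Suc' size_add_mset size_empty size_image_mset numeral_3_eq_3 numeral_2_eq_2)
  obtain xs where xs: "mset xs = Ps" using ex_mset by blast
  then have "length xs = 3" using \<open>size Ps = 3\<close> by (metis size_mset)
  then obtain A B C where "xs = [A, B, C]"
    by (auto simp: numeral_3_eq_3 length_Suc_conv)
  then have Ps: "Ps = {#A, B, C#}" using xs by simp
  have co: "cone_order P = 3" if "P \<in># Ps" for P
  proof -
    have "cone_order P \<in># image_mset cone_order Ps" using that by simp
    then show ?thesis unfolding img by auto
  qed
  have form: "P = replicate_mset (count P 3) 3 + replicate_mset (count P 1) 1 \<and> count P 3 \<ge> 1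
      \<and> d = 3 * count P 3 + count P 1
      \<and> filter_mset (\<lambda>p. p \<noteq> 1) (image_mset (\<lambda>e. cone_order P div e) P) = replicate_mset (count P 1) 3"
    if P: "P \<in># Ps" for P
  proof -
    have e: "e = 1 \<or> e = 3" if "e \<in># P" for e
    proof -
      have "e dvd 3" using dvd[OF that] co[OF P] by simp
      then show ?thesis using prime_nat_iff[of 3] by auto
    qed
    define a b where "a = count P 3" and "b = count P 1"
    have 1: "P = replicate_mset a 3 + replicate_mset b 1"
    proof (rule multiset_eqI)
      fix e show "count P e = count (replicate_mset a 3 + replicate_mset b 1) e"
        using e[of e] by (cases "e \<in># P") (auto simp: a_def b_def not_in_iff)
    qed
    obtain e1 where "e1 \<in># P" "e1 > 1" using parts[OF P] by blast
    then have "3 \<in># P" using e[of e1] by auto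
    then have 2: "a \<ge> 1" by (simp add: a_def Suc_le_eq)
    have "sum_mset P = d" using parts[OF P] by (simp add: partition_of_def)
    then have 3: "d = 3 * a + b" by (subst (asm) 1) (simp add: sum_mset_replicate_mset)
    have 4: "filter_mset (\<lambda>p. p \<noteq> 1) (image_mset (\<lambda>e. cone_order P div e) P) = replicate_mset b 3"
      unfolding co[OF P] by (subst 1) (simp add: filter_mset_replicate_mset)
    show ?thesis using 1 2 3 4 unfolding a_def b_def by blast
  qed
  have mem: "A \<in># Ps" "B \<in># Ps" "C \<in># Ps" by (simp_all add: Ps)
  note fA = form[OF mem(1)] and fB = form[OF mem(2)] and fC = form[OF mem(3)]
  have "replicate_mset (count A 1 + count B 1 + count C 1) 3 = {#3, 3, 3::nat#}"
    using total fA fB fC by (simp add: Ps replicate_mset_plus ac_simps)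
  then have "size (replicate_mset (count A 1 + count B 1 + count C 1) (3::nat)) = size {#3, 3, 3::nat#}" by simp
  then have sum: "count A 1 + count B 1 + count C 1 = 3" by simp
  have d: "d = 3 * count A 3 + count A 1" "d = 3 * count B 3 + count B 1" "d = 3 * count C 3 + count C 1"
    and pos: "count A 3 \<ge> 1" "count B 3 \<ge> 1" "count C 3 \<ge> 1"
    using fA fB fC by blast+
  have AB: "A = replicate_mset (count A 3) 3 + replicate_mset (count A 1) 1"
    "B = replicate_mset (count B 3) 3 + replicate_mset (count B 1) 1"
    "C = replicate_mset (count C 3) 3 + replicate_mset (count C 1) 1" using fA fB fC by blast+
  have cases: "count A 1 = 1 \<and> count B 1 = 1 \<and> count C 1 = 1 \<or> count A 1 = 3 \<and> count B 1 = 0 \<and> count C 1 = 0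
     \<or> count A 1 = 0 \<and> count B 1 = 3 \<and> count C 1 = 0 \<or> count A 1 = 0 \<and> count B 1 = 0 \<and> count C 1 = 3"
  proof (rule sum_3_same_residue[OF sum])
    show "count A 1 mod 3 = count B 1 mod 3" "count B 1 mod 3 = count C 1 mod 3"
      using d by (metis mod_mult_self4)+
  qed
  have r3: "replicate_mset 3 (1::nat) = {#1, 1, 1#}" by (simp add: numeral_3_eq_3)
  show ?thesis
  proof (cases "count A 1 = 1")
    case True
    then have "count B 1 = 1" "count C 1 = 1" using cases by auto
    moreover from this have "count B 3 = count A 3" "count C 3 = count A 3" using d True by linarith+
    ultimately show ?thesis
      using d(1) pos(1) AB True unfolding Ps by (intro exI[of _ "count A 3"]) auto
  next
    case False
    then consider "count A 1 = 3" "count B 1 = 0" "count C 1 = 0" | "count A 1 = 0" "count B 1 = 3" "count C 1 = 0"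
      | "count A 1 = 0" "count B 1 = 0" "count C 1 = 3" using cases by metis
    then show ?thesis
    proof cases
      case 1
      then have e: "count B 3 = count A 3 + 1" "count C 3 = count A 3 + 1" using d by linarith+
      have "A = replicate_mset (count A 3) 3 + {#1, 1, 1#}" "B = replicate_mset (count A 3 + 1) 3"
        "C = replicate_mset (count A 3 + 1) 3"
        using AB unfolding 1 e r3 by simp_all
      then show ?thesis using d(1) 1 pos(1) unfolding Ps
        by (intro exI[of _ "count A 3"]) (metis add_mset_commute)
    next
      case 2
      then have e: "count A 3 = count B 3 + 1" "count C 3 = count B 3 + 1" using d by linarith+
      have "B = replicate_mset (count B 3) 3 + {#1, 1, 1#}" "A = replicate_mset (count B 3 + 1) 3"
        "C = replicate_mset (count B 3 + 1) 3"
        using AB unfolding 2 e r3 by simp_all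
      then show ?thesis using d(2) 2 pos(2) unfolding Ps
        by (intro exI[of _ "count B 3"]) (metis add_mset_commute)
    next
      case 3
      then have e: "count A 3 = count C 3 + 1" "count B 3 = count C 3 + 1" using d by linarith+
      have "C = replicate_mset (count C 3) 3 + {#1, 1, 1#}" "A = replicate_mset (count C 3 + 1) 3"
        "B = replicate_mset (count C 3 + 1) 3"
        using AB unfolding 3 e r3 by simp_all
      then show ?thesis using d(3) 3 pos(3) unfolding Ps
        by (intro exI[of _ "count C 3"]) metis
    qed
  qed
qed

text \<open>In both families the partitions have \<open>d + 2\<close> entries together, which is the
  Riemann-Hurwitz condition for a map between spheres with three branching points.\<close>

lemma candidate_S333_iff:
  fixes X :: "'a topology" and Y :: "'b topology"
  shows "candidate_branched_cover X Y d Ps \<and>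
        same_orbifold (induced_total X Ps) S333 \<and> same_orbifold (induced_base Y Ps) S333
      \<longleftrightarrow>
      X homeomorphic_space sphere2 \<and> Y homeomorphic_space sphere2 \<and>
      (\<exists>k\<ge>1.
         d = 3 * k + 1 \<and>
           Ps = {# replicate_mset k 3 + {#1#}, replicate_mset k 3 + {#1#}, replicate_mset k 3 + {#1#} #} \<or>
         d = 3 * k + 3 \<and>
           Ps = {# replicate_mset (k + 1) 3, replicate_mset (k + 1) 3, replicate_mset k 3 + {#1, 1, 1#} #})"
    (is "?L \<longleftrightarrow> ?R")
proof
  assume ?L
  then show ?R
    using partitions_of_S333[of Ps d]
    by (auto simp: candidate_branched_cover_def same_orbifold_def S333_def induced_total_def induced_base_def)
next
  assume R: ?R
  then have X: "X homeomorphic_space sphere2" and Y: "Y homeomorphic_space sphere2" by blast+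
  note surf = closed_orientable_surface_sphere[OF X] closed_orientable_surface_sphere[OF Y]
    euler_char_sphere[OF X] euler_char_sphere[OF Y]
  obtain k :: nat where k: "k \<ge> 1"
    and cases: "d = 3 * k + 1 \<and>
           Ps = {# replicate_mset k 3 + {#1#}, replicate_mset k 3 + {#1#}, replicate_mset k 3 + {#1#} #} \<or>
         d = 3 * k + 3 \<and>
           Ps = {# replicate_mset (k + 1) 3, replicate_mset (k + 1) 3, replicate_mset k 3 + {#1, 1, 1#} #}"
    using R by blast
  have co: "cone_order (replicate_mset k 3 + {#1#}) = 3" "cone_order (replicate_mset (k + 1) 3) = 3"
    "cone_order (replicate_mset k 3 + {#1, 1, 1#}) = 3"
    using k by (auto simp: cone_order_def)
  from cases show ?L
  proof
    assume *: "d = 3 * k + 1 \<and>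
           Ps = {# replicate_mset k 3 + {#1#}, replicate_mset k 3 + {#1#}, replicate_mset k 3 + {#1#} #}"
    have "candidate_branched_cover X Y d Ps"
      unfolding candidate_branched_cover_def using surf k *
      by (auto simp: partition_of_def sum_mset_replicate_mset)
    moreover have "same_orbifold (induced_total X Ps) S333"
      using X co(1) * by (simp add: same_orbifold_def S333_def induced_total_def filter_mset_replicate_mset del: replicate_mset_Suc union_mset_add_mset_right)
    moreover have "same_orbifold (induced_base Y Ps) S333"
      using Y co(1) * by (simp add: same_orbifold_def S333_def induced_base_def del: union_mset_add_mset_right)
    ultimately show ?thesis by blast
  next
    assume *: "d = 3 * k + 3 \<and>
           Ps = {# replicate_mset (k + 1) 3, replicate_mset (k + 1) 3, replicate_mset k 3 + {#1, 1, 1#} #}"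
    have "candidate_branched_cover X Y d Ps"
      unfolding candidate_branched_cover_def using surf k *
      by (auto simp: partition_of_def sum_mset_replicate_mset)
    moreover have "same_orbifold (induced_total X Ps) S333"
      using X co(2,3) * by (simp add: same_orbifold_def S333_def induced_total_def filter_mset_replicate_mset del: replicate_mset_Suc union_mset_add_mset_right)
    moreover have "same_orbifold (induced_base Y Ps) S333"
      using Y co(2,3) * by (simp add: same_orbifold_def S333_def induced_base_def del: replicate_mset_Suc union_mset_add_mset_right)
    ultimately show ?thesis by blast
  qed
qed

section \<open>Maps induced by Eisenstein multiplication\<close>

text \<open>As \<open>omega\<close> is congruent to 1 modulo \<open>1 - omega\<close>, the residue
  of \<open>a + b * omega\<close> is that of \<open>a + b\<close>, and \<open>1 - omega\<close>
  divides 3.\<close>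

lemma Eisenstein_mod_prime:
  assumes "e \<in> Eisenstein"
  obtains s e' where "s = 0 \<or> s = 1 \<or> s = - 1" "e' \<in> Eisenstein" "e = s + (1 - omega) * e'"
proof -
  obtain a b where e: "e = eis a b" using assms by (rule EisensteinE)
  obtain s :: int where s: "s = 0 \<or> s = 1 \<or> s = - 1" "3 dvd (a + b) - s"
  proof -
    have "(a + b) mod 3 = 0 \<or> (a + b) mod 3 = 1 \<or> (a + b) mod 3 = 2" by presburger
    then have "3 dvd (a + b) - 0 \<or> 3 dvd (a + b) - 1 \<or> 3 dvd (a + b) - (- 1)" by presburger
    then show thesis using that by blast
  qed
  obtain q where q: "a + b = s + 3 * q" using s(2) by (metis add.commute diff_add_cancel dvdE)
  have "(1 - omega) * (of_int q * (1 - omega ^ 2)) = of_int q * (1 - omega - omega * omega + omega ^ 3)"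
    by (simp add: power2_eq_square power3_eq_cube algebra_simps)
  then have 3: "(1 - omega) * (of_int q * (1 - omega ^ 2)) = 3 * of_int q"
    by (simp add: omega_squared omega_cubed)
  have "e = of_int (a + b) - of_int b * (1 - omega)" by (simp add: e eis_def algebra_simps)
  also have "\<dots> = of_int s + (1 - omega) * (of_int q * (1 - omega ^ 2)) - of_int b * (1 - omega)"
    unfolding q 3 by simp
  also have "\<dots> = of_int s + (1 - omega) * (of_int q * (1 - omega ^ 2) - of_int b)"
    by (simp add: algebra_simps)
  finally have "e = of_int s + (1 - omega) * (of_int q * (1 - omega ^ 2) - of_int b)" .
  moreover have "of_int q * (1 - omega ^ 2) - of_int b \<in> Eisenstein"
    by (intro Eisenstein_diff Eisenstein_mult[of "of_int q"]) auto
  moreover have "(of_int s :: complex) = 0 \<or> (of_int s :: complex) = 1 \<or> (of_int s :: complex) = - 1"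
    using s(1) by auto
  ultimately show thesis using that by blast
qed

text \<open>Multiplication by \<open>l\<close> carries orbits of the group into orbits; the induced
  map of the quotient is a Lattes map in topological form.\<close>

locale lattes = orbifold_projection P for P +
  fixes l :: complex
  assumes l: "l \<in> Eisenstein" "l \<noteq> 0"
begin

definition lattes_map :: "complex \<times> real \<Rightarrow> complex \<times> real" where
  "lattes_map x = P (l * (SOME z. P z = x))"

text \<open>The choice of representative is immaterial because multiplication by \<open>l\<close>
  commutes with \<open>omega\<close> and preserves the lattice.\<close>

lemma lattes_map_P: "lattes_map (P z) = P (l * z)"
proof -
  define z' where "z' = (SOME z'. P z' = P z)"
  have "P z' = P z" unfolding z'_def by (rule someI[of _ z]) simp
  then obtain j where j: "j < 3" "z - omega ^ j * z' \<in> Eisenstein" using eq_iff by blast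
  have "l * z - omega ^ j * (l * z') = l * (z - omega ^ j * z')" by (simp add: algebra_simps)
  then have "l * z - omega ^ j * (l * z') \<in> Eisenstein" using Eisenstein_mult[OF l(1) j(2)] by simp
  then have "P (l * z') = P (l * z)" using eq_iff j by blast
  then show ?thesis unfolding lattes_map_def z'_def .
qed

lemma surjE: "x \<in> unit_sphere \<Longrightarrow> \<exists>z. x = P z"
  using surj by blast

text \<open>Continuity descends because \<open>P\<close>, restricted to the compact unit disc, is a
  quotient map onto the sphere.\<close>

lemma continuous_lattes_map: "continuous_on unit_sphere lattes_map"
proof -
  have contP: "continuous_on (cball 0 1) P" using cont by (rule continuous_on_subset) simp
  have quot: "quotient_map (top_of_set (cball 0 1)) S2 P"
  proof (rule T1_Spaces.continuous_imp_quotient_map)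
    show "continuous_map (top_of_set (cball 0 1)) S2 P"
      using contP in_sphere by (simp add: continuous_map_in_subtopology image_subset_iff del: mem_sphere)
    show "compact_space (top_of_set (cball 0 1 :: complex set))" by (simp add: compact_space_subtopology)
    show "Hausdorff_space S2" by (simp add: Hausdorff_space_subtopology Hausdorff_space_euclidean)
  qed (simp add: image_cball surj)
  have "continuous_on (cball 0 1) (\<lambda>z. P (l * z))"
    by (rule continuous_on_compose2[OF cont]) (auto intro: continuous_intros)
  then have "continuous_map (top_of_set (cball 0 1)) euclidean (lattes_map \<circ> P)"
    by (simp add: comp_def lattes_map_P)
  then have "continuous_map S2 euclidean lattes_map"
    using continuous_compose_quotient_map[OF quot] by blast
  then show ?thesis by simp
qed

text \<open>In the coordinates \<open>w^k\<close> at \<open>z\<close> and \<open>w^m\<close> at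
  \<open>l * z\<close>, multiplication by \<open>l\<close> sends \<open>v\<close> to
  \<open>(l^k * v)^n\<close> with \<open>m = k * n\<close>; cone points go to cone points, so
  \<open>k\<close> divides \<open>m\<close>. Scaling the source chart by \<open>l^k\<close> leaves a
  pure power.\<close>

lemma lattes_local_degree:
  "has_local_degree S2 S2 lattes_map (P z) (cone_index (l * z) div cone_index z)"
proof -
  define k m where "k = cone_index z" and "m = cone_index (l * z)"
  have "k dvd m" using cone_point_Eisenstein_mult[OF l(1), of z] by (auto simp: k_def m_def cone_index_def)
  then obtain n where n: "m = k * n" by blast
  have pos: "0 < k" "0 < m" by (simp_all add: k_def m_def)
  then have n1: "n \<ge> 1" using n by (cases n) auto
  obtain r Q Q' where r: "r > 0" and Q: "homeomorphism (cball 0 (r ^ k)) (Q ` cball 0 (r ^ k)) Q Q'"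
    and PQ: "\<And>w. cmod w \<le> r \<Longrightarrow> P (z + w) = Q (w ^ k)"
    and opQ: "\<And>U. open U \<Longrightarrow> U \<subseteq> cball 0 (r ^ k) \<Longrightarrow> openin S2 (Q ` U)"
    using chart[of z] unfolding k_def by metis
  obtain r2 Q2 Q2' where r2: "r2 > 0" and Q2: "homeomorphism (cball 0 (r2 ^ m)) (Q2 ` cball 0 (r2 ^ m)) Q2 Q2'"
    and PQ2: "\<And>w. cmod w \<le> r2 \<Longrightarrow> P (l * z + w) = Q2 (w ^ m)"
    and opQ2: "\<And>U. open U \<Longrightarrow> U \<subseteq> cball 0 (r2 ^ m) \<Longrightarrow> openin S2 (Q2 ` U)"
    using chart[of "l * z"] unfolding m_def by metis
  \<comment> \<open>Small enough that \<open>l\<close> times the disc of this radius fits into the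
    chart at \<open>l * z\<close>.\<close>
  define \<rho> where "\<rho> = min r (r2 / cmod l)"
  have \<rho>: "\<rho> > 0" "\<rho> \<le> r" "cmod l * \<rho> \<le> r2"
    using r r2 l by (auto simp: \<rho>_def min_def field_simps)
  have sub: "ball 0 (\<rho> ^ k) \<subseteq> (cball 0 (r ^ k) :: complex set)"
    using power_mono[of \<rho> r k] \<rho> by (intro subsetI) auto
  have sub2: "ball 0 (r2 ^ m) \<subseteq> (cball 0 (r2 ^ m) :: complex set)" by auto
  define U where "U = Q ` ball 0 (\<rho> ^ k)"
  define V where "V = Q2 ` ball 0 (r2 ^ m)"
  define D where "D = ball (0 :: complex) ((cmod l * \<rho>) ^ k)"
  have homU: "homeomorphism (ball 0 (\<rho> ^ k)) U Q Q'"
    using homeomorphism_of_subsets[OF Q sub] unfolding U_def by blast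
  have homV: "homeomorphism (ball 0 (r2 ^ m)) V Q2 Q2'"
    using homeomorphism_of_subsets[OF Q2 sub2] unfolding V_def by blast
  have lk: "l ^ k \<noteq> 0" using l by simp
  have hD: "homeomorphism U D (\<lambda>u. l ^ k * Q' u) (\<lambda>v. Q (v / l ^ k))"
  proof (rule homeomorphismI)
    show "continuous_on U (\<lambda>u. l ^ k * Q' u)"
      by (intro continuous_intros homeomorphism_cont2[OF homU])
    have scale: "v / l ^ k \<in> ball 0 (\<rho> ^ k)" if "v \<in> D" for v
      using that l by (simp add: D_def norm_divide norm_power power_mult_distrib field_simps)
    show "continuous_on D (\<lambda>v. Q (v / l ^ k))"
      by (rule continuous_on_compose2[OF homeomorphism_cont1[OF homU]])
        (use lk scale in \<open>auto intro!: continuous_intros\<close>)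
    have Q'im: "Q' u \<in> ball 0 (\<rho> ^ k)" if "u \<in> U" for u
      using homeomorphism_image2[OF homU] that by blast
    show "(\<lambda>u. l ^ k * Q' u) ` U \<subseteq> D"
    proof (rule image_subsetI)
      fix u assume "u \<in> U"
      then have "cmod (Q' u) < \<rho> ^ k" using Q'im by simp
      then show "l ^ k * Q' u \<in> D" using l by (simp add: D_def norm_mult norm_power power_mult_distrib)
    qed
    show "(\<lambda>v. Q (v / l ^ k)) ` D \<subseteq> U" using scale by (auto simp: U_def)
    show "Q (l ^ k * Q' u / l ^ k) = u" if "u \<in> U" for u
      using homeomorphism_apply2[OF homU that] lk by simp
    show "l ^ k * Q' (Q (v / l ^ k)) = v" if "v \<in> D" for v
      using homeomorphism_apply1[OF homU scale[OF that]] lk by simp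
  qed
  have opU: "openin S2 U" unfolding U_def by (rule opQ[OF open_ball sub])
  have opV: "openin S2 V" unfolding V_def by (rule opQ2[OF open_ball sub2])
  have sU: "subtopology S2 U = top_of_set U" "subtopology S2 V = top_of_set V"
    using opU opV by (auto simp: subtopology_subtopology Int_absorb1 dest: openin_imp_subset)
  have main: "lattes_map u \<in> V \<and> Q2' (lattes_map u) = (l ^ k * Q' u) ^ n" if u: "u \<in> U" for u
  proof -
    obtain v where v: "v \<in> ball 0 (\<rho> ^ k)" "u = Q v" using u by (auto simp: U_def)
    obtain w where w: "w \<in> ball 0 \<rho>" "w ^ k = v" using complex_root_in_ball[OF v(1) pos(1) \<rho>(1)] .
    have "u = P (z + w)" using PQ[of w] v w \<rho> by auto
    then have fu: "lattes_map u = P (l * z + l * w)" by (simp add: lattes_map_P distrib_left)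
    have "cmod (l * w) < cmod l * \<rho>" using w l by (simp add: norm_mult)
    then have lw: "cmod (l * w) < r2" using \<rho>(3) by linarith
    then have fu2: "lattes_map u = Q2 ((l * w) ^ m)" using fu PQ2[of "l * w"] by simp
    have "cmod ((l * w) ^ m) < r2 ^ m"
      unfolding norm_power using lw pos by (intro power_strict_mono) auto
    then have inb: "(l * w) ^ m \<in> ball 0 (r2 ^ m)" by simp
    have "Q2' (lattes_map u) = (l * w) ^ m" unfolding fu2 by (rule homeomorphism_apply1[OF homV inb])
    also have "\<dots> = (l ^ k * w ^ k) ^ n" by (simp add: n power_mult power_mult_distrib)
    also have "w ^ k = Q' u" unfolding v(2) w(2) by (rule homeomorphism_apply1[OF homU v(1), symmetric])
    finally show ?thesis using fu2 inb by (simp add: V_def)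
  qed
  have Pz: "P z = Q 0" using PQ[of 0] r pos by (simp add: power_0_left)
  have P0: "P z \<in> U" unfolding Pz U_def using \<rho> by auto
  have Q'0: "Q' (P z) = 0" unfolding Pz by (rule homeomorphism_apply1[OF homU]) (use \<rho> in simp)
  have "has_local_degree S2 S2 lattes_map (P z) n"
    unfolding has_local_degree_def
  proof (intro conjI exI)
    show "homeomorphic_map (subtopology S2 U) (top_of_set D) (\<lambda>u. l ^ k * Q' u)"
      unfolding sU homeomorphic_map_maps using hD homeomorphism_iff_homeomorphic_maps by blast
    show "homeomorphic_map (subtopology S2 V) (top_of_set (ball 0 (r2 ^ m))) Q2'"
      unfolding sU homeomorphic_map_maps
      using homV homeomorphism_iff_homeomorphic_maps homeomorphism_sym by blast
    show "openin S2 U" "openin S2 V" "P z \<in> U" by (fact opU opV P0)+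
    show "lattes_map ` U \<subseteq> V" "\<forall>u\<in>U. Q2' (lattes_map u) = (l ^ k * Q' u) ^ n" using main by blast+
    show "l ^ k * Q' (P z) = 0" by (simp add: Q'0)
    show "Q2' (lattes_map (P z)) = 0" using main[OF P0] Q'0 n1 by simp
  qed (use n1 D_def in auto)
  moreover have "n = cone_index (l * z) div cone_index z"
    using n pos unfolding k_def m_def by simp
  ultimately show ?thesis by simp
qed

lemma branched_cover_lattes_map: "branched_cover S2 S2 lattes_map"
  unfolding branched_cover_def
proof (intro conjI ballI)
  have "S2 homeomorphic_space sphere2"
    using nsphere2_homeomorphic_unit_sphere homeomorphic_space_sym by blast
  then show "closed_orientable_surface S2" "closed_orientable_surface S2"
    by (simp_all add: closed_orientable_surface_sphere)
  have "lattes_map ` unit_sphere \<subseteq> unit_sphere" unfolding lattes_map_def using in_sphere by blast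
  then show "continuous_map S2 S2 lattes_map"
    using continuous_lattes_map by (simp add: continuous_map_in_subtopology image_subset_iff del: mem_sphere)
  fix x assume "x \<in> topspace S2"
  then obtain z where "x = P z" using surjE[of x] by auto
  then show "\<exists>k. has_local_degree S2 S2 lattes_map x k" using lattes_local_degree by blast
qed

section \<open>Fibres of the induced map and their partitions\<close>

lemma local_degree_lattes_map:
  "local_degree S2 S2 lattes_map (P z) = cone_index (l * z) div cone_index z"
  using lattes_local_degree by (rule local_degree_eq)

text \<open>\<open>A\<close> represents the solutions of \<open>l * z = q\<close> on the torus, so
  its size is the index of the multiples of \<open>l\<close>. A point over the orbit of
  \<open>q\<close> can be rotated until it solves the equation for \<open>q\<close> itself.\<close>

lemma fibre_lattes_map:
  obtains A where "finite A" "of_nat (card A) = (cmod l)\<^sup>2" "fibre S2 lattes_map (P q) = P ` A"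
    "\<forall>z. l * z - q \<in> Eisenstein \<longrightarrow> (\<exists>!a. a \<in> A \<and> z - a \<in> Eisenstein)"
    "\<forall>a\<in>A. l * a - q \<in> Eisenstein"
proof -
  obtain R where R: "finite R" "R \<subseteq> Eisenstein" "of_nat (card R) = (cmod l)\<^sup>2"
    "\<And>t. t \<in> Eisenstein \<Longrightarrow> \<exists>!r. r \<in> R \<and> (\<exists>e\<in>Eisenstein. t = r + l * e)"
    using Eisenstein_residues[OF l] by metis
  define A where "A = (\<lambda>r. (q + r) / l) ` R"
  have "inj_on (\<lambda>r. (q + r) / l) R" using l by (auto simp: inj_on_def)
  then have card: "card A = card R" unfolding A_def by (rule card_image)
  have A_in: "l * a - q \<in> Eisenstein" if "a \<in> A" for a using that R(2) l by (auto simp: A_def)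
  have A_unique: "\<exists>!a. a \<in> A \<and> z - a \<in> Eisenstein" if z: "l * z - q \<in> Eisenstein" for z
  proof -
    have "(r \<in> R \<and> (\<exists>e\<in>Eisenstein. l * z - q = r + l * e)) \<longleftrightarrow> r \<in> R \<and> z - (q + r) / l \<in> Eisenstein" for r
    proof -
      have "l * z - q = r + l * e \<longleftrightarrow> z - (q + r) / l = e" for e
        using l by (auto simp: field_simps)
      then show ?thesis by auto
    qed
    then have "\<exists>!r. r \<in> R \<and> z - (q + r) / l \<in> Eisenstein" using R(4)[OF z] by simp
    then show ?thesis unfolding A_def by blast
  qed
  have "fibre S2 lattes_map (P q) = P ` A"
  proof (intro equalityI subsetI)
    fix x assume x: "x \<in> fibre S2 lattes_map (P q)"
    then obtain z where z: "x = P z" using surjE[of x] by (auto simp: fibre_def)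
    then have "P q = P (l * z)" using x lattes_map_P by (simp add: fibre_def)
    then obtain j where j: "j < 3" "l * z - omega ^ j * q \<in> Eisenstein" using eq_iff by blast
    have inv: "omega ^ (3 - j) * omega ^ j = 1" using j omega_cubed by (simp flip: power_add)
    have "l * (omega ^ (3 - j) * z) - q = l * (omega ^ (3 - j) * z) - (omega ^ (3 - j) * omega ^ j) * q"
      by (simp add: inv)
    also have "\<dots> = omega ^ (3 - j) * (l * z - omega ^ j * q)" by (simp add: algebra_simps)
    finally have "l * (omega ^ (3 - j) * z) - q \<in> Eisenstein"
      using Eisenstein_mult[OF Eisenstein_power[OF omega_in] j(2)] by simp
    then obtain a where a: "a \<in> A" "omega ^ (3 - j) * z - a \<in> Eisenstein" using A_unique by blast
    have "P a = P (a + (omega ^ (3 - j) * z - a))" using translate[OF a(2), of a] by simp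
    also have "\<dots> = P z" using rotate by simp
    finally have "x = P a" using z by simp
    then show "x \<in> P ` A" using a(1) by (rule image_eqI)
  next
    fix x assume "x \<in> P ` A"
    then obtain a where a: "a \<in> A" "x = P a" by blast
    have "P (l * a) = P q" using translate[OF A_in[OF a(1)], of q] by simp
    then show "x \<in> fibre S2 lattes_map (P q)"
      using a in_sphere[of a] lattes_map_P by (simp add: fibre_def)
  qed
  moreover have "finite A" using R(1) by (simp add: A_def)
  ultimately show thesis using that[of A] R(3) card A_unique A_in by simp
qed

text \<open>Away from cone values no nontrivial rotation identifies two elements of
  \<open>A\<close>, since it would fix \<open>q\<close> modulo the lattice and make it a cone point.
  So the fibre is as large as \<open>A\<close>.\<close>

lemma has_degree_lattes_map:
  assumes d: "of_nat d = (cmod l)\<^sup>2" and branch: "\<And>q. cone_point q \<Longrightarrow> P q \<in> branching_points S2 S2 lattes_map"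
  shows "has_degree S2 S2 lattes_map d"
  unfolding has_degree_def
proof (intro conjI ballI)
  show "1 \<le> d"
  proof (rule ccontr)
    assume "\<not> 1 \<le> d"
    then have "d = 0" by simp
    then show False using d l by simp
  qed
  fix y assume y: "y \<in> topspace S2 - branching_points S2 S2 lattes_map"
  then obtain q where q: "y = P q" using surjE[of y] by auto
  then have nc: "\<not> cone_point q" using y branch by blast
  obtain A where A: "finite A" "of_nat (card A) = (cmod l)\<^sup>2" "fibre S2 lattes_map (P q) = P ` A"
    "\<forall>z. l * z - q \<in> Eisenstein \<longrightarrow> (\<exists>!a. a \<in> A \<and> z - a \<in> Eisenstein)"
    "\<forall>a\<in>A. l * a - q \<in> Eisenstein"
    by (rule fibre_lattes_map[of q], rule that)
  note A4 = A(4)[rule_format] and A5 = A(5)[rule_format]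
  have "inj_on P A"
  proof (rule inj_onI)
    fix a b assume ab: "a \<in> A" "b \<in> A" "P a = P b"
    then obtain j where j: "j < 3" "b - omega ^ j * a \<in> Eisenstein" using eq_iff by blast
    have "(1 - omega ^ j) * q = l * (b - omega ^ j * a) - (l * b - q) + omega ^ j * (l * a - q)"
      by (simp add: algebra_simps)
    moreover have "l * (b - omega ^ j * a) - (l * b - q) + omega ^ j * (l * a - q) \<in> Eisenstein"
      by (intro Eisenstein_add[OF Eisenstein_diff[OF Eisenstein_mult[OF l(1) j(2)] A5[OF ab(2)]]]
          Eisenstein_mult[OF Eisenstein_power[OF omega_in] A5[OF ab(1)]])
    ultimately have "j = 0" using cone_point_power_diff[OF j(1)] nc by metis
    then have "b - a \<in> Eisenstein" "b - b \<in> Eisenstein" using j by simp_all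
    then show "a = b" using A4[OF A5[OF ab(2)]] ab by blast
  qed
  then have "card (fibre S2 lattes_map y) = card A" unfolding q A(3) by (rule card_image)
  then show "card (fibre S2 lattes_map y) = d" using A(2) d by (metis of_nat_eq_iff)
qed

text \<open>The \<open>d\<close> torus solutions fall into classes under rotation. A cone point
  stands alone and has local degree \<open>3 div 3\<close>; any other solution lies in a class of
  three and has local degree \<open>3 div 1\<close>.\<close>

lemma cone_fibre:
  assumes d: "of_nat d = (cmod l)\<^sup>2" and q: "cone_point q"
  obtains n where "local_degrees S2 S2 lattes_map (P q)
      = replicate_mset n 3 + replicate_mset (card {x \<in> fibre S2 lattes_map (P q). x \<in> P ` {z. cone_point z}}) 1"
    "3 * n + card {x \<in> fibre S2 lattes_map (P q). x \<in> P ` {z. cone_point z}} = d"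
    "finite (fibre S2 lattes_map (P q))"
proof -
  obtain A where A: "finite A" "of_nat (card A) = (cmod l)\<^sup>2" "fibre S2 lattes_map (P q) = P ` A"
    "\<forall>z. l * z - q \<in> Eisenstein \<longrightarrow> (\<exists>!a. a \<in> A \<and> z - a \<in> Eisenstein)"
    "\<forall>a\<in>A. l * a - q \<in> Eisenstein"
    by (rule fibre_lattes_map[of q], rule that)
  note A4 = A(4)[rule_format] and A5 = A(5)[rule_format]
  have cardA: "card A = d" using A(2) d by (metis of_nat_eq_iff)
  define F where "F = P ` A"
  define F1 where "F1 = {x \<in> F. x \<in> P ` {z. cone_point z}}"
  define F3 where "F3 = F - F1"
  have fin: "finite F" "finite F1" "finite F3" using A by (auto simp: F_def F1_def F3_def)
  have A_eq: "a = b" if "a \<in> A" "b \<in> A" "b - a \<in> Eisenstein" for a b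
  proof -
    have "b - b \<in> Eisenstein" by simp
    then show ?thesis using A4[OF A5[OF that(2)]] that by blast
  qed
  have F1_iff: "P z \<in> F1 \<longleftrightarrow> cone_point z" if "P z \<in> F" for z
  proof
    assume "P z \<in> F1"
    then obtain c where c: "cone_point c" "P z = P c" by (auto simp: F1_def)
    show "cone_point z" by (rule cone_point_cong[OF c(2)[symmetric] c(1)])
  qed (use that in \<open>auto simp: F1_def\<close>)
  have lcone: "cone_point (l * a)" if "a \<in> A" for a
  proof -
    have "P (l * a) = P q" using translate[OF A5[OF that], of q] by simp
    then show ?thesis using cone_point_cong q by metis
  qed
  have deg1: "local_degree S2 S2 lattes_map x = 1" if x: "x \<in> F1" for x
  proof -
    obtain a where a: "a \<in> A" "x = P a" using x by (auto simp: F1_def F_def)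
    then have "cone_point a" using x F1_iff by (auto simp: F_def)
    then show ?thesis using lcone[OF a(1)] a by (simp add: local_degree_lattes_map cone_index_def)
  qed
  have deg3: "local_degree S2 S2 lattes_map x = 3" if x: "x \<in> F3" for x
  proof -
    obtain a where a: "a \<in> A" "x = P a" using x by (auto simp: F3_def F_def)
    then have "\<not> cone_point a" using x F1_iff by (auto simp: F_def F3_def)
    then show ?thesis using lcone[OF a(1)] a by (simp add: local_degree_lattes_map cone_index_def)
  qed
  have card1: "card {a \<in> A. P a = x} = 1" if x: "x \<in> F1" for x
  proof -
    obtain a where a: "a \<in> A" "x = P a" using x by (auto simp: F1_def F_def)
    then have "cone_point a" using x F1_iff by (auto simp: F_def)
    have "b = a" if b: "b \<in> A" "P b = x" for b
    proof -
      have "P a = P b" using a b by simp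
      then have "b - a \<in> Eisenstein" using eq_cone_point_iff[OF \<open>cone_point a\<close>] by blast
      then show ?thesis using A_eq[OF a(1) b(1)] by simp
    qed
    then have "{b \<in> A. P b = x} = {a}" using a by blast
    then show ?thesis by simp
  qed
  have card3: "card {a \<in> A. P a = x} = 3" if x: "x \<in> F3" for x
  proof -
    obtain a where a: "a \<in> A" "x = P a" using x by (auto simp: F3_def F_def)
    then have nc: "\<not> cone_point a" using x F1_iff by (auto simp: F_def F3_def)
    \<comment> \<open>Since \<open>q\<close> is a cone point, a rotated solution is again a solution
      modulo the lattice.\<close>
    have "\<exists>!b. b \<in> A \<and> omega ^ j * a - b \<in> Eisenstein" for j
    proof (rule A4)
      have "l * (omega ^ j * a) - q = omega ^ j * (l * a - q) - (1 - omega ^ j) * q" by (simp add: algebra_simps)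
      then show "l * (omega ^ j * a) - q \<in> Eisenstein"
        using Eisenstein_diff[OF Eisenstein_mult[OF Eisenstein_power[OF omega_in] A5[OF a(1)]]
            cone_point_power_diff_in[OF q]] by metis
    qed
    then obtain \<rho> where \<rho>: "\<And>j::nat. \<rho> j \<in> A \<and> omega ^ j * a - \<rho> j \<in> Eisenstein" by metis
    have inj: "inj_on \<rho> {..<3}"
    proof -
      have "\<not> i < j" if ij: "j < 3" "\<rho> i = \<rho> j" for i j
      proof
        assume "i < j"
        have "(omega ^ i * a - \<rho> i) - (omega ^ j * a - \<rho> j) \<in> Eisenstein" using \<rho> by blast
        then have e: "omega ^ i * a - omega ^ j * a \<in> Eisenstein" using ij by simp
        have inv: "omega ^ (3 - i) * omega ^ i = 1" using ij \<open>i < j\<close> omega_cubed by (simp flip: power_add)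
        have "omega ^ j = omega ^ i * omega ^ (j - i)" using \<open>i < j\<close> by (simp flip: power_add)
        then have "omega ^ (3 - i) * (omega ^ i * a - omega ^ j * a)
            = (omega ^ (3 - i) * omega ^ i) * ((1 - omega ^ (j - i)) * a)"
          by (simp only: left_diff_distrib right_diff_distrib mult_1_left mult.assoc)
        then have "omega ^ (3 - i) * (omega ^ i * a - omega ^ j * a) = (1 - omega ^ (j - i)) * a"
          unfolding inv by simp
        then have "(1 - omega ^ (j - i)) * a \<in> Eisenstein"
          using Eisenstein_mult[OF Eisenstein_power[OF omega_in] e] by metis
        then show False using cone_point_power_diff[of "j - i" a] less_imp_diff_less[OF ij(1), of i] \<open>i < j\<close> nc by simp
      qed
      then show ?thesis by (intro inj_onI) (metis lessThan_iff nat_neq_iff)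
    qed
    have "{b \<in> A. P b = x} = \<rho> ` {..<3}"
    proof (intro equalityI subsetI)
      fix b assume "b \<in> {b \<in> A. P b = x}"
      then have b: "b \<in> A" "P a = P b" using a by auto
      then obtain j where j: "j < 3" "b - omega ^ j * a \<in> Eisenstein" using eq_iff by blast
      then have "(b - omega ^ j * a) + (omega ^ j * a - \<rho> j) \<in> Eisenstein" using \<rho> by blast
      then have "b - \<rho> j \<in> Eisenstein" by simp
      then have "\<rho> j = b" using A_eq \<rho> b by blast
      then show "b \<in> \<rho> ` {..<3}" using j by blast
    next
      fix b assume "b \<in> \<rho> ` {..<3}"
      then obtain j where j: "b = \<rho> j" by blast
      have "P b = P (b + (omega ^ j * a - b))" using translate \<rho> j by metis
      then have "P b = x" using rotate a by simp
      then show "b \<in> {b \<in> A. P b = x}" using \<rho> j by blast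
    qed
    then show ?thesis using inj by (simp add: card_image)
  qed
  have FU: "F = F3 \<union> F1" "F3 \<inter> F1 = {}" by (auto simp: F3_def F1_def)
  have "card A = (\<Sum>x\<in>F. card {a \<in> A. P a = x})"
    using sum.group[OF A(1) fin(1), of P "\<lambda>_. 1::nat"] by (simp add: F_def)
  also have "\<dots> = 3 * card F3 + card F1"
    unfolding FU(1) using fin FU(2) card1 card3 by (simp add: sum.union_disjoint)
  finally have count: "3 * card F3 + card F1 = d" using cardA by simp
  have "local_degrees S2 S2 lattes_map (P q) = image_mset (local_degree S2 S2 lattes_map) (mset_set F3 + mset_set F1)"
    unfolding local_degrees_def A(3) F_def[symmetric] using fin FU by (metis mset_set_Union)
  also have "\<dots> = image_mset (\<lambda>_. 3) (mset_set F3) + image_mset (\<lambda>_. 1) (mset_set F1)"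
    unfolding image_mset_union
    by (intro arg_cong2[where f = "(+)"] image_mset_cong) (use fin deg1 deg3 in auto)
  also have "\<dots> = replicate_mset (card F3) 3 + replicate_mset (card F1) 1"
    by (simp add: image_mset_const_eq)
  finally show thesis
    using that[of "card F3"] count fin(1) unfolding F1_def F_def A(3) by blast
qed

text \<open>Up to the factor \<open>kappa\<close>, cone points modulo the lattice are residues
  modulo \<open>1 - omega\<close>, represented by 0, 1 and -1.\<close>

lemma cone_images: "P ` {z. cone_point z} = {P 0, P kappa, P (- kappa)}"
proof (intro equalityI subsetI)
  fix x assume "x \<in> P ` {z. cone_point z}"
  then obtain z where z: "cone_point z" "x = P z" by blast
  then obtain s e where s: "s = 0 \<or> s = 1 \<or> s = - 1" and e: "e \<in> Eisenstein" "(1 - omega) * z = s + (1 - omega) * e"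
    using Eisenstein_mod_prime unfolding cone_point_def by metis
  have "z = ((1 - omega) * kappa) * z" by simp
  also have "\<dots> = kappa * ((1 - omega) * z)" by (simp only: mult_ac)
  also have "\<dots> = kappa * s + ((1 - omega) * kappa) * e" unfolding e(2) by (simp only: distrib_left mult_ac)
  finally have "z = kappa * s + e" by simp
  then have "P z = P (kappa * s)" using translate[OF e(1)] by simp
  then show "x \<in> {P 0, P kappa, P (- kappa)}" using z s by auto
qed auto

text \<open>A quotient of cone indices above 1 forces \<open>l * z\<close> to be a cone point; the
  assumption provides the converse.\<close>

lemma branching_points_lattes_map:
  assumes "\<And>q. cone_point q \<Longrightarrow> 3 \<in># local_degrees S2 S2 lattes_map (P q)"
  shows "branching_points S2 S2 lattes_map = {P 0, P kappa, P (- kappa)}"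
proof (intro equalityI subsetI)
  fix y assume "y \<in> branching_points S2 S2 lattes_map"
  then obtain x where y: "y \<in> unit_sphere" and x: "x \<in> fibre S2 lattes_map y" "local_degree S2 S2 lattes_map x > 1"
    by (auto simp: branching_points_def)
  obtain z where z: "x = P z" using x(1) surjE[of x] by (auto simp: fibre_def)
  have "cone_index (l * z) div cone_index z > 1" using x(2) unfolding z local_degree_lattes_map .
  then have "cone_point (l * z)" by (auto simp: cone_index_def split: if_splits)
  moreover have "y = P (l * z)" using x(1) z lattes_map_P by (simp add: fibre_def)
  ultimately show "y \<in> {P 0, P kappa, P (- kappa)}" using cone_images by blast
next
  fix y assume "y \<in> {P 0, P kappa, P (- kappa)}"
  then obtain q where q: "cone_point q" "y = P q" using cone_images by blast
  have "3 \<in># image_mset (local_degree S2 S2 lattes_map) (mset_set (fibre S2 lattes_map y))"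
    using assms[OF q(1)] q(2) by (simp add: local_degrees_def)
  then obtain x where x: "x \<in># mset_set (fibre S2 lattes_map y)" "local_degree S2 S2 lattes_map x = 3" by auto
  then have "x \<in> fibre S2 lattes_map y"
    by (metis elem_mset_set empty_iff mset_set.infinite set_mset_empty)
  moreover have "local_degree S2 S2 lattes_map x > 1" using x(2) by simp
  ultimately show "y \<in> branching_points S2 S2 lattes_map"
    using q in_sphere[of q] by (auto simp: branching_points_def)
qed

lemma realizable_lattes_map:
  assumes d: "of_nat d = (cmod l)\<^sup>2"
    and deg: "local_degrees S2 S2 lattes_map (P 0) = p0" "local_degrees S2 S2 lattes_map (P kappa) = p1"
      "local_degrees S2 S2 lattes_map (P (- kappa)) = p2"
    and three: "3 \<in># p0" "3 \<in># p1" "3 \<in># p2"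
  shows "realizable S2 S2 d {#p0, p1, p2#}"
proof -
  have mem: "3 \<in># local_degrees S2 S2 lattes_map (P q)" if q: "cone_point q" for q
  proof -
    have "P q \<in> {P 0, P kappa, P (- kappa)}" using cone_images q by blast
    then show ?thesis using deg three by auto
  qed
  have B: "branching_points S2 S2 lattes_map = {P 0, P kappa, P (- kappa)}"
    by (rule branching_points_lattes_map) (rule mem)
  have "has_degree S2 S2 lattes_map d"
    using d by (rule has_degree_lattes_map) (use B cone_images in blast)
  moreover have "image_mset (local_degrees S2 S2 lattes_map) (mset_set (branching_points S2 S2 lattes_map)) = {#p0, p1, p2#}"
    unfolding B using cone_images_distinct by (simp add: deg)
  moreover have "finite (branching_points S2 S2 lattes_map)" unfolding B by simp
  ultimately show ?thesis
    unfolding realizable_def using branched_cover_lattes_map by blast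
qed

lemma cone_fibre_points:
  "{x \<in> fibre S2 lattes_map y. x \<in> P ` {z. cone_point z}}
    = {x \<in> {P 0, P kappa, P (- kappa)}. lattes_map x = y}"
  unfolding cone_images using in_sphere by (auto simp: fibre_def)

text \<open>A degree prime to 3 makes \<open>l\<close> congruent to 1 or -1 modulo
  \<open>1 - omega\<close>. The map then permutes the three cone images, and each cone fibre
  contains exactly one of them.\<close>

lemma realizable_unramified_at_cone_points:
  assumes d: "of_nat d = (cmod l)\<^sup>2" "d = 3 * k + 1" "k \<ge> 1"
  shows "realizable S2 S2 d {# replicate_mset k 3 + {#1#}, replicate_mset k 3 + {#1#}, replicate_mset k 3 + {#1#} #}"
proof -
  obtain s e where s: "s = 0 \<or> s = 1 \<or> s = - 1" and e: "e \<in> Eisenstein" "l = s + (1 - omega) * e"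
    using Eisenstein_mod_prime[OF l(1)] by metis
  \<comment> \<open>If \<open>1 - omega\<close> divided \<open>l\<close>, its norm 3 would divide
    \<open>d\<close>.\<close>
  have "s \<noteq> 0"
  proof
    assume "s = 0"
    then have "(cmod l)\<^sup>2 = 3 * (cmod e)\<^sup>2" unfolding e(2) by (simp add: norm_mult power_mult_distrib norm_one_minus_omega)
    moreover obtain a b where "e = eis a b" using e(1) by (rule EisensteinE)
    ultimately have "real_of_int (int d) = real_of_int (3 * (a\<^sup>2 - a * b + b\<^sup>2))"
      using d(1) norm_eis[of a b] by simp
    then have "int d = 3 * (a\<^sup>2 - a * b + b\<^sup>2)" by (metis of_int_eq_iff)
    then show False using d(2) by presburger
  qed
  then have s: "s = 1 \<or> s = - 1" using s by blast
  have "l * kappa = s * kappa + ((1 - omega) * kappa) * e" unfolding e(2) by (simp only: distrib_right distrib_left mult_ac)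
  then have lk: "l * kappa = s * kappa + e" by simp
  then have lk': "l * - kappa = - (s * kappa) + (- e)" by simp
  have f: "lattes_map (P 0) = P 0" "lattes_map (P kappa) = P (s * kappa)" "lattes_map (P (- kappa)) = P (- (s * kappa))"
    unfolding lattes_map_P lk lk' using translate[OF e(1)] translate[OF Eisenstein_minus[OF e(1)]] by simp_all
  have card1: "card {x \<in> {P 0, P kappa, P (- kappa)}. lattes_map x = P q} = 1" if "q = 0 \<or> q = kappa \<or> q = - kappa" for q
  proof -
    have "{x \<in> {P 0, P kappa, P (- kappa)}. lattes_map x = P q} = {P (s * q)}"
      using that s f cone_images_distinct by auto
    then show ?thesis by simp
  qed
  have ld: "local_degrees S2 S2 lattes_map (P q) = replicate_mset k 3 + {#1#}"
    if q: "q = 0 \<or> q = kappa \<or> q = - kappa" for q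
  proof -
    have "cone_point q" using q by auto
    then obtain n where n: "local_degrees S2 S2 lattes_map (P q) = replicate_mset n 3 + replicate_mset 1 1" "3 * n + 1 = d"
      using cone_fibre[OF d(1), of q] unfolding cone_fibre_points card1[OF q] by metis
    moreover have "n = k" using n(2) d(2) by simp
    ultimately show ?thesis by simp
  qed
  show ?thesis by (rule realizable_lattes_map[OF d(1) ld ld ld]) (use d(3) in auto)
qed

text \<open>Here \<open>l * kappa\<close> is a lattice point, so all three cone images lie over
  \<open>P 0\<close> and none over the other two cone values.\<close>

lemma realizable_ramified_at_cone_points:
  assumes d: "of_nat d = (cmod l)\<^sup>2" "d = 3 * k + 3" "k \<ge> 1" and m: "m \<in> Eisenstein" "l = (1 - omega) * m"
  shows "realizable S2 S2 d {# replicate_mset (k + 1) 3, replicate_mset (k + 1) 3, replicate_mset k 3 + {#1, 1, 1#} #}"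
proof -
  have "l * kappa = ((1 - omega) * kappa) * m" unfolding m(2) by (simp only: mult_ac)
  then have lk: "l * kappa = 0 + m" by simp
  then have lk': "l * - kappa = 0 + (- m)" by simp
  have f: "lattes_map (P 0) = P 0" "lattes_map (P kappa) = P 0" "lattes_map (P (- kappa)) = P 0"
    unfolding lattes_map_P lk lk' using translate[OF m(1), of 0] translate[OF Eisenstein_minus[OF m(1)], of 0] by simp_all
  have c0: "{x \<in> {P 0, P kappa, P (- kappa)}. lattes_map x = P 0} = {P 0, P kappa, P (- kappa)}" using f by auto
  have c1: "{x \<in> {P 0, P kappa, P (- kappa)}. lattes_map x = P q} = {}" if "q = kappa \<or> q = - kappa" for q
    using f that cone_images_distinct by auto
  have card0: "card {P 0, P kappa, P (- kappa)} = 3" using cone_images_distinct by simp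
  obtain n where n: "local_degrees S2 S2 lattes_map (P 0) = replicate_mset n 3 + replicate_mset 3 1" "3 * n + 3 = d"
    using cone_fibre[OF d(1) cone_point_0] unfolding cone_fibre_points c0 card0 by metis
  then have "n = k" using d(2) by simp
  then have ld0: "local_degrees S2 S2 lattes_map (P 0) = replicate_mset k 3 + {#1, 1, 1#}"
    using n(1) by (simp add: numeral_3_eq_3)
  have ld1: "local_degrees S2 S2 lattes_map (P q) = replicate_mset (k + 1) 3" if q: "q = kappa \<or> q = - kappa" for q
  proof -
    have "cone_point q" using q by auto
    then obtain n where n: "local_degrees S2 S2 lattes_map (P q) = replicate_mset n 3 + replicate_mset 0 1" "3 * n + 0 = d"
      using cone_fibre[OF d(1), of q] unfolding cone_fibre_points c1[OF q] card.empty by metis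
    moreover have "n = k + 1" using n(2) d(2) by simp
    ultimately show ?thesis by simp
  qed
  have "realizable S2 S2 d {# replicate_mset k 3 + {#1, 1, 1#}, replicate_mset (k + 1) 3, replicate_mset (k + 1) 3 #}"
    by (rule realizable_lattes_map[OF d(1) ld0 ld1 ld1]) (use d(3) in auto)
  then show ?thesis by (metis add_mset_commute)
qed

end

section \<open>Realizability\<close>

lemma realizable_sphere_iff:
  assumes "X homeomorphic_space sphere2" "Y homeomorphic_space sphere2"
  shows "realizable X Y d Ps \<longleftrightarrow> realizable S2 S2 d Ps"
proof -
  have S: "S2 homeomorphic_space sphere2"
    using nsphere2_homeomorphic_unit_sphere homeomorphic_space_sym by blast
  have X: "X homeomorphic_space S2" and Y: "Y homeomorphic_space S2"
    using assms nsphere2_homeomorphic_unit_sphere homeomorphic_space_trans by blast+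
  note surf = assms[THEN closed_orientable_surface_sphere] closed_orientable_surface_sphere[OF S]
  show ?thesis
    using realizable_transport[of X Y d Ps, OF _ X Y surf(3) surf(3)]
      realizable_transport[of _ _ d Ps X Y, OF _ X[unfolded homeomorphic_space_sym[of X]] Y[unfolded homeomorphic_space_sym[of Y]] surf(1,2)]
    by blast
qed

text \<open>The norm gives the form, and \<open>d\<close> being 1 modulo 3 excludes congruent
  arguments. Conversely \<open>x - y * omega\<close> has norm
  \<open>x^2 + x y + y^2\<close>.\<close>

lemma realizable_3k1_iff:
  assumes k: "k \<ge> 1" and d: "d = 3 * k + 1"
  shows "realizable S2 S2 d
      {# replicate_mset k 3 + {#1#}, replicate_mset k 3 + {#1#}, replicate_mset k 3 + {#1#} #}
    \<longleftrightarrow> (\<exists>x y :: nat. d = x\<^sup>2 + x * y + y\<^sup>2 \<and> \<not> [x = y] (mod 3))"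
    (is "realizable ?S ?S d ?Ps \<longleftrightarrow> ?R")
proof
  assume "realizable ?S ?S d ?Ps"
  then have "\<exists>a b. int d = a\<^sup>2 - a * b + b\<^sup>2"
    by (rule realizable_sphere_imp_norm[where ?p1.0 = "replicate_mset k 3 + {#1#}"]) (auto split: if_splits)
  then obtain x y :: nat where xy: "d = x\<^sup>2 + x * y + y\<^sup>2" using norm_form_nonneg by blast
  have "\<not> [d = 0] (mod 3)" unfolding d cong_def by simp
  then show ?R using xy norm_form_mod_3(1)[of x y] by blast
next
  assume ?R
  then obtain x y :: nat where xy: "d = x\<^sup>2 + x * y + y\<^sup>2" by blast
  define l where "l = eis (int x) (- int y)"
  have n: "of_nat d = (cmod l)\<^sup>2" unfolding l_def norm_eis xy by simp
  have "l \<noteq> 0" using n d by auto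
  then interpret lattes triangle_projection l by unfold_locales (simp_all add: l_def)
  show "realizable ?S ?S d ?Ps" by (rule realizable_unramified_at_cone_points[OF n d k])
qed

text \<open>Divisibility of \<open>d\<close> by 3 forces congruent arguments, which allows the
  rewriting of the form. Conversely \<open>(x + y) - y * omega\<close> has norm
  \<open>x^2 + 3 x y + 3 y^2\<close>, and the factor \<open>1 - omega\<close> supplies the
  3.\<close>

lemma realizable_3k3_iff:
  assumes k: "k \<ge> 1" and d: "d = 3 * k + 3"
  shows "realizable S2 S2 d
      {# replicate_mset (k + 1) 3, replicate_mset (k + 1) 3, replicate_mset k 3 + {#1, 1, 1#} #}
    \<longleftrightarrow> (\<exists>x y :: nat. d = 3 * (x\<^sup>2 + 3 * x * y + 3 * y\<^sup>2))"
    (is "realizable ?S ?S d ?Ps \<longleftrightarrow> ?R")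
proof
  assume "realizable ?S ?S d ?Ps"
  then have "\<exists>a b. int d = a\<^sup>2 - a * b + b\<^sup>2"
    by (rule realizable_sphere_imp_norm[where ?p1.0 = "replicate_mset k 3 + {#1, 1, 1#}"])
      (auto split: if_splits)
  then obtain x y :: nat where xy: "d = x\<^sup>2 + x * y + y\<^sup>2" using norm_form_nonneg by blast
  have "[d = 0] (mod 3)" unfolding d cong_def by presburger
  then have "[x = y] (mod 3)" using xy norm_form_mod_3(1)[of x y] by blast
  then show ?R using norm_form_div_3[OF xy] by blast
next
  assume ?R
  then obtain x y :: nat where xy: "d = 3 * (x\<^sup>2 + 3 * x * y + 3 * y\<^sup>2)" by blast
  define m where "m = eis (int (x + y)) (- int y)"
  define l where "l = (1 - omega) * m"
  have "(cmod l)\<^sup>2 = 3 * (cmod m)\<^sup>2"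
    by (simp add: l_def norm_mult power_mult_distrib norm_one_minus_omega)
  also have "\<dots> = of_nat d"
    unfolding m_def norm_eis xy by (simp add: power2_eq_square algebra_simps)
  finally have n: "of_nat d = (cmod l)\<^sup>2" by simp
  have m: "m \<in> Eisenstein" by (simp add: m_def)
  have "l \<noteq> 0" using n d by auto
  moreover have "l \<in> Eisenstein" unfolding l_def using m by (intro Eisenstein_mult Eisenstein_diff) auto
  ultimately interpret lattes triangle_projection l by unfold_locales
  show "realizable ?S ?S d ?Ps" by (rule realizable_ramified_at_cone_points[OF n d k m l_def])
qed

theorem theorem3p6:
  fixes X :: "'a topology" and Y :: "'b topology"
    and d :: nat and Ps :: "nat multiset multiset"
  shows
    "(candidate_branched_cover X Y d Ps \<and>
        same_orbifold (induced_total X Ps) S333 \<and> same_orbifold (induced_base Y Ps) S333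
      \<longleftrightarrow>
      X homeomorphic_space sphere2 \<and> Y homeomorphic_space sphere2 \<and>
      (\<exists>k\<ge>1.
         d = 3 * k + 1 \<and>
           Ps = {# replicate_mset k 3 + {#1#}, replicate_mset k 3 + {#1#},
                   replicate_mset k 3 + {#1#} #} \<or>
         d = 3 * k + 3 \<and>
           Ps = {# replicate_mset (k + 1) 3, replicate_mset (k + 1) 3,
                   replicate_mset k 3 + {#1, 1, 1#} #}))
     \<and>
     (\<forall>k\<ge>1.
        X homeomorphic_space sphere2 \<and> Y homeomorphic_space sphere2 \<and> d = 3 * k + 1 \<and>
        Ps = {# replicate_mset k 3 + {#1#}, replicate_mset k 3 + {#1#},
                replicate_mset k 3 + {#1#} #}
        \<longrightarrow>
        (realizable X Y d Ps \<longleftrightarrow>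
           (\<exists>x y :: nat. d = x\<^sup>2 + x * y + y\<^sup>2 \<and> \<not> [x = y] (mod 3))))
     \<and>
     (\<forall>k\<ge>1.
        X homeomorphic_space sphere2 \<and> Y homeomorphic_space sphere2 \<and> d = 3 * k + 3 \<and>
        Ps = {# replicate_mset (k + 1) 3, replicate_mset (k + 1) 3,
                replicate_mset k 3 + {#1, 1, 1#} #}
        \<longrightarrow>
        (realizable X Y d Ps \<longleftrightarrow>
           (\<exists>x y :: nat. d = 3 * (x\<^sup>2 + 3 * x * y + 3 * y\<^sup>2))))"
  by (intro conjI candidate_S333_iff allI impI)
    (elim conjE, simp only: realizable_sphere_iff realizable_3k1_iff realizable_3k3_iff)+

end
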